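(* Let $S=\mathbb{K}[x_1,\ldots,x_n]$ be a polynomial ring over a field $\mathbb{K}$, and let $I=(u_1,u_2,x_1^{e_1},\ldots,x_n^{e_n})$, where $u_1=x_1^{a_1}\cdots x_n^{a_n}$ and $u_2=x_1^{b_1}\cdots x_n^{b_n}$ are monomials, neither dividing the other and neither a pure power of a variable, with $a_i+b_i>0$ and $e_i>\max\{a_i,b_i\}$ for all $i\in[n]$. Let $\mathcal{A}$ be the homogeneous matching of $G_I$ and $P_1,P_2,A,B$ the sets defined in the context. Then for every $i\ge 0$ and every monomial $\mathbf{u}$, $$\beta_{i,\mathbf{u}}(I)=\begin{cases}1 & \text{if } \mathbf{u}\in\{\mathbf{m}_T: T \text{ is an } \mathcal{A}\text{-critical vertex of } G_I^{\mathcal{A}} \text{ with } |T|=i+1\},\\ 0&\text{otherwise.}\end{cases}$$ In particular, the Cohen-Macaulay type of $S/I$ is $|A\cap B|+|P_1||P_2|$.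
   Context: $\beta_{i,\mathbf{u}}(I)$ is the multigraded Betti number: the number of copies of the free module $S(\mathbf{u})$ (generator in multidegree $\mathbf{u}$) in homological degree $i$ of the minimal multigraded free resolution of $I$ (homological degree $0$ corresponds to the generators of $I$). For a Cohen-Macaulay quotient $S/M$ of projective dimension $\rho$, the Cohen-Macaulay type is $\beta_\rho(S/M)$. Index the generators of $I$ by $[n+2]=\{1,\ldots,n+2\}$: generator $1$ is $u_1$, generator $2$ is $u_2$, and generator $i+2$ is $x_i^{e_i}$ for $i\in[n]$. For $T\subseteq[n+2]$, $\mathbf{m}_T$ is the lcm of the generators indexed by $T$, with $\mathbf{m}_\varnothing=1$. $G_I$ is the directed graph with vertex set $2^{[n+2]}$ and an edge $(T,T')$ from $T$ to $T'$ whenever $T'\subseteq T$ and $|T|=|T'|+1$; vertex $T$ is labeled $\mathbf{m}_T$. For a matching $\mathcal{A}$ (set of edges no two sharing a vertex), $G_I^{\mathcal{A}}$ is obtained from $G_I$ by reversing the edges in $\mathcal{A}$, and a vertex is $\mathcal{A}$-critical if it lies in no edge of $\mathcal{A}$. Put $P_0=\{i+2: a_i=b_i\}$, $P_1=\{i+2: a_i>b_i\}$, $P_2=\{i+2: a_i<b_i\}$, $A=\{i+2: a_i>0\}$, $B=\{i+2: b_i>0\}$ ($i$ ranging over $[n]$). The matching $\mathcal{A}$ consists of the following edges of $G_I$: (1) $(T,T\setminus\{1\})$ with $1\in T$, $2\in T$, $P_1\subseteq T$; (2) $(T,T\setminus\{2\})$ with $1\in T$, $2\in T$, $P_1\not\subseteq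 T$, $P_2\subseteq T$; (3) $(T,T\setminus\{1\})$ with $1\in T$, $2\notin T$, $A\subseteq T$; (4) $(T,T\setminus\{2\})$ with $1\notin T$, $2\in T$, $B\subseteq T$, $T\ne[n+2]\setminus\{1\}$. *)

theory Defs
  imports
    Main
    "HOL-Library.Poly_Mapping"
    "HOL-Library.Extended_Nat"
    "HOL-Algebra.Ideal"
begin

text \<open>
  Polynomials are finitely supported functions from exponent vectors to coefficients, with the
  convolution product of \<^theory>\<open>HOL-Library.Poly_Mapping\<close>. A monomial is identified with its
  exponent vector throughout: multidegrees and labels are exponent vectors, the product of
  monomials is +, and the monomial 1 is the exponent vector 0.
\<close>

type_synonym expo = "nat \<Rightarrow>\<^sub>0 nat"
type_synonym 'k mpoly = "expo \<Rightarrow>\<^sub>0 'k"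

definition expos :: "nat \<Rightarrow> expo set" where
  "expos n = {m. Poly_Mapping.keys m \<subseteq> {1..n}}"

definition xpow :: "expo \<Rightarrow> 'k::field mpoly" where
  "xpow m = Poly_Mapping.single m 1"

text \<open>The ring K[x_1,...,x_n]:\<close>

definition polyring :: "nat \<Rightarrow> 'k::field mpoly ring" where
  "polyring n = \<lparr>carrier = {p. Poly_Mapping.keys p \<subseteq> expos n}, mult = (*), one = 1, zero = 0, add = (+)\<rparr>"

definition max_ideal :: "nat \<Rightarrow> 'k::field mpoly set" where
  "max_ideal n = genideal (polyring n) ((\<lambda>i. xpow (Poly_Mapping.single i 1)) ` {1..n})"


section \<open>Multigraded free resolutions and Betti numbers\<close>

text \<open>
  A complex of multigraded free modules of finite rank together with an augmentation. The list
  \<open>degs F i\<close> contains the multidegrees of a basis of the module \<open>F_i\<close>; the differential maps the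
  j-th basis element of \<open>F_(i+1)\<close> to the combination with coefficients \<open>dmat F i j k\<close> of the basis
  elements (index k) of \<open>F_i\<close>; the augmentation maps the j-th basis element of \<open>F_0\<close> to (the class
  of) \<open>aug F j\<close>. Values at indices out of range are irrelevant.
\<close>

record (overloaded) 'k free_cpx =
  degs :: "nat \<Rightarrow> expo list"
  dmat :: "nat \<Rightarrow> nat \<Rightarrow> nat \<Rightarrow> 'k mpoly"
  aug :: "nat \<Rightarrow> 'k mpoly"

definition free_mod :: "nat \<Rightarrow> 'k::field free_cpx \<Rightarrow> nat \<Rightarrow> (nat \<Rightarrow> 'k mpoly) set" where
  "free_mod n F i = {v. (\<forall>j < length (degs F i). v j \<in> carrier (polyring n)) \<and>
                        (\<forall>j \<ge> length (degs F i). v j = 0)}"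

definition bd :: "'k::field free_cpx \<Rightarrow> nat \<Rightarrow> (nat \<Rightarrow> 'k mpoly) \<Rightarrow> nat \<Rightarrow> 'k mpoly" where
  "bd F i v = (\<lambda>k. if k < length (degs F i)
                   then \<Sum>j < length (degs F (Suc i)). v j * dmat F i j k else 0)"

definition aug_map :: "'k::field free_cpx \<Rightarrow> (nat \<Rightarrow> 'k mpoly) \<Rightarrow> 'k mpoly" where
  "aug_map F v = (\<Sum>j < length (degs F 0). v j * aug F j)"

text \<open>All basis elements lie in degrees of \<open>\<nat>^n\<close>, and all maps are homogeneous of degree 0.\<close>

definition multigraded :: "nat \<Rightarrow> 'k::field free_cpx \<Rightarrow> bool" where
  "multigraded n F \<longleftrightarrow>
     (\<forall>i. set (degs F i) \<subseteq> expos n) \<and>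
     (\<forall>i. \<forall>j < length (degs F (Suc i)). \<forall>k < length (degs F i).
        dmat F i j k \<in> carrier (polyring n) \<and>
        (\<forall>m \<in> Poly_Mapping.keys (dmat F i j k). m + degs F i ! k = degs F (Suc i) ! j)) \<and>
     (\<forall>j < length (degs F 0). Poly_Mapping.keys (aug F j) \<subseteq> {degs F 0 ! j})"

text \<open>
  \<open>F\<close> is a multigraded free resolution of the multigraded module \<open>M/N\<close>, where \<open>N \<subseteq> M\<close> are monomial
  ideals. This covers an ideal \<open>I\<close> (as \<open>I/{0}\<close>) and a quotient \<open>S/I\<close> at once. The augmentation
  into \<open>M/N\<close> is given by homogeneous representatives in \<open>M\<close>. The last three conjuncts are
  surjectivity of the augmentation, exactness at \<open>F_0\<close>, and exactness at \<open>F_(i+1)\<close>.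
\<close>

definition free_resolution ::
    "nat \<Rightarrow> 'k::field mpoly set \<Rightarrow> 'k mpoly set \<Rightarrow> 'k free_cpx \<Rightarrow> bool" where
  "free_resolution n M N F \<longleftrightarrow>
     multigraded n F \<and>
     (\<forall>j < length (degs F 0). aug F j \<in> M) \<and>
     (\<forall>p \<in> M. \<exists>v \<in> free_mod n F 0. p - aug_map F v \<in> N) \<and>
     {v \<in> free_mod n F 0. aug_map F v \<in> N} = bd F 0 ` free_mod n F 1 \<and>
     (\<forall>i. {v \<in> free_mod n F (Suc i). bd F i v = (\<lambda>k. 0)} = bd F (Suc i) ` free_mod n F (Suc (Suc i)))"

text \<open>Minimality says that the differential maps \<open>F_(i+1)\<close> into \<open>(x_1,...,x_n) F_i\<close>.\<close>

definition minimal_free_resolution ::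
    "nat \<Rightarrow> 'k::field mpoly set \<Rightarrow> 'k mpoly set \<Rightarrow> 'k free_cpx \<Rightarrow> bool" where
  "minimal_free_resolution n M N F \<longleftrightarrow>
     free_resolution n M N F \<and>
     (\<forall>i. \<forall>j < length (degs F (Suc i)). \<forall>k < length (degs F i). dmat F i j k \<in> max_ideal n)"

definition betti_mg ::
    "nat \<Rightarrow> 'k::field mpoly set \<Rightarrow> 'k mpoly set \<Rightarrow> nat \<Rightarrow> expo \<Rightarrow> nat" where
  "betti_mg n M N i u =
     (THE r. \<exists>F. minimal_free_resolution n M N F \<and> r = count_list (degs F i) u)"

definition betti :: "nat \<Rightarrow> 'k::field mpoly set \<Rightarrow> 'k mpoly set \<Rightarrow> nat \<Rightarrow> nat" where
  "betti n M N i =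
     (THE r. \<exists>F. minimal_free_resolution n M N F \<and> r = length (degs F i))"

text \<open>Multigraded finitely generated projective modules are free, so free resolutions suffice.\<close>

definition proj_dim :: "nat \<Rightarrow> 'k::field mpoly set \<Rightarrow> 'k mpoly set \<Rightarrow> nat" where
  "proj_dim n M N = (LEAST d. \<exists>F. free_resolution n M N F \<and> (\<forall>i > d. degs F i = []))"


section \<open>Cohen-Macaulay quotients and their type\<close>

definition krull_dim :: "nat \<Rightarrow> 'k::field mpoly set \<Rightarrow> enat" where
  "krull_dim n M = Sup {enat d | d. \<exists>P :: nat \<Rightarrow> 'k mpoly set.
     (\<forall>j \<le> d. primeideal (P j) (polyring n) \<and> M \<subseteq> P j) \<and> (\<forall>j < d. P j \<subset> P (Suc j))}"

definition regular_seq :: "nat \<Rightarrow> 'k::field mpoly set \<Rightarrow> 'k mpoly list \<Rightarrow> bool" where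
  "regular_seq n M fs \<longleftrightarrow>
     set fs \<subseteq> carrier (polyring n) \<and>
     genideal (polyring n) (M \<union> set fs) \<noteq> carrier (polyring n) \<and>
     (\<forall>j < length fs. \<forall>g \<in> carrier (polyring n).
        fs ! j * g \<in> genideal (polyring n) (M \<union> set (take j fs)) \<longrightarrow>
        g \<in> genideal (polyring n) (M \<union> set (take j fs)))"

text \<open>Depth of \<open>S/M\<close> with respect to the graded maximal ideal:\<close>

definition depth :: "nat \<Rightarrow> 'k::field mpoly set \<Rightarrow> enat" where
  "depth n M = Sup {enat (length fs) | fs. regular_seq n M fs \<and> set fs \<subseteq> max_ideal n}"

text \<open>For a proper monomial ideal \<open>M\<close>, the quotient \<open>S/M\<close> is Cohen-Macaulay:\<close>

definition cohen_macaulay :: "nat \<Rightarrow> 'k::field mpoly set \<Rightarrow> bool" where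
  "cohen_macaulay n M \<longleftrightarrow> M \<noteq> carrier (polyring n) \<and> depth n M = krull_dim n M"

definition cm_type :: "nat \<Rightarrow> 'k::field mpoly set \<Rightarrow> nat" where
  "cm_type n M =
     betti n (carrier (polyring n)) M (proj_dim n (carrier (polyring n)) M)"


section \<open>The graph of the generators and the matching\<close>

text \<open>
  In this section \<open>a\<close> and \<open>b\<close> are the exponent vectors of \<open>u_1\<close> and \<open>u_2\<close>, and \<open>e i\<close> is the
  exponent of the generator \<open>x_i^(e_i)\<close>, which has index \<open>i + 2\<close>.
\<close>

definition gen :: "expo \<Rightarrow> expo \<Rightarrow> (nat \<Rightarrow> nat) \<Rightarrow> nat \<Rightarrow> expo" where
  "gen a b e k = (if k = 1 then a else if k = 2 then b
                  else Poly_Mapping.single (k - 2) (e (k - 2)))"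

definition lcm_label :: "nat \<Rightarrow> expo \<Rightarrow> expo \<Rightarrow> (nat \<Rightarrow> nat) \<Rightarrow> nat set \<Rightarrow> expo" where
  "lcm_label n a b e T =
     (\<Sum>i\<in>{1..n}. Poly_Mapping.single i
        (Max (insert 0 ((\<lambda>k. Poly_Mapping.lookup (gen a b e k) i) ` T))))"

definition graph_vertices :: "nat \<Rightarrow> nat set set" where
  "graph_vertices n = Pow {1..n+2}"

definition graph_edges :: "nat \<Rightarrow> (nat set \<times> nat set) set" where
  "graph_edges n = {(T, T'). T \<in> graph_vertices n \<and> T' \<subseteq> T \<and> card T = card T' + 1}"

definition set_P1 :: "nat \<Rightarrow> expo \<Rightarrow> expo \<Rightarrow> nat set" where
  "set_P1 n a b = {i + 2 | i. i \<in> {1..n} \<and> Poly_Mapping.lookup a i > Poly_Mapping.lookup b i}"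

definition set_P2 :: "nat \<Rightarrow> expo \<Rightarrow> expo \<Rightarrow> nat set" where
  "set_P2 n a b = {i + 2 | i. i \<in> {1..n} \<and> Poly_Mapping.lookup a i < Poly_Mapping.lookup b i}"

definition set_A :: "nat \<Rightarrow> expo \<Rightarrow> nat set" where
  "set_A n a = {i + 2 | i. i \<in> {1..n} \<and> Poly_Mapping.lookup a i > 0}"

definition set_B :: "nat \<Rightarrow> expo \<Rightarrow> nat set" where
  "set_B n b = {i + 2 | i. i \<in> {1..n} \<and> Poly_Mapping.lookup b i > 0}"

definition matching :: "nat \<Rightarrow> expo \<Rightarrow> expo \<Rightarrow> (nat set \<times> nat set) set" where
  "matching n a b = {(T, T') \<in> graph_edges n.
     (T' = T - {1} \<and> 1 \<in> T \<and> 2 \<in> T \<and> set_P1 n a b \<subseteq> T) \<or>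
     (T' = T - {2} \<and> 1 \<in> T \<and> 2 \<in> T \<and> \<not> set_P1 n a b \<subseteq> T \<and> set_P2 n a b \<subseteq> T) \<or>
     (T' = T - {1} \<and> 1 \<in> T \<and> 2 \<notin> T \<and> set_A n a \<subseteq> T) \<or>
     (T' = T - {2} \<and> 1 \<notin> T \<and> 2 \<in> T \<and> set_B n b \<subseteq> T \<and> T \<noteq> {1..n+2} - {1})}"

text \<open>
  Reversing the edges of a matching does not change the vertices of the graph, nor which vertices
  lie on a matching edge.
\<close>

definition critical :: "nat \<Rightarrow> (nat set \<times> nat set) set \<Rightarrow> nat set \<Rightarrow> bool" where
  "critical n E T \<longleftrightarrow> T \<in> graph_vertices n \<and> (\<forall>(T1, T2) \<in> E. T \<noteq> T1 \<and> T \<noteq> T2)"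

end

theory Submission
  imports Defs
begin

text \<open>
  The Taylor complex of the generators is a free resolution of \<open>S/I\<close> whose matched pairs have equal
  labels, so their entries in the differential are units and Gaussian elimination removes the
  pairs one at a time. An elimination changes an entry between two vertices of equal label only if
  these vertices and the eliminated pair all have that label; since at most the four sets
  \<open>Q\<close>, \<open>Q \<union> {1}\<close>, \<open>Q \<union> {2}\<close>, \<open>Q \<union> {1, 2}\<close> share a label, this never happens. What is left is
  supported on the critical vertices, has no unit entries because equal labels of adjacent critical
  vertices do not occur, and critical vertices of the same size have distinct labels.

  Betti numbers are well defined, and \<open>S/I\<close> has projective dimension \<open>n\<close>, because a minimal
  resolution is a homotopy retract of every other one, and the homotopy term \<open>dh + hd\<close> vanishes modulo
  the maximal ideal. All of this is done over the field: in each multidegree \<open>u\<close> a multigraded complex is a complex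
  of vector spaces on the basis elements whose degree divides \<open>u\<close>. Finally \<open>S/I\<close> is Artinian, hence
  of depth and dimension zero.
\<close>

section \<open>Linear algebra: cancelling a pair of basis elements\<close>

text \<open>The label of a set determines its pure part \<open>Q\<close> because \<open>e i\<close>
  exceeds both exponents at \<open>i\<close>: a label shows the exponent \<open>e i\<close> only if
  \<open>x_i^(e_i)\<close> is in the set. Hence all elimination happens inside the square over one
  \<open>Q\<close>, and it may proceed in any order, with no acyclicity argument as in discrete
  Morse theory. Multiplicity above 1 could only come from the corners \<open>Q \<union> {1}\<close>
  and \<open>Q \<union> {2}\<close>; if their labels agree, then \<open>P1\<close> lies in
  \<open>Q\<close> and the second corner is matched. It is \<open>S/I\<close> that gets resolved,
  since a degree outside \<open>I\<close> then sees only the empty set. Dropping the module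
  \<open>S\<close> in homological degree 0 leaves a resolution of \<open>I\<close>, whence the
  condition \<open>card T = i + 1\<close>. The type counts the critical sets of size
  \<open>n\<close> through the two indices they omit: one from \<open>P1\<close> and one from
  \<open>P2\<close>, or one \<open>x\<close> from \<open>A \<inter> B\<close> together with 1 if
  \<open>x\<close> is in \<open>P1\<close> and with 2 otherwise. Neither monomial divides the other,
  so \<open>P1\<close> and \<open>P2\<close> are nonempty and the size \<open>n\<close> really
  occurs.\<close>

definition lin :: "'a set \<Rightarrow> ('a \<Rightarrow> 'b \<Rightarrow> 'k) \<Rightarrow> ('a \<Rightarrow> 'k) \<Rightarrow> 'b \<Rightarrow> 'k::comm_ring" where
  "lin J M v = (\<lambda>k. \<Sum>j\<in>J. v j * M j k)"

definition supported :: "'a set \<Rightarrow> ('a \<Rightarrow> 'k::zero) \<Rightarrow> bool" where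
  "supported D v \<longleftrightarrow> (\<forall>j. j \<notin> D \<longrightarrow> v j = 0)"

text \<open>Vectors are rows and \<open>M j\<close> is the image of the basis element
  \<open>j\<close>, as in \<open>bd\<close>; row \<open>j\<close> of a composite is therefore the
  image of \<open>M j\<close>.\<close>

lemma lin_lin: "lin K N (lin J M v) = lin J (\<lambda>j. lin K N (M j)) v"
proof
  fix l
  have "lin K N (lin J M v) l = (\<Sum>k\<in>K. \<Sum>j\<in>J. v j * (M j k * N k l))"
    by (simp add: lin_def sum_distrib_right mult.assoc)
  also have "\<dots> = (\<Sum>j\<in>J. \<Sum>k\<in>K. v j * (M j k * N k l))"
    by (rule sum.swap)
  also have "\<dots> = lin J (\<lambda>j. lin K N (M j)) v l"
    by (simp add: lin_def sum_distrib_left)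
  finally show "lin K N (lin J M v) l = lin J (\<lambda>j. lin K N (M j)) v l" .
qed

lemma lin_diff: "lin J M (\<lambda>j. v j - w j) k = lin J M v k - lin J M w k"
  by (simp add: lin_def left_diff_distrib sum_subtractf)

lemma lin_scale: "lin J M (\<lambda>j. s * v j) k = s * lin J M v k"
  by (simp add: lin_def sum_distrib_left mult.assoc)

lemma lin_zero: "lin J M (\<lambda>j. 0) = (\<lambda>k. 0)"
  by (simp add: lin_def)

lemma lin_unit:
  fixes M :: "'a \<Rightarrow> 'b \<Rightarrow> 'k::comm_ring_1"
  assumes "finite J" "p \<in> J"
  shows "lin J M (\<lambda>j. if j = p then 1 else 0) = M p"
proof
  fix k
  have "lin J M (\<lambda>j. if j = p then 1 else 0) k = (\<Sum>j\<in>J. if j = p then M p k else 0)"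
    unfolding lin_def by (rule sum.cong) auto
  then show "lin J M (\<lambda>j. if j = p then 1 else 0) k = M p k"
    using assms by simp
qed

lemma lin_cong: "(\<And>j. j \<in> J \<Longrightarrow> v j = w j) \<Longrightarrow> lin J M v = lin J M w"
  by (auto simp: lin_def intro!: ext sum.cong)

lemma lin_remove2:
  assumes "finite V" "p \<in> V" "q \<in> V" "p \<noteq> q"
  shows "lin V M w k = lin (V - {p, q}) M w k + w p * M p k + w q * M q k"
proof -
  have "V = insert p (insert q (V - {p, q}))" using assms by auto
  then have "lin V M w k = (\<Sum>j\<in>insert p (insert q (V - {p, q})). w j * M j k)"
    by (simp add: lin_def)
  also have "\<dots> = lin (V - {p, q}) M w k + w p * M p k + w q * M q k"
    using assms by (simp add: lin_def algebra_simps)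
  finally show ?thesis .
qed

definition square_zero :: "'a set \<Rightarrow> ('a \<Rightarrow> 'a \<Rightarrow> 'k::comm_ring) \<Rightarrow> bool" where
  "square_zero V c \<longleftrightarrow> (\<forall>j\<in>V. \<forall>l\<in>V. lin V c (c j) l = 0)"

text \<open>\<open>D\<close> is meant to span a subcomplex. Homological degrees are not separated,
  and only one inclusion is demanded: cycles are boundaries.\<close>

definition exact_on :: "'a set \<Rightarrow> ('a \<Rightarrow> 'a \<Rightarrow> 'k::comm_ring) \<Rightarrow> 'a set \<Rightarrow> bool" where
  "exact_on V c D \<longleftrightarrow> (\<forall>v. supported D v \<longrightarrow> (\<forall>k\<in>V. lin V c v k = 0) \<longrightarrow>
     (\<exists>w. supported D w \<and> (\<forall>k\<in>V. lin V c w k = v k)))"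

text \<open>The Schur complement of the pivot \<open>c p q\<close>: the differential after splitting
  off the contractible summand spanned by \<open>p\<close> and its boundary.\<close>

definition cancel :: "('a \<Rightarrow> 'a \<Rightarrow> 'k::field) \<Rightarrow> 'a \<Rightarrow> 'a \<Rightarrow> 'a \<Rightarrow> 'a \<Rightarrow> 'k" where
  "cancel c p q = (\<lambda>j k. c j k - c j q * c p k / c p q)"

lemma lin_cancel:
  "lin V (cancel c p q) w k = lin V c w k - lin V c w q * c p k / c p q"
  by (simp add: lin_def cancel_def right_diff_distrib sum_subtractf sum_distrib_right
      sum_divide_distrib mult.assoc)

text \<open>Row \<open>j\<close> of the new matrix is the old boundary of \<open>j\<close> corrected
  by a multiple of \<open>p\<close> that clears the \<open>q\<close> component. Being a boundary it
  is a cycle, and the part of its boundary due to its \<open>p\<close> component is what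
  \<open>cancel\<close> subtracts.\<close>

lemma square_zero_cancel:
  assumes fin: "finite V" and pq: "p \<in> V" "q \<in> V" "p \<noteq> q" and unit: "c p q \<noteq> 0"
    and sq: "square_zero V c"
  shows "square_zero (V - {p, q}) (cancel c p q)"
  unfolding square_zero_def
proof (intro ballI)
  fix j l assume j: "j \<in> V - {p, q}" and l: "l \<in> V - {p, q}"
  let ?x = "cancel c p q j"
  have x: "?x = (\<lambda>k. c j k - (c j q / c p q) * c p k)"
    by (simp add: cancel_def)
  have cyc: "lin V c ?x k = 0" if "k \<in> V" for k
    unfolding x lin_diff lin_scale using sq that j pq by (simp add: square_zero_def)
  have xq: "?x q = 0" using unit by (simp add: cancel_def)
  have r: "lin (V - {p, q}) c ?x k = - ?x p * c p k" if "k \<in> V" for k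
    using cyc[OF that] lin_remove2[OF fin pq, of c ?x k] xq by (simp add: eq_neg_iff_add_eq_0)
  show "lin (V - {p, q}) (cancel c p q) ?x l = 0"
    using r[of l] r[of q] l pq unit by (simp add: lin_cancel)
qed

text \<open>A cycle of the reduced complex is lifted to a cycle of the old one, bounded there, and
  the bounding vector is moved off \<open>p\<close> and \<open>q\<close>. The condition
  \<open>pqD\<close> keeps both corrections, which involve \<open>p\<close>, inside the
  subcomplex.\<close>

lemma exact_on_cancel:
  assumes fin: "finite V" and pq: "p \<in> V" "q \<in> V" "p \<noteq> q" and unit: "c p q \<noteq> 0"
    and sq: "square_zero V c" and DV: "D \<subseteq> V" and closed: "\<And>j k. j \<in> D \<Longrightarrow> k \<in> V \<Longrightarrow> c j k \<noteq> 0 \<Longrightarrow> k \<in> D"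
    and pqD: "q \<in> D \<Longrightarrow> p \<in> D" and ex: "exact_on V c D"
  shows "exact_on (V - {p, q}) (cancel c p q) (D - {p, q})"
  unfolding exact_on_def
proof (intro allI impI)
  fix v :: "'a \<Rightarrow> 'b"
  assume sup: "supported (D - {p, q}) v"
    and cyc: "\<forall>k\<in>V - {p, q}. lin (V - {p, q}) (cancel c p q) v k = 0"
  let ?V' = "V - {p, q}"
  \<comment> \<open>The multiple of \<open>p\<close> for which the boundary of
    \<open>v - s p\<close> has no \<open>q\<close> component.\<close>
  define s where "s = lin ?V' c v q / c p q"
  define v1 where "v1 = (\<lambda>j. if j = p then - s else v j)"
  have vpq: "v p = 0" "v q = 0" using sup by (auto simp: supported_def)
  have v1lin: "lin V c v1 k = lin ?V' c v k - s * c p k" for k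
  proof -
    have "lin ?V' c v1 k = lin ?V' c v k"
      by (rule fun_cong[OF lin_cong]) (auto simp: v1_def)
    then show ?thesis
      using lin_remove2[OF fin pq, of c v1 k] pq vpq by (simp add: v1_def)
  qed
  have v1q: "lin V c v1 q = 0" using unit by (simp add: v1lin s_def)
  have v1k: "lin V c v1 k = 0" if "k \<in> ?V'" for k
    using cyc that by (simp add: v1lin lin_cancel s_def)
  \<comment> \<open>The boundary of \<open>v1\<close> can only live at \<open>p\<close>. Applying
    the differential once more and reading the \<open>q\<close> entry gives that coefficient times
    the unit \<open>c p q\<close>.\<close>
  have "lin V c (lin V c v1) q = 0"
    unfolding lin_lin using sq pq by (simp add: lin_def[of V "\<lambda>j. lin V c (c j)"] square_zero_def)
  moreover have "lin V c (lin V c v1) q = lin V c v1 p * c p q"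
  proof -
    have "lin ?V' c (lin V c v1) q = 0" unfolding lin_def[of ?V'] using v1k by simp
    then show ?thesis using lin_remove2[OF fin pq, of c "lin V c v1" q] v1q by simp
  qed
  ultimately have v1p: "lin V c v1 p = 0" using unit by simp
  have v1cyc: "\<forall>k\<in>V. lin V c v1 k = 0" using v1k v1p v1q by blast
  \<comment> \<open>If \<open>p\<close> is outside \<open>D\<close>, so is \<open>q\<close>, and a
    vector supported on the closed set \<open>D\<close> has no boundary at \<open>q\<close>; so
    \<open>v1\<close> needs no \<open>p\<close> component.\<close>
  have "s = 0" if "p \<notin> D"
  proof -
    have "v j * c j q = 0" if "j \<in> ?V'" for j
      using closed[of j q] pq pqD \<open>p \<notin> D\<close> sup by (cases "j \<in> D") (auto simp: supported_def)
    then show ?thesis by (simp add: s_def lin_def sum.neutral)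
  qed
  then have "supported D v1" using sup by (auto simp: supported_def v1_def)
  then obtain w where w: "supported D w" "\<forall>k\<in>V. lin V c w k = v1 k"
    using ex v1cyc unfolding exact_on_def by blast
  \<comment> \<open>Subtracting a multiple of the boundary of \<open>p\<close> clears the
    \<open>q\<close> component and leaves the image unchanged. The guard is there because the values
    of \<open>c p\<close> outside \<open>V\<close> are arbitrary.\<close>
  define w2 where "w2 = (\<lambda>j. w j - (w q / c p q) * (if j \<in> V then c p j else 0))"
  have w2q: "w2 q = 0" using unit pq by (simp add: w2_def)
  have w2sup: "w2 j = 0" if "j \<notin> D" for j
  proof (cases "q \<in> D \<and> j \<in> V")
    case True
    then show ?thesis using closed[of p j] pqD that w(1) by (auto simp: w2_def supported_def)
  next
    case False
    then show ?thesis using that w(1) by (auto simp: w2_def supported_def)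
  qed
  have w2lin: "lin V c w2 k = v1 k" if "k \<in> V" for k
  proof -
    have "lin V c (\<lambda>j. if j \<in> V then c p j else 0) = lin V c (c p)" by (rule lin_cong) simp
    then show ?thesis
      unfolding w2_def lin_diff lin_scale using w sq that pq by (simp add: square_zero_def)
  qed
  \<comment> \<open>Dropping the \<open>p\<close> component changes the image by a multiple of
    \<open>c p\<close>, and row \<open>p\<close> is exactly what the reduced differential
    annihilates.\<close>
  define w3 where "w3 = (\<lambda>j. if j = p then 0 else w2 j)"
  have w3: "lin ?V' c w3 k = v1 k - w2 p * c p k" if "k \<in> V" for k
  proof -
    have "lin ?V' c w3 k = lin ?V' c w2 k"
      by (rule fun_cong[OF lin_cong]) (auto simp: w3_def)
    then show ?thesis
      using lin_remove2[OF fin pq, of c w2 k] w2q w2lin[OF that] by (simp add: algebra_simps)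
  qed
  have "lin ?V' (cancel c p q) w3 k = v k" if "k \<in> ?V'" for k
    using w3[of k] w3[of q] that pq unit vpq by (simp add: lin_cancel v1_def)
  moreover have "supported (D - {p, q}) w3"
    using w2sup w2q by (auto simp: supported_def w3_def)
  ultimately show "\<exists>w. supported (D - {p, q}) w \<and> (\<forall>k\<in>?V'. lin ?V' (cancel c p q) w k = v k)"
    by blast
qed

section \<open>The Taylor complex\<close>

abbreviation (input) lookup :: "('a \<Rightarrow>\<^sub>0 'b::zero) \<Rightarrow> 'a \<Rightarrow> 'b" where
  "lookup \<equiv> Poly_Mapping.lookup"

abbreviation (input) keys :: "('a \<Rightarrow>\<^sub>0 'b::zero) \<Rightarrow> 'a set" where
  "keys \<equiv> Poly_Mapping.keys"

abbreviation (input) single :: "'a \<Rightarrow> 'b \<Rightarrow> 'a \<Rightarrow>\<^sub>0 'b::zero" where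
  "single \<equiv> Poly_Mapping.single"

section \<open>Divisibility of monomials as an order on exponent vectors\<close>

definition expo_le :: "expo \<Rightarrow> expo \<Rightarrow> bool" (infix \<open>\<preceq>\<close> 50) where
  "m \<preceq> m' \<longleftrightarrow> (\<forall>i. lookup m i \<le> lookup m' i)"

lemma expo_le_refl [simp]: "m \<preceq> m"
  by (simp add: expo_le_def)

lemma expo_le_trans [trans]: "m \<preceq> m' \<Longrightarrow> m' \<preceq> m'' \<Longrightarrow> m \<preceq> m''"
  unfolding expo_le_def using order_trans by blast

lemma expo_le_antisym: "m \<preceq> m' \<Longrightarrow> m' \<preceq> m \<Longrightarrow> m = m'"
  by (rule poly_mapping_eqI) (simp add: expo_le_def le_antisym)

lemma expo_le_add [simp]: "m \<preceq> d + m" "m \<preceq> m + d"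
  by (simp_all add: expo_le_def lookup_add)

lemma expo_le_diff_add [simp]: "m \<preceq> m' \<Longrightarrow> m' - m + m = m'"
  by (rule poly_mapping_eqI) (simp add: expo_le_def lookup_add lookup_minus)

lemma expo_le_iff: "m \<preceq> m' \<longleftrightarrow> (\<exists>d. m' = d + m)"
  by (metis expo_le_diff_add expo_le_add(1))

text \<open>
  All homological degrees are merged into one finite basis with one differential; \<open>lev\<close> remembers
  the homological degree. Exactness is required only in the degrees \<open>u \<in> X\<close>, where \<open>S/I\<close> vanishes.
\<close>

definition resolving ::
    "expo set \<Rightarrow> 'v set \<Rightarrow> ('v \<Rightarrow> nat) \<Rightarrow> ('v \<Rightarrow> expo) \<Rightarrow> ('v \<Rightarrow> 'v \<Rightarrow> 'k::field) \<Rightarrow> bool" where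
  "resolving X V lev dg c \<longleftrightarrow> finite V \<and> square_zero V c \<and>
     (\<forall>j\<in>V. \<forall>k\<in>V. c j k \<noteq> 0 \<longrightarrow> lev j = Suc (lev k) \<and> dg k \<preceq> dg j) \<and>
     (\<forall>u\<in>X. exact_on V c {j \<in> V. dg j \<preceq> u})"

text \<open>A new entry from \<open>j\<close> to \<open>k\<close> arises from entries
  \<open>j\<close> to \<open>q\<close> and \<open>p\<close> to \<open>k\<close>. Since
  \<open>p\<close> has the degree of \<open>q\<close> and sits one level above it, levels and
  degrees still fit; for the same reason \<open>p\<close> and \<open>q\<close> enter the strand of
  \<open>u\<close> together.\<close>

lemma resolving_cancel:
  assumes res: "resolving X V lev dg c" and pq: "p \<in> V" "q \<in> V" and dg: "dg p = dg q"
    and unit: "c p q \<noteq> 0"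
  shows "resolving X (V - {p, q}) lev dg (cancel c p q)"
proof -
  have neq: "p \<noteq> q" using res pq unit unfolding resolving_def by force
  have fin: "finite V" and sq: "square_zero V c" using res by (auto simp: resolving_def)
  have gr: "lev j = Suc (lev k) \<and> dg k \<preceq> dg j" if "j \<in> V" "k \<in> V" "c j k \<noteq> 0" for j k
    using res that unfolding resolving_def by blast
  have gr': "lev j = Suc (lev k) \<and> dg k \<preceq> dg j"
    if "j \<in> V" "k \<in> V" "cancel c p q j k \<noteq> 0" for j k
  proof (cases "c j k = 0")
    case True
    then have "c j q \<noteq> 0" "c p k \<noteq> 0" using that(3) by (auto simp: cancel_def)
    with gr[of j q] gr[of p k] gr[of p q] pq that unit dg show ?thesis
      by (metis expo_le_trans old.nat.inject)
  qed (use gr that in blast)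
  have "exact_on (V - {p, q}) (cancel c p q) {j \<in> V - {p, q}. dg j \<preceq> u}" if u: "u \<in> X" for u
  proof -
    have "exact_on (V - {p, q}) (cancel c p q) ({j \<in> V. dg j \<preceq> u} - {p, q})"
    proof (rule exact_on_cancel[OF fin pq neq unit sq])
      show "exact_on V c {j \<in> V. dg j \<preceq> u}" using res u by (simp add: resolving_def)
      show "k \<in> {j \<in> V. dg j \<preceq> u}" if "j \<in> {j \<in> V. dg j \<preceq> u}" "k \<in> V" "c j k \<noteq> 0" for j k
        using gr[of j k] that expo_le_trans by blast
    qed (use pq dg in auto)
    moreover have "{j \<in> V. dg j \<preceq> u} - {p, q} = {j \<in> V - {p, q}. dg j \<preceq> u}" by auto
    ultimately show ?thesis by simp
  qed
  then show ?thesis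
    using square_zero_cancel[OF fin pq neq unit sq] fin gr' by (simp add: resolving_def)
qed

text \<open>The invariant is that entries between equal degrees are the original ones, so every
  pending pivot stays nonzero. The hypothesis \<open>sparse\<close> does the work that acyclicity
  does in discrete Morse theory.\<close>

lemma resolving_matching:
  assumes res: "resolving X V lev dg c" and fin: "finite E" and EV: "E \<subseteq> V \<times> V"
    and disj: "\<And>p q p' q'. (p, q) \<in> E \<Longrightarrow> (p', q') \<in> E \<Longrightarrow> {p, q} \<inter> {p', q'} \<noteq> {} \<Longrightarrow> (p, q) = (p', q')"
    and dg: "\<And>p q. (p, q) \<in> E \<Longrightarrow> dg p = dg q" and unit: "\<And>p q. (p, q) \<in> E \<Longrightarrow> c p q \<noteq> 0"
    and sparse: "\<And>p q j k. (p, q) \<in> E \<Longrightarrow> j \<in> V \<Longrightarrow> k \<in> V \<Longrightarrow> j \<noteq> p \<Longrightarrow> k \<noteq> q \<Longrightarrow>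
       dg j = dg p \<Longrightarrow> dg k = dg p \<Longrightarrow> c j q \<noteq> 0 \<Longrightarrow> c p k \<noteq> 0 \<Longrightarrow> False"
  shows "\<exists>c'. resolving X (V - (fst ` E \<union> snd ` E)) lev dg c' \<and>
     (\<forall>j\<in>V - (fst ` E \<union> snd ` E). \<forall>k\<in>V - (fst ` E \<union> snd ` E). dg j = dg k \<longrightarrow> c' j k = c j k)"
  using fin subset_refl
proof (induction E rule: finite_subset_induct')
  case empty
  then show ?case using res by auto
next
  case (insert e F)
  obtain p q where e: "e = (p, q)" by force
  let ?V = "V - (fst ` F \<union> snd ` F)"
  obtain c' where c': "resolving X ?V lev dg c'"
    and same: "\<And>j k. j \<in> ?V \<Longrightarrow> k \<in> ?V \<Longrightarrow> dg j = dg k \<Longrightarrow> c' j k = c j k"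
    using insert.IH by blast
  have pqE: "(p, q) \<in> E" and pqF: "(p, q) \<notin> F" using insert e by auto
  have pq: "p \<in> ?V" "q \<in> ?V"
  proof -
    have "p \<notin> fst ` F \<union> snd ` F" "q \<notin> fst ` F \<union> snd ` F"
    proof -
      have *: "{p, q} \<inter> {p', q'} = {}" if "(p', q') \<in> F" for p' q'
        using disj[OF pqE, of p' q'] that insert.hyps(3) pqF by auto
      show "p \<notin> fst ` F \<union> snd ` F" "q \<notin> fst ` F \<union> snd ` F"
        using * by fastforce+
    qed
    then show "p \<in> ?V" "q \<in> ?V" using pqE EV by auto
  qed
  have u': "c' p q \<noteq> 0" using same[OF pq] dg[OF pqE] unit[OF pqE] by simp
  have V': "V - (fst ` insert e F \<union> snd ` insert e F) = ?V - {p, q}"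
    by (auto simp: e)
  have "cancel c' p q j k = c j k" if jk: "j \<in> ?V - {p, q}" "k \<in> ?V - {p, q}" "dg j = dg k" for j k
  proof -
    \<comment> \<open>A nonzero correction gives \<open>dg q \<preceq> dg j\<close> and
      \<open>dg k \<preceq> dg p\<close>. With \<open>dg p = dg q\<close> and
      \<open>dg j = dg k\<close> all four degrees coincide, so the invariant reduces the claim to
      \<open>sparse\<close> for the original matrix.\<close>
    have prod0: "c' j q * c' p k = 0"
    proof (rule ccontr)
      assume "c' j q * c' p k \<noteq> 0"
      then have nz: "c' j q \<noteq> 0" "c' p k \<noteq> 0" by auto
      then have le: "dg q \<preceq> dg j" "dg k \<preceq> dg p"
        using c' jk(1,2) pq unfolding resolving_def by blast+
      then have "dg j = dg p" using dg[OF pqE] jk(3) expo_le_antisym by metis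
      then have eqs: "dg j = dg p" "dg k = dg p" "dg j = dg q" "dg p = dg k"
        using dg[OF pqE] jk(3) by auto
      show False
      proof (rule sparse[OF pqE])
        show "c j q \<noteq> 0" "c p k \<noteq> 0"
          using nz same[OF _ pq(2) eqs(3)] same[OF pq(1) _ eqs(4)] jk(1,2) by simp_all
      qed (use jk(1,2) eqs(1,2) in simp_all)
    qed
    have "c' j k = c j k" using same[of j k] jk by blast
    then show ?thesis unfolding cancel_def prod0 by simp
  qed
  then show ?case
    unfolding V' using resolving_cancel[OF c' pq dg[OF pqE] u']
    by (intro exI[of _ "cancel c' p q"] conjI ballI impI) simp_all
qed

section \<open>The Taylor differential: signs, square zero and exactness\<close>

definition taylor_sign :: "nat \<Rightarrow> nat set \<Rightarrow> 'k::comm_ring_1" where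
  "taylor_sign x T = (-1) ^ card {y \<in> T. y < x}"

text \<open>Only the scalar entries; the monomial factors are recovered from the labels. At most one
  summand is nonzero, so the sum merely avoids choosing the removed element.\<close>

definition taylor :: "nat set \<Rightarrow> nat set \<Rightarrow> 'k::comm_ring_1" where
  "taylor T T' = (\<Sum>x\<in>T. if T' = T - {x} then taylor_sign x T else 0)"

lemma taylor_nonzero: "taylor T T' \<noteq> 0 \<Longrightarrow> \<exists>x\<in>T. T' = T - {x}"
  unfolding taylor_def by (rule ccontr) (auto simp: sum.neutral)

lemma taylor_remove:
  assumes "finite T" "x \<in> T"
  shows "taylor T (T - {x}) = taylor_sign x T"
proof -
  have "T - {x} = T - {y} \<longleftrightarrow> y = x" if "y \<in> T" for y using that assms by auto
  then have "taylor T (T - {x}) = (\<Sum>y\<in>T. if y = x then taylor_sign x T else (0::'a))"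
    unfolding taylor_def by (intro sum.cong) auto
  then show ?thesis using assms by simp
qed

lemma taylor_sign_neq_0: "taylor_sign x T \<noteq> (0::'k::field)"
  by (simp add: taylor_sign_def)

lemma taylor_sign_insert_less:
  assumes "finite T" "x \<notin> T" "x < y"
  shows "taylor_sign y (insert x T) = - taylor_sign y T"
proof -
  have "{z \<in> insert x T. z < y} = insert x {z \<in> T. z < y}" using assms by auto
  then show ?thesis using assms by (simp add: taylor_sign_def)
qed

lemma taylor_sign_insert_ge:
  assumes "y \<le> x"
  shows "taylor_sign y (insert x T) = taylor_sign y T"
proof -
  have "{z \<in> insert x T. z < y} = {z \<in> T. z < y}" using assms by auto
  then show ?thesis by (simp add: taylor_sign_def)
qed

lemma lin_taylor_row:
  assumes "finite N" "T \<subseteq> N"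
  shows "lin (Pow N) M (taylor T) l = (\<Sum>x\<in>T. taylor_sign x T * M (T - {x}) l)"
proof -
  have "lin (Pow N) M (taylor T) l =
      (\<Sum>T'\<in>Pow N. \<Sum>x\<in>T. if T' = T - {x} then taylor_sign x T * M T' l else 0)"
    unfolding lin_def taylor_def by (auto simp: sum_distrib_right intro!: sum.cong)
  also have "\<dots> = (\<Sum>x\<in>T. \<Sum>T'\<in>Pow N. if T' = T - {x} then taylor_sign x T * M T' l else 0)"
    by (rule sum.swap)
  also have "\<dots> = (\<Sum>x\<in>T. taylor_sign x T * M (T - {x}) l)"
  proof (rule sum.cong[OF refl])
    fix x assume "x \<in> T"
    then have "T - {x} \<in> Pow N" using assms by auto
    then show "(\<Sum>T'\<in>Pow N. if T' = T - {x} then taylor_sign x T * M T' l else 0) =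
        taylor_sign x T * M (T - {x}) l"
      using assms by (subst sum.delta) auto
  qed
  finally show ?thesis .
qed

text \<open>Removing two elements in either order reaches the same set with opposite signs: removing
  the smaller one first shifts the position of the larger, while the converse order shifts nothing.
  The double sum is therefore split along \<open>x < y\<close>.\<close>

lemma square_zero_taylor:
  assumes fin: "finite N"
  shows "square_zero (Pow N) (taylor :: _ \<Rightarrow> _ \<Rightarrow> 'k::comm_ring_1)"
  unfolding square_zero_def
proof (intro ballI)
  fix T l assume T: "T \<in> Pow N"
  have finT: "finite T" using T fin finite_subset by auto
  define f :: "nat \<Rightarrow> nat \<Rightarrow> 'k" where
    "f x y = (if l = T - {x} - {y} then taylor_sign x T * taylor_sign y (T - {x}) else 0)" for x y
  have anti: "f y x = - f x y" if "x \<in> T" "y \<in> T" "x < y" for x y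
  proof -
    have "taylor_sign y T = - (taylor_sign y (T - {x}) :: 'k)"
      using taylor_sign_insert_less[of "T - {x}" x y] that finT by (simp add: insert_absorb)
    moreover have "taylor_sign x T = (taylor_sign x (T - {y}) :: 'k)"
      using taylor_sign_insert_ge[of x y "T - {y}"] that by (simp add: insert_absorb)
    moreover have "T - {y} - {x} = T - {x} - {y}" by auto
    ultimately show ?thesis by (simp add: f_def)
  qed
  have "lin (Pow N) taylor (taylor T) l = (\<Sum>x\<in>T. \<Sum>y\<in>T - {x}. f x y)"
    unfolding lin_taylor_row[OF fin T[unfolded Pow_iff]]
  proof (intro sum.cong[OF refl])
    fix x
    show "taylor_sign x T * taylor (T - {x}) l = (\<Sum>y\<in>T - {x}. f x y)"
      unfolding taylor_def f_def by (simp add: sum_distrib_left if_distrib cong: if_cong)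
  qed
  also have "\<dots> = (\<Sum>x\<in>T. (\<Sum>y\<in>T. if x < y then f x y else 0) + (\<Sum>y\<in>T. if y < x then f x y else 0))"
  proof (rule sum.cong[OF refl])
    fix x
    have "(\<Sum>y\<in>T - {x}. f x y) = (\<Sum>y\<in>T. if y \<noteq> x then f x y else 0)"
      using finT by (intro sum.mono_neutral_cong_left) auto
    also have "\<dots> = (\<Sum>y\<in>T. (if x < y then f x y else 0) + (if y < x then f x y else 0))"
      by (intro sum.cong refl) auto
    finally show "(\<Sum>y\<in>T - {x}. f x y) =
        (\<Sum>y\<in>T. if x < y then f x y else 0) + (\<Sum>y\<in>T. if y < x then f x y else 0)"
      by (simp add: sum.distrib)
  qed
  also have "\<dots> = (\<Sum>x\<in>T. \<Sum>y\<in>T. if x < y then f x y else 0) + (\<Sum>x\<in>T. \<Sum>y\<in>T. if x < y then f y x else 0)"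
    by (subst sum.swap[of _ T T]) (simp add: sum.distrib)
  also have "\<dots> = (\<Sum>x\<in>T. \<Sum>y\<in>T. (if x < y then f x y else 0) + (if x < y then f y x else 0))"
    by (simp add: sum.distrib)
  also have "\<dots> = 0"
    using anti by (intro sum.neutral ballI) auto
  finally show "lin (Pow N) taylor (taylor T) l = (0::'k)" .
qed

lemma lin_taylor_col:
  assumes fin: "finite N" and T': "T' \<subseteq> N"
  shows "lin (Pow N) taylor w T' = (\<Sum>y\<in>N - T'. w (insert y T') * taylor_sign y (insert y T'))"
proof -
  have "lin (Pow N) taylor w T' =
      (\<Sum>T\<in>Pow N. \<Sum>x\<in>N. if x \<in> T \<and> T' = T - {x} then w T * taylor_sign x T else 0)"
    unfolding lin_def
  proof (rule sum.cong[OF refl])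
    fix T assume T: "T \<in> Pow N"
    have "w T * taylor T T' = (\<Sum>x\<in>T. if T' = T - {x} then w T * taylor_sign x T else 0)"
      unfolding taylor_def by (simp add: sum_distrib_left if_distrib cong: if_cong)
    also have "\<dots> = (\<Sum>x\<in>N. if x \<in> T \<and> T' = T - {x} then w T * taylor_sign x T else 0)"
      using T fin by (intro sum.mono_neutral_cong_left) auto
    finally show "w T * taylor T T' = \<dots>" .
  qed
  also have "\<dots> = (\<Sum>x\<in>N. \<Sum>T\<in>Pow N. if x \<in> T \<and> T' = T - {x} then w T * taylor_sign x T else 0)"
    by (rule sum.swap)
  also have "\<dots> = (\<Sum>x\<in>N. if x \<notin> T' then w (insert x T') * taylor_sign x (insert x T') else 0)"
  proof (rule sum.cong[OF refl])
    fix x assume x: "x \<in> N"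
    show "(\<Sum>T\<in>Pow N. if x \<in> T \<and> T' = T - {x} then w T * taylor_sign x T else 0) =
        (if x \<notin> T' then w (insert x T') * taylor_sign x (insert x T') else 0)"
    proof (cases "x \<in> T'")
      case True
      then show ?thesis by (auto intro!: sum.neutral)
    next
      case False
      have "(\<Sum>T\<in>Pow N. if x \<in> T \<and> T' = T - {x} then w T * taylor_sign x T else 0) =
          (\<Sum>T\<in>Pow N. if T = insert x T' then w T * taylor_sign x T else 0)"
        using False by (intro sum.cong refl if_cong) auto
      also have "\<dots> = w (insert x T') * taylor_sign x (insert x T')"
        using fin x T' by (subst sum.delta) auto
      finally show ?thesis using False by simp
    qed
  qed
  also have "\<dots> = (\<Sum>y\<in>N - T'. w (insert y T') * taylor_sign y (insert y T'))"
    using fin by (intro sum.mono_neutral_cong_right) auto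
  finally show ?thesis .
qed

text \<open>\<open>Pow W\<close> is the augmented chain complex of a full simplex, contracted by
  coning with a vertex \<open>x\<close>. Taking \<open>x\<close> minimal makes every sign of
  \<open>x\<close> equal to 1.\<close>

lemma exact_on_taylor:
  assumes fin: "finite N" and WN: "W \<subseteq> N" and W: "W \<noteq> {}"
  shows "exact_on (Pow N) (taylor :: _ \<Rightarrow> _ \<Rightarrow> 'k::field) (Pow W)"
  unfolding exact_on_def
proof (intro allI impI)
  fix v :: "nat set \<Rightarrow> 'k"
  assume sup: "supported (Pow W) v" and cyc: "\<forall>k\<in>Pow N. lin (Pow N) taylor v k = 0"
  have finW: "finite W" using fin WN finite_subset by blast
  define x where "x = Min W"
  have xW: "x \<in> W" and xmin: "\<And>y. y \<in> W \<Longrightarrow> x \<le> y" using finW W by (auto simp: x_def)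
  define w where "w T = (if x \<in> T then v (T - {x}) else 0)" for T
  have v0: "v T = 0" if "\<not> T \<subseteq> W" for T using sup that by (auto simp: supported_def)
  have sx: "taylor_sign x T = (1::'k)" if "T \<subseteq> W" for T
  proof -
    have none: "{y \<in> T. y < x} = {}" using xmin that by fastforce
    show ?thesis unfolding taylor_sign_def none by simp
  qed
  have "supported (Pow W) w"
    unfolding supported_def w_def using v0[of "_ - {x}"] xW by auto
  moreover have "lin (Pow N) taylor w T = v T" if T: "T \<in> Pow N" for T
  proof (cases "x \<in> T")
    case False
    have "lin (Pow N) taylor w T = (\<Sum>y\<in>N - T. if y = x then v T * taylor_sign x (insert x T) else 0)"
      unfolding lin_taylor_col[OF fin T[unfolded Pow_iff]]
      using False by (intro sum.cong) (auto simp: w_def)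
    also have "\<dots> = v T * taylor_sign x (insert x T)" using False fin xW WN by auto
    also have "\<dots> = v T" using sx[of "insert x T"] v0[of T] xW by (cases "T \<subseteq> W") auto
    finally show ?thesis .
  next
    case True
    define R where "R = T - {x}"
    have RN: "R \<subseteq> N" and RT: "T = insert x R" "x \<notin> R" using T True by (auto simp: R_def)
    have finR: "finite R" using fin RN finite_subset by blast
    have w_ins: "w (insert y T) = v (insert y R)" if "y \<in> N - T" for y
    proof -
      have "insert y T - {x} = insert y R" using that True by (auto simp: R_def)
      then show ?thesis using True by (simp add: w_def)
    qed
    have signs: "v (insert y R) * taylor_sign y (insert y T) =
        - (v (insert y R) * taylor_sign y (insert y R))" if y: "y \<in> N - T" for y
    proof (cases "insert y R \<subseteq> W")
      case True
      then have "x < y" using xmin[of y] y RT by (metis DiffD2 insertCI insert_subset nless_le)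
      then have "taylor_sign y (insert x (insert y R)) = - (taylor_sign y (insert y R) :: 'k)"
        using finR RT y by (intro taylor_sign_insert_less) auto
      then show ?thesis by (simp add: RT insert_commute)
    qed (simp add: v0)
    \<comment> \<open>The cycle condition at \<open>T - {x}\<close> expresses \<open>v T\<close>
      through the sets \<open>insert y R\<close>, which are the values of the cone \<open>w\<close>
      on \<open>insert y T\<close>.\<close>
    have "0 = lin (Pow N) taylor v R" using cyc RN by simp
    also have "\<dots> = (\<Sum>y\<in>N - R. v (insert y R) * taylor_sign y (insert y R))"
      by (rule lin_taylor_col[OF fin RN])
    also have "N - R = insert x (N - T)" using RT xW WN by auto
    also have "(\<Sum>y\<in>insert x (N - T). v (insert y R) * taylor_sign y (insert y R)) =
        v T * taylor_sign x T + (\<Sum>y\<in>N - T. v (insert y R) * taylor_sign y (insert y R))"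
      using fin True by (subst sum.insert) (auto simp: RT)
    also have "v T * taylor_sign x T = v T" using sx v0 by (cases "T \<subseteq> W") auto
    finally have "0 = v T + (\<Sum>y\<in>N - T. v (insert y R) * taylor_sign y (insert y R))" .
    then have "v T = (\<Sum>y\<in>N - T. - (v (insert y R) * taylor_sign y (insert y R)))"
      by (simp add: sum_negf eq_neg_iff_add_eq_0)
    also have "\<dots> = lin (Pow N) taylor w T"
      unfolding lin_taylor_col[OF fin T[unfolded Pow_iff]]
      by (intro sum.cong refl) (simp only: w_ins signs)
    finally show ?thesis by simp
  qed
  ultimately show "\<exists>w. supported (Pow W) w \<and> (\<forall>T\<in>Pow N. lin (Pow N) taylor w T = v T)"
    by blast
qed

text \<open>The sets whose label divides \<open>u\<close> are all subsets of the generators dividing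
  \<open>u\<close>, so the strand in degree \<open>u\<close> is a full simplex;
  \<open>u \<in> X\<close> makes it nonempty.\<close>

lemma resolving_taylor:
  assumes fin: "finite N" and lab: "\<And>T u. T \<subseteq> N \<Longrightarrow> lab T \<preceq> u \<longleftrightarrow> (\<forall>k\<in>T. g k \<preceq> u)"
    and X: "\<And>u. u \<in> X \<Longrightarrow> \<exists>k\<in>N. g k \<preceq> u"
  shows "resolving X (Pow N) card lab (taylor :: _ \<Rightarrow> _ \<Rightarrow> 'k::field)"
  unfolding resolving_def
proof (intro conjI ballI impI)
  show "finite (Pow N)" "square_zero (Pow N) taylor"
    using fin square_zero_taylor by auto
next
  fix T T' assume T: "T \<in> Pow N" and T': "T' \<in> Pow N" and "taylor T T' \<noteq> (0::'k)"
  then obtain x where x: "x \<in> T" "T' = T - {x}" using taylor_nonzero by blast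
  have "finite T" using T fin finite_subset by auto
  then show "card T = Suc (card T')" using x by (metis card_Suc_Diff1)
  have "lab T \<preceq> lab T" by simp
  then show "lab T' \<preceq> lab T" using lab[of T "lab T"] lab[of T' "lab T"] T T' x by auto
next
  fix u assume "u \<in> X"
  then have "{k \<in> N. g k \<preceq> u} \<noteq> {}" using X by blast
  then have "exact_on (Pow N) (taylor :: _ \<Rightarrow> _ \<Rightarrow> 'k) (Pow {k \<in> N. g k \<preceq> u})"
    using fin by (intro exact_on_taylor) auto
  moreover have "{T \<in> Pow N. lab T \<preceq> u} = Pow {k \<in> N. g k \<preceq> u}" using lab by auto
  ultimately show "exact_on (Pow N) (taylor :: _ \<Rightarrow> _ \<Rightarrow> 'k) {T \<in> Pow N. lab T \<preceq> u}"
    by simp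
qed

section \<open>Free resolutions degree by degree\<close>

lemma expo_le_cancel: "d \<preceq> m \<Longrightarrow> d' \<preceq> d \<Longrightarrow> d - d' \<preceq> m - d'"
  unfolding expo_le_def lookup_minus by (meson diff_le_mono)

lemma expos_add: "m \<in> expos n \<Longrightarrow> m' \<in> expos n \<Longrightarrow> m + m' \<in> expos n"
  using keys_add[of m m'] by (auto simp: expos_def)

lemma expos_le: "m \<in> expos n \<Longrightarrow> m' \<preceq> m \<Longrightarrow> m' \<in> expos n"
  unfolding expos_def expo_le_def in_keys_iff subset_iff mem_Collect_eq by (metis le_zero_eq)

lemma expos_diff: "m \<in> expos n \<Longrightarrow> m - m' \<in> expos n"
  by (rule expos_le) (auto simp: expo_le_def lookup_minus)

lemma lookup_times_single:
  fixes p :: "'k::field mpoly"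
  shows "lookup (p * single d s) m = (if d \<preceq> m then lookup p (m - d) * s else 0)"
proof -
  have "(\<Sum>q. lookup (single d s) q when m = l + q) = (s when m = l + d)" for l
  proof -
    have eq: "(\<lambda>q. lookup (single d s) q when m = l + q) = (\<lambda>q. (s when m = l + d) when q = d)"
      by (auto simp: lookup_single when_def fun_eq_iff)
    show ?thesis unfolding eq by (rule Sum_any_when_equal)
  qed
  then have eq: "lookup (p * single d s) m = (\<Sum>l. lookup p l * (s when m = l + d))"
    by (simp add: lookup_mult)
  show ?thesis
  proof (cases "d \<preceq> m")
    case True
    have eq2: "(\<lambda>l. lookup p l * (s when m = l + d)) = (\<lambda>l. (lookup p (m - d) * s) when l = m - d)"
      using True by (auto simp: when_def fun_eq_iff)
    show ?thesis using True unfolding eq eq2 by simp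
  next
    case False
    then have "m \<noteq> l + d" for l by auto
    then show ?thesis using False by (simp add: eq)
  qed
qed

text \<open>One notation for three uses: \<open>expos n\<close> yields the ring, \<open>{}\<close>
  the zero ideal, and an upward closed set of exponents a monomial ideal.\<close>

definition mono_ideal :: "expo set \<Rightarrow> 'k::field mpoly set" where
  "mono_ideal X = {p. keys p \<subseteq> X}"

text \<open>A homogeneous entry is a scalar times a monomial fixed by the two degrees; this is the
  scalar. Setting it to 0 out of range keeps the irrelevant values of \<open>dmat\<close> out of all
  later sums.\<close>

definition coef :: "'k::field free_cpx \<Rightarrow> nat \<Rightarrow> nat \<Rightarrow> nat \<Rightarrow> 'k" where
  "coef F i j k = (if j < length (degs F (Suc i)) \<and> k < length (degs F i)
     then lookup (dmat F i j k) (degs F (Suc i) ! j - degs F i ! k) else 0)"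

definition aug_coef :: "'k::field free_cpx \<Rightarrow> nat \<Rightarrow> 'k" where
  "aug_coef F j = lookup (aug F j) (degs F 0 ! j)"

definition strand :: "'k::field free_cpx \<Rightarrow> nat \<Rightarrow> expo \<Rightarrow> (nat \<Rightarrow> 'k) set" where
  "strand F i u = {v. \<forall>j. v j \<noteq> 0 \<longrightarrow> j < length (degs F i) \<and> degs F i ! j \<preceq> u}"

text \<open>
  A basis element of degree \<open>d\<close> contributes to the multidegree \<open>u\<close> through the coefficient of the
  monomial \<open>u - d\<close>; the subtraction of exponent vectors truncates, hence the guard \<open>d \<preceq> u\<close>.
\<close>

definition part :: "'k::field free_cpx \<Rightarrow> nat \<Rightarrow> expo \<Rightarrow> (nat \<Rightarrow> 'k mpoly) \<Rightarrow> nat \<Rightarrow> 'k" where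
  "part F i u v = (\<lambda>j. if j < length (degs F i) \<and> degs F i ! j \<preceq> u
     then lookup (v j) (u - degs F i ! j) else 0)"

text \<open>One scalar matrix serves all multidegrees; only the support of the vectors depends on
  \<open>u\<close>.\<close>

definition sbd :: "'k::field free_cpx \<Rightarrow> nat \<Rightarrow> (nat \<Rightarrow> 'k) \<Rightarrow> nat \<Rightarrow> 'k" where
  "sbd F i = lin {..<length (degs F (Suc i))} (coef F i)"

definition saug :: "'k::field free_cpx \<Rightarrow> (nat \<Rightarrow> 'k) \<Rightarrow> 'k" where
  "saug F v = (\<Sum>j<length (degs F 0). v j * aug_coef F j)"

text \<open>The quotient being resolved vanishes in the degrees of \<open>N\<close>, so there every
  vector of homological degree 0 is a cycle.\<close>

definition cyc :: "expo set \<Rightarrow> 'k::field free_cpx \<Rightarrow> nat \<Rightarrow> expo \<Rightarrow> (nat \<Rightarrow> 'k) set" where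
  "cyc N F i u = {v \<in> strand F i u.
     case i of 0 \<Rightarrow> u \<in> N \<or> saug F v = 0 | Suc i' \<Rightarrow> sbd F i' v = (\<lambda>k. 0)}"

lemma zero_in_cyc: "(\<lambda>j. 0) \<in> cyc N F i u"
  by (simp add: cyc_def strand_def saug_def sbd_def lin_zero split: nat.split)

lemma degs_in_expos: "multigraded n F \<Longrightarrow> j < length (degs F i) \<Longrightarrow> degs F i ! j \<in> expos n"
  unfolding multigraded_def by (meson nth_mem subsetD)

lemma coef_nonzeroD:
  assumes "multigraded n F" "coef F i j k \<noteq> 0"
  shows "j < length (degs F (Suc i))" "k < length (degs F i)" "degs F i ! k \<preceq> degs F (Suc i) ! j"
proof -
  show j: "j < length (degs F (Suc i))" and k: "k < length (degs F i)"
    using assms(2) by (auto simp: coef_def split: if_splits)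
  have "degs F (Suc i) ! j - degs F i ! k \<in> keys (dmat F i j k)"
    using assms(2) j k by (simp add: coef_def in_keys_iff)
  then have "degs F (Suc i) ! j = (degs F (Suc i) ! j - degs F i ! k) + degs F i ! k"
    using assms(1) j k unfolding multigraded_def by metis
  then show "degs F i ! k \<preceq> degs F (Suc i) ! j" by (metis expo_le_add(1))
qed

lemma dmat_eq_single:
  assumes "multigraded n F" "j < length (degs F (Suc i))" "k < length (degs F i)"
  shows "dmat F i j k = single (degs F (Suc i) ! j - degs F i ! k) (coef F i j k)"
proof (rule poly_mapping_eqI)
  fix m
  show "lookup (dmat F i j k) m = lookup (single (degs F (Suc i) ! j - degs F i ! k) (coef F i j k)) m"
  proof (cases "m \<in> keys (dmat F i j k)")
    case True
    then have "m + degs F i ! k = degs F (Suc i) ! j" using assms unfolding multigraded_def by blast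
    then have "m = degs F (Suc i) ! j - degs F i ! k" by (metis add_diff_cancel_right')
    then show ?thesis using assms by (simp add: coef_def)
  next
    case False
    then show ?thesis using assms by (auto simp: coef_def in_keys_iff lookup_single when_def)
  qed
qed

lemma aug_eq_single:
  assumes "multigraded n F" "j < length (degs F 0)"
  shows "aug F j = single (degs F 0 ! j) (aug_coef F j)"
proof (rule poly_mapping_eqI)
  fix m
  have "keys (aug F j) \<subseteq> {degs F 0 ! j}" using assms unfolding multigraded_def by blast
  then show "lookup (aug F j) m = lookup (single (degs F 0 ! j) (aug_coef F j)) m"
    by (cases "m = degs F 0 ! j") (auto simp: aug_coef_def lookup_single when_def in_keys_iff)
qed

lemma sbd_in_strand:
  assumes "multigraded n F" "v \<in> strand F (Suc i) u"
  shows "sbd F i v \<in> strand F i u"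
  unfolding strand_def mem_Collect_eq
proof (intro allI impI)
  fix k assume "sbd F i v k \<noteq> 0"
  then obtain j where "v j * coef F i j k \<noteq> 0" unfolding sbd_def lin_def by (meson sum.neutral)
  then have j: "v j \<noteq> 0" "coef F i j k \<noteq> 0" by auto
  then have "degs F (Suc i) ! j \<preceq> u" using assms(2) by (auto simp: strand_def)
  then show "k < length (degs F i) \<and> degs F i ! k \<preceq> u"
    using coef_nonzeroD[OF assms(1) j(2)] expo_le_trans by blast
qed

lemma part_in_strand: "part F i u v \<in> strand F i u"
  by (simp add: part_def strand_def)

lemma lookup_eq_part: "j < length (degs F i) \<Longrightarrow> lookup (v j) m = part F i (m + degs F i ! j) v j"
  by (simp add: part_def)

lemma free_mod_eqI:
  assumes "v \<in> free_mod n F i" "w \<in> free_mod n F i" "\<And>u. u \<in> expos n \<Longrightarrow> part F i u v = part F i u w"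
    and mg: "multigraded n F"
  shows "v = w"
proof (rule ext, rule poly_mapping_eqI)
  fix j m
  show "lookup (v j) m = lookup (w j) m"
  proof (cases "j < length (degs F i)")
    case True
    show ?thesis
    proof (cases "m \<in> expos n")
      case m: True
      then have "m + degs F i ! j \<in> expos n" using degs_in_expos[OF mg True] by (rule expos_add)
      then show ?thesis using assms(3) True lookup_eq_part by metis
    next
      case False
      then have "m \<notin> keys (v j)" "m \<notin> keys (w j)"
        using assms(1,2) True by (auto simp: free_mod_def polyring_def)
      then show ?thesis by (simp add: in_keys_iff)
    qed
  next
    case False
    then show ?thesis using assms(1,2) by (simp add: free_mod_def)
  qed
qed

lemma part_outside:
  assumes mg: "multigraded n F" and v: "v \<in> free_mod n F i" and u: "u \<notin> expos n"
  shows "part F i u v = (\<lambda>j. 0)"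
proof
  fix j
  show "part F i u v j = 0"
  proof (rule ccontr)
    assume "part F i u v j \<noteq> 0"
    then have j: "j < length (degs F i)" "degs F i ! j \<preceq> u" and "u - degs F i ! j \<in> keys (v j)"
      by (auto simp: part_def in_keys_iff split: if_splits)
    then have "u - degs F i ! j \<in> expos n" using v by (auto simp: free_mod_def polyring_def)
    then have "u - degs F i ! j + degs F i ! j \<in> expos n"
      using degs_in_expos[OF mg j(1)] by (rule expos_add)
    then show False using u j(2) by simp
  qed
qed

lemma finite_part:
  "finite {u. part F i u v \<noteq> (\<lambda>j. 0)}"
proof (rule finite_subset)
  show "{u. part F i u v \<noteq> (\<lambda>j. 0)} \<subseteq>
      (\<Union>j<length (degs F i). (\<lambda>m. m + degs F i ! j) ` keys (v j))"
  proof
    fix u assume "u \<in> {u. part F i u v \<noteq> (\<lambda>j. 0)}"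
    then obtain j where "part F i u v j \<noteq> 0" by (auto simp: fun_eq_iff)
    then have "j < length (degs F i)" "degs F i ! j \<preceq> u" "u - degs F i ! j \<in> keys (v j)"
      by (auto simp: part_def in_keys_iff split: if_splits)
    then show "u \<in> (\<Union>j<length (degs F i). (\<lambda>m. m + degs F i ! j) ` keys (v j))"
      by (force intro: rev_image_eqI)
  qed
qed auto

text \<open>Different multidegrees use different monomials in each coordinate, so prescribed parts
  do not interfere; finiteness of \<open>U\<close> keeps the coordinates polynomial.\<close>

lemma glue:
  assumes mg: "multigraded n F" and U: "finite U" "U \<subseteq> expos n"
    and w: "\<And>u. u \<in> U \<Longrightarrow> w u \<in> strand F i u"
  shows "\<exists>v\<in>free_mod n F i. \<forall>u. part F i u v = (if u \<in> U then w u else (\<lambda>j. 0))"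
proof -
  define v where "v j = (if j < length (degs F i)
    then \<Sum>u\<in>U. if degs F i ! j \<preceq> u then single (u - degs F i ! j) (w u j) else 0 else 0)" for j
  have "keys (v j) \<subseteq> expos n" for j
  proof
    fix m assume "m \<in> keys (v j)"
    then have "lookup (v j) m \<noteq> 0" by (simp add: in_keys_iff)
    then obtain u where u: "u \<in> U" "degs F i ! j \<preceq> u" "lookup (single (u - degs F i ! j) (w u j)) m \<noteq> 0"
      unfolding v_def by (auto simp: lookup_sum split: if_splits elim!: sum.not_neutral_contains_not_neutral)
    then have "m = u - degs F i ! j" by (auto simp: lookup_single when_def split: if_splits)
    then show "m \<in> expos n" using u U expos_diff by blast
  qed
  moreover have "v j = 0" if "length (degs F i) \<le> j" for j using that by (simp add: v_def)
  ultimately have "v \<in> free_mod n F i" by (simp add: free_mod_def polyring_def)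
  moreover have "part F i u v = (if u \<in> U then w u else (\<lambda>j. 0))" for u
  proof
    fix j
    show "part F i u v j = (if u \<in> U then w u else (\<lambda>j. 0)) j"
    proof (cases "j < length (degs F i) \<and> degs F i ! j \<preceq> u")
      case True
      have inj: "u' = u" if "degs F i ! j \<preceq> u'" "u' - degs F i ! j = u - degs F i ! j" for u'
        using True that by (metis expo_le_diff_add)
      have "part F i u v j = (\<Sum>u'\<in>U. if u' = u then w u j else 0)"
        using True unfolding part_def v_def
        by (auto simp: lookup_sum lookup_single when_def dest: inj intro!: sum.cong)
      then show ?thesis using U by simp
    next
      case False
      then have "w u j = 0" if "u \<in> U" using w[OF that] by (auto simp: strand_def)
      then show ?thesis using False by (auto simp: part_def)
    qed
  qed
  ultimately show ?thesis by blast
qed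

lemma part_bd:
  assumes mg: "multigraded n F"
  shows "part F i u (bd F i v) = sbd F i (part F (Suc i) u v)"
proof
  fix k
  show "part F i u (bd F i v) k = sbd F i (part F (Suc i) u v) k"
  proof (cases "k < length (degs F i) \<and> degs F i ! k \<preceq> u")
    case True
    let ?d = "degs F i ! k"
    have "lookup (v j * dmat F i j k) (u - ?d) = part F (Suc i) u v j * coef F i j k"
      if j: "j < length (degs F (Suc i))" for j
    proof (cases "coef F i j k = 0")
      case False
      let ?d' = "degs F (Suc i) ! j"
      have le: "?d \<preceq> ?d'" using coef_nonzeroD(3)[OF mg False] .
      have iff: "?d' - ?d \<preceq> u - ?d \<longleftrightarrow> ?d' \<preceq> u"
      proof
        assume "?d' - ?d \<preceq> u - ?d"
        then obtain e where "u - ?d = e + (?d' - ?d)" unfolding expo_le_iff by blast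
        then have "u - ?d + ?d = e + (?d' - ?d + ?d)" by (simp add: add.assoc)
        then show "?d' \<preceq> u" using True le by simp
      qed (use le expo_le_cancel in blast)
      \<comment> \<open>Subtraction of exponents truncates, and this identity rests on
        \<open>?d \<preceq> ?d'\<close>.\<close>
      have "u - ?d - (?d' - ?d) = u - ?d'"
      proof (rule poly_mapping_eqI)
        fix l
        have "lookup ?d l \<le> lookup ?d' l" using le by (simp add: expo_le_def)
        then show "lookup (u - ?d - (?d' - ?d)) l = lookup (u - ?d') l"
          by (simp add: lookup_minus)
      qed
      then show ?thesis using True j iff
        by (simp add: dmat_eq_single[OF mg] lookup_times_single part_def)
    qed (use True j in \<open>simp add: dmat_eq_single[OF mg]\<close>)
    then show ?thesis using True by (simp add: part_def[of F i] bd_def sbd_def lin_def lookup_sum)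
  next
    case False
    have "sbd F i (part F (Suc i) u v) \<in> strand F i u"
      by (rule sbd_in_strand[OF mg part_in_strand])
    then show ?thesis using False by (auto simp: strand_def part_def)
  qed
qed

lemma lookup_aug_map:
  assumes mg: "multigraded n F"
  shows "lookup (aug_map F v) u = saug F (part F 0 u v)"
  unfolding aug_map_def saug_def lookup_sum
  by (intro sum.cong refl) (simp add: aug_eq_single[OF mg] lookup_times_single part_def)

lemma bd_in_free_mod:
  fixes v :: "nat \<Rightarrow> 'k::field mpoly"
  assumes mg: "multigraded n F" and v: "v \<in> free_mod n F (Suc i)"
  shows "bd F i v \<in> free_mod n F i"
proof -
  have "keys (v j * dmat F i j k) \<subseteq> expos n"
    if "j < length (degs F (Suc i))" "k < length (degs F i)" for j k
  proof -
    have "keys (v j) \<subseteq> expos n" "keys (dmat F i j k) \<subseteq> expos n"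
      using v mg that by (auto simp: free_mod_def polyring_def multigraded_def)
    then show ?thesis using keys_mult[of "v j" "dmat F i j k"] expos_add by fastforce
  qed
  then have "keys (\<Sum>j<length (degs F (Suc i)). v j * dmat F i j k) \<subseteq> expos n"
    if "k < length (degs F i)" for k
    using that by (force simp: in_keys_iff lookup_sum elim!: sum.not_neutral_contains_not_neutral)
  then show ?thesis by (simp add: free_mod_def polyring_def bd_def)
qed

text \<open>By \<open>glue\<close>, a single vector \<open>w\<close> in \<open>A u\<close> is a part
  of an element all of whose other parts vanish. Such an element satisfies the conditions in the
  other degrees because \<open>A\<close> contains 0 everywhere.\<close>

lemma strandwise_eq_iff:
  assumes mg: "multigraded n F"
    and A: "\<And>u. A u \<subseteq> strand F i u" "\<And>u. (\<lambda>j. 0) \<in> A u"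
    and B: "\<And>u. B u \<subseteq> strand F i u" "\<And>u. (\<lambda>j. 0) \<in> B u"
  shows "{v \<in> free_mod n F i. \<forall>u\<in>expos n. part F i u v \<in> A u} =
      {v \<in> free_mod n F i. \<forall>u\<in>expos n. part F i u v \<in> B u} \<longleftrightarrow> (\<forall>u\<in>expos n. A u = B u)"
proof -
  have sub: "A' u \<subseteq> B' u"
    if eq: "{v \<in> free_mod n F i. \<forall>u\<in>expos n. part F i u v \<in> A' u} =
        {v \<in> free_mod n F i. \<forall>u\<in>expos n. part F i u v \<in> B' u}" and u: "u \<in> expos n"
      and A': "\<And>u. A' u \<subseteq> strand F i u" "\<And>u. (\<lambda>j. 0) \<in> A' u" for A' B' u
  proof
    fix w assume w: "w \<in> A' u"
    obtain v where v: "v \<in> free_mod n F i" "\<And>u'. part F i u' v = (if u' = u then w else (\<lambda>j. 0))"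
      using glue[OF mg, of "{u}" "\<lambda>_. w" i] u w A' by auto
    then have "v \<in> {v \<in> free_mod n F i. \<forall>u\<in>expos n. part F i u v \<in> A' u}"
      using w A' by simp
    then have "part F i u v \<in> B' u" using eq u by blast
    then show "w \<in> B' u" using v by simp
  qed
  show ?thesis
  proof
    assume eq: "{v \<in> free_mod n F i. \<forall>u\<in>expos n. part F i u v \<in> A u} =
      {v \<in> free_mod n F i. \<forall>u\<in>expos n. part F i u v \<in> B u}"
    show "\<forall>u\<in>expos n. A u = B u"
      using sub[OF eq _ A] sub[OF eq[symmetric] _ B] by blast
  qed auto
qed

text \<open>Preimages are chosen degree by degree. Only finitely many parts of \<open>v\<close> are
  nonzero, so the chosen vectors can be glued, with 0 as preimage of 0.\<close>

lemma bd_image_strandwise: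
  assumes mg: "multigraded n F"
  shows "bd F i ` free_mod n F (Suc i) =
    {v \<in> free_mod n F i. \<forall>u\<in>expos n. part F i u v \<in> sbd F i ` strand F (Suc i) u}"
proof (intro equalityI subsetI)
  fix v assume "v \<in> bd F i ` free_mod n F (Suc i)"
  then show "v \<in> {v \<in> free_mod n F i. \<forall>u\<in>expos n. part F i u v \<in> sbd F i ` strand F (Suc i) u}"
    using bd_in_free_mod[OF mg] part_bd[OF mg] part_in_strand by fastforce
next
  fix v assume "v \<in> {v \<in> free_mod n F i. \<forall>u\<in>expos n. part F i u v \<in> sbd F i ` strand F (Suc i) u}"
  then have v: "v \<in> free_mod n F i"
    and "\<forall>u\<in>expos n. \<exists>w. w \<in> strand F (Suc i) u \<and> part F i u v = sbd F i w" by auto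
  then obtain w where w: "\<And>u. u \<in> expos n \<Longrightarrow> w u \<in> strand F (Suc i) u \<and> part F i u v = sbd F i (w u)"
    by metis
  let ?U = "{u. part F i u v \<noteq> (\<lambda>j. 0)}"
  have U: "finite ?U" "?U \<subseteq> expos n" using finite_part part_outside[OF mg v] by auto
  obtain v' where v': "v' \<in> free_mod n F (Suc i)"
    and part: "\<And>u. part F (Suc i) u v' = (if u \<in> ?U then w u else (\<lambda>j. 0))"
    using glue[OF mg U, of w "Suc i"] w U by blast
  have "bd F i v' = v"
  proof (rule free_mod_eqI[OF bd_in_free_mod[OF mg v'] v _ mg])
    fix u assume u: "u \<in> expos n"
    show "part F i u (bd F i v') = part F i u v"
      using w[OF u] by (auto simp: part_bd[OF mg] part sbd_def lin_zero)
  qed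
  then show "v \<in> bd F i ` free_mod n F (Suc i)" using v' by blast
qed

lemma kernel_aug_strandwise:
  assumes mg: "multigraded n F"
  shows "{v \<in> free_mod n F 0. aug_map F v \<in> mono_ideal N} =
    {v \<in> free_mod n F 0. \<forall>u\<in>expos n. part F 0 u v \<in> cyc N F 0 u}"
proof -
  have "aug_map F v \<in> mono_ideal N \<longleftrightarrow> (\<forall>u\<in>expos n. part F 0 u v \<in> cyc N F 0 u)"
    if v: "v \<in> free_mod n F 0" for v
  proof -
    have "aug_map F v \<in> mono_ideal N \<longleftrightarrow> (\<forall>u. u \<in> N \<or> saug F (part F 0 u v) = 0)"
      by (auto simp: mono_ideal_def in_keys_iff lookup_aug_map[OF mg])
    also have "\<dots> \<longleftrightarrow> (\<forall>u\<in>expos n. u \<in> N \<or> saug F (part F 0 u v) = 0)"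
      using part_outside[OF mg v] by (auto simp: saug_def)
    finally show ?thesis by (simp add: cyc_def part_in_strand)
  qed
  then show ?thesis by blast
qed

lemma kernel_bd_strandwise:
  assumes mg: "multigraded n F"
  shows "{v \<in> free_mod n F (Suc i). bd F i v = (\<lambda>k. 0)} =
    {v \<in> free_mod n F (Suc i). \<forall>u\<in>expos n. part F (Suc i) u v \<in> cyc N F (Suc i) u}"
proof -
  have "bd F i v = (\<lambda>k. 0) \<longleftrightarrow> (\<forall>u\<in>expos n. part F (Suc i) u v \<in> cyc N F (Suc i) u)"
    if v: "v \<in> free_mod n F (Suc i)" for v
  proof -
    have z: "(\<lambda>k. 0) \<in> free_mod n F i" "part F i u (\<lambda>k. 0) = (\<lambda>k. 0)" for u
      by (auto simp: free_mod_def polyring_def part_def)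
    have "bd F i v = (\<lambda>k. 0) \<longleftrightarrow> (\<forall>u\<in>expos n. part F i u (bd F i v) = (\<lambda>k. 0))"
      using free_mod_eqI[OF bd_in_free_mod[OF mg v] z(1) _ mg] z(2) by metis
    then show ?thesis by (simp add: cyc_def part_in_strand part_bd[OF mg])
  qed
  then show ?thesis by blast
qed

lemma augmentation_surj_iff:
  assumes mg: "multigraded n F" and M: "M \<subseteq> expos n"
  shows "(\<forall>p\<in>mono_ideal M. \<exists>v\<in>free_mod n F 0. p - aug_map F v \<in> mono_ideal N) \<longleftrightarrow>
    (\<forall>u\<in>M. \<exists>w\<in>strand F 0 u. u \<in> N \<or> saug F w = 1)" (is "?L \<longleftrightarrow> ?R")
proof
  assume L: ?L
  show ?R
  proof
    fix u assume "u \<in> M"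
    then have "single u 1 \<in> mono_ideal M" by (simp add: mono_ideal_def)
    then obtain v where v: "v \<in> free_mod n F 0" "single u 1 - aug_map F v \<in> mono_ideal N" using L by blast
    have "lookup (single u 1 - aug_map F v) u = 0 \<or> u \<in> N"
      using v(2) by (auto simp: mono_ideal_def in_keys_iff)
    then have "u \<in> N \<or> saug F (part F 0 u v) = 1" by (auto simp: lookup_minus lookup_aug_map[OF mg])
    then show "\<exists>w\<in>strand F 0 u. u \<in> N \<or> saug F w = 1" using part_in_strand by blast
  qed
next
  assume ?R
  then obtain w where w: "\<And>u. u \<in> M \<Longrightarrow> w u \<in> strand F 0 u \<and> (u \<in> N \<or> saug F (w u) = 1)" by metis
  show ?L
  proof
    fix p :: "'a mpoly" assume p: "p \<in> mono_ideal M"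
    let ?w = "\<lambda>u j. lookup p u * w u j"
    have "\<exists>v\<in>free_mod n F 0. \<forall>u. part F 0 u v = (if u \<in> keys p then ?w u else (\<lambda>j. 0))"
    proof (rule glue[OF mg])
      show "keys p \<subseteq> expos n" using p M by (auto simp: mono_ideal_def)
      show "?w u \<in> strand F 0 u" if "u \<in> keys p" for u
        using w[of u] that p by (auto simp: mono_ideal_def strand_def)
    qed simp
    then obtain v where v: "v \<in> free_mod n F 0"
      "\<And>u. part F 0 u v = (if u \<in> keys p then ?w u else (\<lambda>j. 0))" by blast
    have "keys (p - aug_map F v) \<subseteq> N"
    proof
      fix u assume "u \<in> keys (p - aug_map F v)"
      then have ne: "lookup p u \<noteq> saug F (part F 0 u v)"
        by (auto simp: in_keys_iff lookup_minus lookup_aug_map[OF mg])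
      have u: "u \<in> keys p"
      proof (rule ccontr)
        assume "u \<notin> keys p"
        then show False using ne v(2) by (simp add: saug_def in_keys_iff)
      qed
      have "saug F (?w u) = lookup p u * saug F (w u)"
        by (simp add: saug_def sum_distrib_left mult.assoc)
      then show "u \<in> N" using ne u v(2) w[of u] p by (auto simp: mono_ideal_def)
    qed
    then show "\<exists>v\<in>free_mod n F 0. p - aug_map F v \<in> mono_ideal N"
      using v(1) by (auto simp: mono_ideal_def)
  qed
qed

text \<open>The bridge from modules over the polynomial ring to vector spaces: from here on
  exactness is a statement about scalar matrices in each multidegree.\<close>

theorem free_resolution_strandwise:
  fixes F :: "'k::field free_cpx"
  assumes mg: "multigraded n F" and M: "M \<subseteq> expos n"
  shows "free_resolution n (mono_ideal M) (mono_ideal N) F \<longleftrightarrow>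
    (\<forall>j<length (degs F 0). aug_coef F j \<noteq> 0 \<longrightarrow> degs F 0 ! j \<in> M) \<and>
    (\<forall>u\<in>M. \<exists>w\<in>strand F 0 u. u \<in> N \<or> saug F w = 1) \<and>
    (\<forall>i. \<forall>u\<in>expos n. cyc N F i u = sbd F i ` strand F (Suc i) u)"
proof -
  have aug: "(\<forall>j<length (degs F 0). aug F j \<in> mono_ideal M) \<longleftrightarrow>
      (\<forall>j<length (degs F 0). aug_coef F j \<noteq> 0 \<longrightarrow> degs F 0 ! j \<in> M)"
    using aug_eq_single[OF mg] by (auto simp: mono_ideal_def split: if_splits)
  have im: "sbd F i ` strand F (Suc i) u \<subseteq> strand F i u" "(\<lambda>j. 0) \<in> sbd F i ` strand F (Suc i) u" for i u
  proof -
    show "sbd F i ` strand F (Suc i) u \<subseteq> strand F i u" using sbd_in_strand[OF mg] by blast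
    show "(\<lambda>j. 0) \<in> sbd F i ` strand F (Suc i) u"
      by (rule image_eqI[of _ _ "\<lambda>j. 0"]) (simp_all add: sbd_def lin_zero strand_def)
  qed
  have cs: "cyc N F i u \<subseteq> strand F i u" for i u by (auto simp: cyc_def)
  have e0: "{v \<in> free_mod n F 0. aug_map F v \<in> mono_ideal N} = bd F 0 ` free_mod n F 1 \<longleftrightarrow>
      (\<forall>u\<in>expos n. cyc N F 0 u = sbd F 0 ` strand F (Suc 0) u)"
    unfolding kernel_aug_strandwise[OF mg] One_nat_def bd_image_strandwise[OF mg]
    by (rule strandwise_eq_iff[OF mg cs zero_in_cyc im])
  have ei: "{v \<in> free_mod n F (Suc i). bd F i v = (\<lambda>k. 0)} = bd F (Suc i) ` free_mod n F (Suc (Suc i)) \<longleftrightarrow>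
      (\<forall>u\<in>expos n. cyc N F (Suc i) u = sbd F (Suc i) ` strand F (Suc (Suc i)) u)" for i
    unfolding kernel_bd_strandwise[OF mg, where N = N] bd_image_strandwise[OF mg]
    by (rule strandwise_eq_iff[OF mg cs zero_in_cyc im])
  have all: "(\<forall>i. P i) \<longleftrightarrow> P 0 \<and> (\<forall>i. P (Suc i))" for P :: "nat \<Rightarrow> bool"
    by (metis not0_implies_Suc)
  show ?thesis
    unfolding free_resolution_def aug e0 ei augmentation_surj_iff[OF mg M]
    unfolding all[of "\<lambda>i. \<forall>u\<in>expos n. cyc N F i u = sbd F i ` strand F (Suc i) u"]
    using mg by blast
qed

section \<open>Comparison of resolutions\<close>

lemma homogeneous_system_solvable:
  fixes \<alpha> :: "'a \<Rightarrow> 'b \<Rightarrow> 'k::field"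
  assumes "finite Q" "finite P" "card Q < card P"
  shows "\<exists>x. (\<exists>j\<in>P. x j \<noteq> 0) \<and> (\<forall>q\<in>Q. (\<Sum>j\<in>P. x j * \<alpha> j q) = 0)"
  using assms
proof (induction Q arbitrary: P \<alpha> rule: finite_induct)
  case empty
  then have "P \<noteq> {}" by auto
  then show ?case by (intro exI[of _ "\<lambda>_. 1"]) auto
next
  case (insert q Q)
  show ?case
  proof (cases "\<forall>j\<in>P. \<alpha> j q = 0")
    case True
    have "card Q < card P" using insert by simp
    from insert.IH[OF \<open>finite P\<close> this, of \<alpha>] obtain x where
      "\<exists>j\<in>P. x j \<noteq> 0" "\<forall>q\<in>Q. (\<Sum>j\<in>P. x j * \<alpha> j q) = 0" by blast
    then show ?thesis using True by (intro exI[of _ x]) auto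
  next
    case False
    then obtain p where p: "p \<in> P" "\<alpha> p q \<noteq> 0" by blast
    define \<alpha>' where "\<alpha>' j r = \<alpha> j r - \<alpha> j q * \<alpha> p r / \<alpha> p q" for j r
    have "card Q < card (P - {p})" using insert p by simp
    with insert.IH[of "P - {p}" \<alpha>'] insert.prems(1) obtain x where
      x: "\<exists>j\<in>P - {p}. x j \<noteq> 0" "\<forall>r\<in>Q. (\<Sum>j\<in>P - {p}. x j * \<alpha>' j r) = 0" by blast
    \<comment> \<open>Equation \<open>q\<close> is solved for the unknown \<open>p\<close>; the
      matrix of the remaining system already accounts for this substitution.\<close>
    define y where "y = x(p := - (\<Sum>j\<in>P - {p}. x j * \<alpha> j q) / \<alpha> p q)"
    have y: "(\<Sum>j\<in>P. y j * \<alpha> j r) =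
        (\<Sum>j\<in>P - {p}. x j * \<alpha> j r) - (\<Sum>j\<in>P - {p}. x j * \<alpha> j q) * \<alpha> p r / \<alpha> p q" for r
    proof -
      have "(\<Sum>j\<in>P - {p}. y j * \<alpha> j r) = (\<Sum>j\<in>P - {p}. x j * \<alpha> j r)"
        by (intro sum.cong) (auto simp: y_def)
      then show ?thesis using p insert.prems(1) by (simp add: sum.remove[of P p] y_def)
    qed
    have "(\<Sum>j\<in>P. y j * \<alpha> j r) = (\<Sum>j\<in>P - {p}. x j * \<alpha>' j r)" for r
      unfolding y \<alpha>'_def
      by (simp add: right_diff_distrib sum_subtractf sum_distrib_right sum_divide_distrib mult.assoc)
    then have "\<forall>r\<in>Q. (\<Sum>j\<in>P. y j * \<alpha> j r) = 0" using x(2) by simp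
    moreover have "(\<Sum>j\<in>P. y j * \<alpha> j q) = 0" using p by (simp add: y)
    moreover have "\<exists>j\<in>P. y j \<noteq> 0" using x(1) by (auto simp: y_def)
    ultimately show ?thesis by blast
  qed
qed

text \<open>The identity on \<open>P\<close> factors through \<open>Q\<close>. Were \<open>Q\<close>
  smaller, some nonzero vector would be annihilated by the first factor.\<close>

lemma card_le_of_left_inverse:
  fixes \<alpha> :: "'a \<Rightarrow> 'b \<Rightarrow> 'k::field"
  assumes P: "finite P" and Q: "finite Q"
    and inv: "\<And>j j'. j \<in> P \<Longrightarrow> j' \<in> P \<Longrightarrow> (\<Sum>q\<in>Q. \<alpha> j q * \<beta> q j') = (if j = j' then 1 else 0)"
  shows "card P \<le> card Q"
proof (rule ccontr)
  assume "\<not> card P \<le> card Q"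
  then obtain x where x: "\<exists>j\<in>P. x j \<noteq> 0" "\<forall>q\<in>Q. (\<Sum>j\<in>P. x j * \<alpha> j q) = 0"
    using homogeneous_system_solvable[OF Q P, of \<alpha>] by auto
  have "x j' = 0" if j': "j' \<in> P" for j'
  proof -
    have "x j' = (\<Sum>j\<in>P. if j = j' then x j' else 0)" using j' P by simp
    also have "\<dots> = (\<Sum>j\<in>P. x j * (\<Sum>q\<in>Q. \<alpha> j q * \<beta> q j'))"
      using inv j' by (intro sum.cong) auto
    also have "\<dots> = (\<Sum>q\<in>Q. (\<Sum>j\<in>P. x j * \<alpha> j q) * \<beta> q j')"
      by (simp add: sum_distrib_left sum_distrib_right mult.assoc) (rule sum.swap)
    also have "\<dots> = 0" using x(2) by simp
    finally show ?thesis .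
  qed
  then show False using x(1) by blast
qed

section \<open>Homogeneous maps, lifts and homotopies\<close>

abbreviation app :: "'k::field free_cpx \<Rightarrow> nat \<Rightarrow> (nat \<Rightarrow> nat \<Rightarrow> 'k) \<Rightarrow> (nat \<Rightarrow> 'k) \<Rightarrow> nat \<Rightarrow> 'k" where
  "app F i \<equiv> lin {..<length (degs F i)}"

text \<open>The two homological indices are independent because homotopies raise the index while
  chain maps keep it.\<close>

definition homogeneous ::
    "'k::field free_cpx \<Rightarrow> nat \<Rightarrow> 'k free_cpx \<Rightarrow> nat \<Rightarrow> (nat \<Rightarrow> nat \<Rightarrow> 'k) \<Rightarrow> bool" where
  "homogeneous F i G i' \<phi> \<longleftrightarrow> (\<forall>j<length (degs F i). \<phi> j \<in> strand G i' (degs F i ! j))"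

lemma homogeneousD:
  assumes "homogeneous F i G i' \<phi>" "j < length (degs F i)" "\<phi> j k \<noteq> 0"
  shows "k < length (degs G i')" "degs G i' ! k \<preceq> degs F i ! j"
  using assms by (auto simp: homogeneous_def strand_def)

lemma app_in_strand:
  assumes "homogeneous F i G i' \<phi>" "v \<in> strand F i u"
  shows "app F i \<phi> v \<in> strand G i' u"
  unfolding strand_def mem_Collect_eq
proof (intro allI impI)
  fix k assume "app F i \<phi> v k \<noteq> 0"
  then obtain j where "j < length (degs F i)" "v j * \<phi> j k \<noteq> 0"
    unfolding lin_def by (meson lessThan_iff sum.neutral)
  then have j: "j < length (degs F i)" "v j \<noteq> 0" "\<phi> j k \<noteq> 0" by auto
  then have "degs F i ! j \<preceq> u" using assms(2) by (auto simp: strand_def)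
  then show "k < length (degs G i') \<and> degs G i' ! k \<preceq> u"
    using homogeneousD[OF assms(1) j(1,3)] expo_le_trans by blast
qed

lemma sbd_app: "sbd G i (app F i' \<phi> v) = app F i' (\<lambda>j. sbd G i (\<phi> j)) v"
  by (simp add: sbd_def lin_lin)

lemma saug_app: "saug G (app F i \<phi> v) = (\<Sum>j<length (degs F i). v j * saug G (\<phi> j))"
proof -
  have "saug G w = lin {..<length (degs G 0)} (\<lambda>j _. aug_coef G j) w ()" for w
    by (simp add: saug_def lin_def)
  then show ?thesis by (simp add: lin_lin) (simp add: lin_def)
qed

lemma sbd_diff: "sbd G i (\<lambda>k. v k - w k) = (\<lambda>k. sbd G i v k - sbd G i w k)"
  by (simp add: sbd_def lin_diff fun_eq_iff)

lemma saug_diff: "saug G (\<lambda>k. v k - w k) = saug G v - saug G w"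
  by (simp add: saug_def left_diff_distrib sum_subtractf)

lemma strand_diff: "v \<in> strand G i u \<Longrightarrow> w \<in> strand G i u \<Longrightarrow> (\<lambda>k. v k - w k) \<in> strand G i u"
  by (auto simp: strand_def) (metis diff_0_right diff_self)+

text \<open>The right-hand side of \<open>free_resolution_strandwise\<close>, with \<open>N\<close>
  upward closed among all exponent vectors. Thus a degree outside \<open>N\<close> is divisible only
  by degrees outside \<open>N\<close>, where augmentations can be compared.\<close>

locale strand_exact =
  fixes n :: nat and M N :: "expo set" and F :: "'k::field free_cpx"
  assumes mg: "multigraded n F"
    and aug_M: "\<And>j. j < length (degs F 0) \<Longrightarrow> aug_coef F j \<noteq> 0 \<Longrightarrow> degs F 0 ! j \<in> M"
    and surj: "\<And>u. u \<in> M \<Longrightarrow> \<exists>w\<in>strand F 0 u. u \<in> N \<or> saug F w = 1"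
    and exact: "\<And>i u. u \<in> expos n \<Longrightarrow> cyc N F i u = sbd F i ` strand F (Suc i) u"
    and upclosed: "\<And>u u'. u \<in> N \<Longrightarrow> u \<preceq> u' \<Longrightarrow> u' \<in> N"
begin

text \<open>Freeness: it suffices to choose a preimage for each basis element, in its own
  multidegree.\<close>

lemma lift:
  fixes F' :: "'k free_cpx"
  assumes mg': "multigraded n F'"
    and cyc: "\<And>j. j < length (degs F' i') \<Longrightarrow> \<psi> j \<in> cyc N F i (degs F' i' ! j)"
  shows "\<exists>h. homogeneous F' i' F (Suc i) h \<and> (\<forall>j<length (degs F' i'). sbd F i (h j) = \<psi> j)"
proof -
  have "\<exists>w. w \<in> strand F (Suc i) (degs F' i' ! j) \<and> sbd F i w = \<psi> j" if "j < length (degs F' i')" for j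
    using cyc[OF that] exact[OF degs_in_expos[OF mg' that]] by auto
  then obtain h where "\<And>j. j < length (degs F' i') \<Longrightarrow>
      h j \<in> strand F (Suc i) (degs F' i' ! j) \<and> sbd F i (h j) = \<psi> j" by metis
  then show ?thesis by (auto simp: homogeneous_def)
qed

lemma coef_in_cyc:
  assumes "j < length (degs F (Suc i))"
  shows "coef F i j \<in> cyc N F i (degs F (Suc i) ! j)"
proof -
  let ?e = "\<lambda>k. if k = j then 1 else 0"
  have "sbd F i ?e = coef F i j" unfolding sbd_def using assms by (intro lin_unit) auto
  moreover have "?e \<in> strand F (Suc i) (degs F (Suc i) ! j)" using assms by (simp add: strand_def)
  ultimately show ?thesis unfolding exact[OF degs_in_expos[OF mg assms]] by (metis image_eqI)
qed

lemma sbd_coef: "j < length (degs F (Suc (Suc i))) \<Longrightarrow> sbd F i (coef F (Suc i) j) = (\<lambda>k. 0)"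
  using coef_in_cyc[of j "Suc i"] by (simp add: cyc_def)

text \<open>A chain map inducing zero on the resolved module is \<open>dh + hd\<close>. At each
  level the part not yet explained by \<open>h\<close> is a cycle, so exactness supplies the next
  piece of \<open>h\<close>.\<close>

lemma null_homotopy:
  assumes hom: "\<And>i. homogeneous F i F i (\<zeta> i)"
    and zero: "\<And>j. j < length (degs F 0) \<Longrightarrow> \<zeta> 0 j \<in> cyc N F 0 (degs F 0 ! j)"
    and chain: "\<And>i j. j < length (degs F (Suc i)) \<Longrightarrow> sbd F i (\<zeta> (Suc i) j) = app F i (\<zeta> i) (coef F i j)"
  shows "\<exists>h. (\<forall>i. homogeneous F i F (Suc i) (h i)) \<and>
     (\<forall>j<length (degs F 0). sbd F 0 (h 0 j) = \<zeta> 0 j) \<and>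
     (\<forall>i. \<forall>j<length (degs F (Suc i)).
        sbd F (Suc i) (h (Suc i) j) = (\<lambda>k. \<zeta> (Suc i) j k - app F i (h i) (coef F i j) k))"
proof -
  let ?z = "\<lambda>i h j k. \<zeta> (Suc i) j k - app F i h (coef F i j) k"
  \<comment> \<open>The invariant promises that the remainder at the next level consists of cycles,
    which is what \<open>lift\<close> requires; \<open>?Q\<close> links successive choices.\<close>
  let ?P = "\<lambda>i h. homogeneous F i F (Suc i) h \<and>
    (i = 0 \<longrightarrow> (\<forall>j<length (degs F 0). sbd F 0 (h j) = \<zeta> 0 j)) \<and>
    (\<forall>j<length (degs F (Suc i)). ?z i h j \<in> cyc N F (Suc i) (degs F (Suc i) ! j))"
  let ?Q = "\<lambda>i h h'. \<forall>j<length (degs F (Suc i)). sbd F (Suc i) (h' j) = ?z i h j"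
  have in_strand: "?z i h j \<in> strand F (Suc i) (degs F (Suc i) ! j)"
    if "homogeneous F i F (Suc i) h" "j < length (degs F (Suc i))" for i h j
  proof (rule strand_diff)
    show "\<zeta> (Suc i) j \<in> strand F (Suc i) (degs F (Suc i) ! j)"
      using hom[of "Suc i"] that by (simp add: homogeneous_def)
    show "app F i h (coef F i j) \<in> strand F (Suc i) (degs F (Suc i) ! j)"
      using app_in_strand[OF that(1)] coef_in_cyc[OF that(2)] by (auto simp: cyc_def)
  qed
  have base: "\<exists>h. ?P 0 h"
  proof -
    obtain h where h: "homogeneous F 0 F (Suc 0) h" "\<forall>j<length (degs F 0). sbd F 0 (h j) = \<zeta> 0 j"
      using lift[OF mg zero] by blast
    have "?z 0 h j \<in> cyc N F (Suc 0) (degs F (Suc 0) ! j)" if j: "j < length (degs F (Suc 0))" for j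
    proof -
      have "app F 0 (\<lambda>k. sbd F 0 (h k)) v = app F 0 (\<zeta> 0) v" for v
        using h(2) by (auto simp: lin_def intro!: ext sum.cong)
      then have "sbd F 0 (?z 0 h j) = (\<lambda>k. 0)"
        unfolding sbd_diff sbd_app chain[OF j] by simp
      then show ?thesis using in_strand[OF h(1) j] by (simp add: cyc_def)
    qed
    then show ?thesis using h by blast
  qed
  have step: "\<exists>h'. ?P (Suc i) h' \<and> ?Q i h h'" if P: "?P i h" for i h
  proof -
    obtain h' where h': "homogeneous F (Suc i) F (Suc (Suc i)) h'"
      "\<forall>j<length (degs F (Suc i)). sbd F (Suc i) (h' j) = ?z i h j"
      using lift[OF mg, of "Suc i" "?z i h" "Suc i"] P by blast
    have "?z (Suc i) h' j \<in> cyc N F (Suc (Suc i)) (degs F (Suc (Suc i)) ! j)"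
      if j: "j < length (degs F (Suc (Suc i)))" for j
    proof -
      let ?v = "coef F (Suc i) j"
      have "app F (Suc i) (\<lambda>k. sbd F (Suc i) (h' k)) ?v = app F (Suc i) (?z i h) ?v"
        using h'(2) by (auto simp: lin_def intro!: ext sum.cong)
      also have "\<dots> =
          (\<lambda>k. app F (Suc i) (\<zeta> (Suc i)) ?v k - app F (Suc i) (\<lambda>j. app F i h (coef F i j)) ?v k)"
        by (simp add: lin_def right_diff_distrib sum_subtractf)
      also have "app F (Suc i) (\<lambda>j. app F i h (coef F i j)) ?v = app F i h (sbd F i ?v)"
        by (simp add: sbd_def lin_lin)
      finally have "sbd F (Suc i) (?z (Suc i) h' j) = (\<lambda>k. 0)"
        unfolding sbd_diff sbd_app chain[OF j] by (simp add: sbd_coef[OF j] lin_zero)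
      then show ?thesis using in_strand[OF h'(1) j] by (simp add: cyc_def)
    qed
    then show ?thesis using h' by blast
  qed
  have "\<exists>h. \<forall>i. ?P i (h i) \<and> ?Q i (h i) (h (Suc i))"
    by (rule dependent_nat_choice[OF base step])
  then obtain h where h: "\<forall>i. ?P i (h i) \<and> ?Q i (h i) (h (Suc i))" ..
  show ?thesis by (intro exI[of _ h] conjI) (use h in simp_all)
qed

end

text \<open>Chain maps over the identity of the resolved quotient. A basis element with degree in
  \<open>N\<close> maps to zero in that quotient, so its augmentation is unconstrained.\<close>

definition chain_lift :: "expo set \<Rightarrow> 'k::field free_cpx \<Rightarrow> 'k free_cpx \<Rightarrow> (nat \<Rightarrow> nat \<Rightarrow> nat \<Rightarrow> 'k) \<Rightarrow> bool" where
  "chain_lift N F G \<phi> \<longleftrightarrow> (\<forall>i. homogeneous F i G i (\<phi> i)) \<and>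
     (\<forall>j<length (degs F 0). degs F 0 ! j \<in> N \<or> saug G (\<phi> 0 j) = aug_coef F j) \<and>
     (\<forall>i. \<forall>j<length (degs F (Suc i)). sbd G i (\<phi> (Suc i) j) = app F i (\<phi> i) (coef F i j))"

lemma chain_lift_exists:
  fixes F G :: "'k::field free_cpx"
  assumes F: "strand_exact n M N F" and G: "strand_exact n M N G"
  shows "\<exists>\<phi>. chain_lift N F G \<phi>"
proof -
  interpret F: strand_exact n M N F by (rule F)
  interpret G: strand_exact n M N G by (rule G)
  let ?B = "\<lambda>\<phi>. \<forall>j<length (degs F 0). degs F 0 ! j \<in> N \<or> saug G (\<phi> j) = aug_coef F j"
  \<comment> \<open>Preservation of cycles is carried along so that the image of each boundary can
    be lifted at the next level.\<close>
  let ?P = "\<lambda>i \<phi>. homogeneous F i G i \<phi> \<and> (i = 0 \<longrightarrow> ?B \<phi>) \<and>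
    (\<forall>u. \<forall>v\<in>cyc N F i u. app F i \<phi> v \<in> cyc N G i u)"
  let ?Q = "\<lambda>i \<phi> \<phi>'. \<forall>j<length (degs F (Suc i)). sbd G i (\<phi>' j) = app F i \<phi> (coef F i j)"
  have base: "\<exists>\<phi>. ?P 0 \<phi>"
  proof -
    have "\<exists>w. w \<in> strand G 0 (degs F 0 ! j) \<and> (degs F 0 ! j \<in> N \<or> saug G w = aug_coef F j)"
      if j: "j < length (degs F 0)" for j
    proof (cases "aug_coef F j = 0")
      case True
      then show ?thesis by (intro exI[of _ "\<lambda>_. 0"]) (simp add: strand_def saug_def)
    next
      case False
      then obtain w where w: "w \<in> strand G 0 (degs F 0 ! j)" "degs F 0 ! j \<in> N \<or> saug G w = 1"
        using F.aug_M[OF j] G.surj by blast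
      have "saug G (\<lambda>k. aug_coef F j * w k) = aug_coef F j * saug G w"
        by (simp add: saug_def sum_distrib_left mult.assoc)
      then show ?thesis using w by (intro exI[of _ "\<lambda>k. aug_coef F j * w k"]) (auto simp: strand_def)
    qed
    then obtain \<phi> where \<phi>: "\<And>j. j < length (degs F 0) \<Longrightarrow> \<phi> j \<in> strand G 0 (degs F 0 ! j) \<and>
        (degs F 0 ! j \<in> N \<or> saug G (\<phi> j) = aug_coef F j)" by metis
    then have hom: "homogeneous F 0 G 0 \<phi>" by (simp add: homogeneous_def)
    have "app F 0 \<phi> v \<in> cyc N G 0 u" if v: "v \<in> cyc N F 0 u" for u v
    proof -
      have "saug G (app F 0 \<phi> v) = 0" if u: "u \<notin> N"
      proof -
        \<comment> \<open>If \<open>v j\<close> is nonzero, the degree of \<open>j\<close> divides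
          \<open>u\<close>. As \<open>u\<close> is outside \<open>N\<close>, so is that degree, and
          the two augmentations agree there.\<close>
        have eq: "v j * saug G (\<phi> j) = v j * aug_coef F j" if "j < length (degs F 0)" for j
          using \<phi>[OF that] v u F.upclosed by (cases "v j = 0") (auto simp: cyc_def strand_def)
        have "saug G (app F 0 \<phi> v) = saug F v"
          unfolding saug_app saug_def[of F] by (intro sum.cong refl eq) simp
        then show ?thesis using v u by (simp add: cyc_def)
      qed
      then show ?thesis using app_in_strand[OF hom] v by (auto simp: cyc_def)
    qed
    then show ?thesis using hom \<phi> by blast
  qed
  have step: "\<exists>\<phi>'. ?P (Suc i) \<phi>' \<and> ?Q i \<phi> \<phi>'" if P: "?P i \<phi>" for i \<phi>
  proof -
    obtain \<phi>' where \<phi>': "homogeneous F (Suc i) G (Suc i) \<phi>'"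
      "\<forall>j<length (degs F (Suc i)). sbd G i (\<phi>' j) = app F i \<phi> (coef F i j)"
      using G.lift[OF F.mg, of "Suc i" "\<lambda>j. app F i \<phi> (coef F i j)" i] P F.coef_in_cyc by blast
    have "app F (Suc i) \<phi>' v \<in> cyc N G (Suc i) u" if v: "v \<in> cyc N F (Suc i) u" for u v
    proof -
      have "sbd G i (app F (Suc i) \<phi>' v) = app F (Suc i) (\<lambda>j. app F i \<phi> (coef F i j)) v"
        unfolding sbd_app using \<phi>'(2) by (auto simp: lin_def[of "{..<length (degs F (Suc i))}"] intro!: ext sum.cong)
      also have "\<dots> = app F i \<phi> (sbd F i v)" by (simp add: sbd_def lin_lin)
      also have "\<dots> = (\<lambda>k. 0)" using v by (simp add: cyc_def lin_zero)
      finally show ?thesis using app_in_strand[OF \<phi>'(1)] v by (auto simp: cyc_def)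
    qed
    then show ?thesis using \<phi>' by blast
  qed
  have "\<exists>\<phi>. \<forall>i. ?P i (\<phi> i) \<and> ?Q i (\<phi> i) (\<phi> (Suc i))"
    by (rule dependent_nat_choice[OF base step])
  then obtain \<phi> where \<phi>: "\<forall>i. ?P i (\<phi> i) \<and> ?Q i (\<phi> i) (\<phi> (Suc i))" ..
  have "chain_lift N F G \<phi>" unfolding chain_lift_def by (intro conjI) (use \<phi> in simp_all)
  then show ?thesis by blast
qed

text \<open>The composite of the comparison maps differs from the identity by
  \<open>dh + hd\<close>. Between basis elements of equal degree, each product in \<open>dh\<close>
  or \<open>hd\<close> passes through an element of that same degree, where \<open>min\<close> makes
  the differential vanish. So the block of degree \<open>u\<close> of \<open>F\<close> is a retract
  of that of \<open>G\<close>.\<close>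

lemma minimal_rank_le:
  fixes F G :: "'k::field free_cpx"
  assumes F: "strand_exact n M N F" and G: "strand_exact n M N G"
    and min: "\<And>i j k. degs F (Suc i) ! j = degs F i ! k \<Longrightarrow> coef F i j k = 0"
  shows "card {j. j < length (degs F i) \<and> degs F i ! j = u} \<le>
    card {k. k < length (degs G i) \<and> degs G i ! k = u}" (is "card ?P \<le> card ?Q")
proof -
  interpret F: strand_exact n M N F by (rule F)
  interpret G: strand_exact n M N G by (rule G)
  obtain \<phi> where \<phi>: "chain_lift N F G \<phi>" using chain_lift_exists[OF F G] by blast
  obtain \<psi> where \<psi>: "chain_lift N G F \<psi>" using chain_lift_exists[OF G F] by blast
  have hom\<phi>: "homogeneous F i G i (\<phi> i)" and hom\<psi>: "homogeneous G i F i (\<psi> i)" for i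
    using \<phi> \<psi> by (auto simp: chain_lift_def)
  let ?e = "\<lambda>j k. if k = j then 1 else (0::'k)"
  define \<zeta> where "\<zeta> i j k = app G i (\<psi> i) (\<phi> i j) k - ?e j k" for i j k
  have \<zeta>_eq: "\<zeta> i j = (\<lambda>k. app G i (\<psi> i) (\<phi> i j) k - ?e j k)" for i j by (rule ext) (simp add: \<zeta>_def)
  have hom: "homogeneous F i F i (\<zeta> i)" for i
    unfolding homogeneous_def \<zeta>_eq
  proof (intro allI impI strand_diff)
    fix j assume j: "j < length (degs F i)"
    then have "\<phi> i j \<in> strand G i (degs F i ! j)" using hom\<phi> by (simp add: homogeneous_def)
    then show "app G i (\<psi> i) (\<phi> i j) \<in> strand F i (degs F i ! j)" by (rule app_in_strand[OF hom\<psi>])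
    show "?e j \<in> strand F i (degs F i ! j)" using j by (simp add: strand_def)
  qed
  have zero: "\<zeta> 0 j \<in> cyc N F 0 (degs F 0 ! j)" if j: "j < length (degs F 0)" for j
  proof -
    have "saug F (\<zeta> 0 j) = 0" if nN: "degs F 0 ! j \<notin> N"
    proof -
      have eq: "\<phi> 0 j k * saug F (\<psi> 0 k) = \<phi> 0 j k * aug_coef G k" if "k < length (degs G 0)" for k
        using \<psi> that homogeneousD[OF hom\<phi> j, of k] nN F.upclosed
        by (cases "\<phi> 0 j k = 0") (auto simp: chain_lift_def)
      have "saug F (app G 0 (\<psi> 0) (\<phi> 0 j)) = saug G (\<phi> 0 j)"
        unfolding saug_app saug_def[of G] by (intro sum.cong refl eq) simp
      also have "\<dots> = aug_coef F j" using \<phi> j nN by (auto simp: chain_lift_def)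
      also have "\<dots> = saug F (?e j)"
      proof -
        have "saug F (?e j) = (\<Sum>k<length (degs F 0). if k = j then aug_coef F j else 0)"
          unfolding saug_def by (intro sum.cong) auto
        then show ?thesis using j by simp
      qed
      finally show ?thesis unfolding \<zeta>_eq saug_diff by simp
    qed
    then show ?thesis using hom[of 0] j by (auto simp: cyc_def homogeneous_def)
  qed
  have chain: "sbd F i (\<zeta> (Suc i) j) = app F i (\<zeta> i) (coef F i j)" if j: "j < length (degs F (Suc i))" for i j
  proof -
    have "sbd F i (app G (Suc i) (\<psi> (Suc i)) (\<phi> (Suc i) j)) =
        app G (Suc i) (\<lambda>k. app G i (\<psi> i) (coef G i k)) (\<phi> (Suc i) j)"
      unfolding sbd_app using \<psi>
      by (auto simp: lin_def[of "{..<length (degs G (Suc i))}"] chain_lift_def intro!: ext sum.cong)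
    also have "\<dots> = app G i (\<psi> i) (sbd G i (\<phi> (Suc i) j))" by (simp add: sbd_def lin_lin)
    also have "sbd G i (\<phi> (Suc i) j) = app F i (\<phi> i) (coef F i j)" using \<phi> j by (simp add: chain_lift_def)
    finally have 1: "sbd F i (app G (Suc i) (\<psi> (Suc i)) (\<phi> (Suc i) j)) =
        app F i (\<lambda>k. app G i (\<psi> i) (\<phi> i k)) (coef F i j)" by (simp add: lin_lin)
    have 2: "sbd F i (?e j) = coef F i j" unfolding sbd_def using j by (intro lin_unit) auto
    have 3: "app F i ?e (coef F i j) = coef F i j"
    proof
      fix k
      have "app F i ?e (coef F i j) k = (\<Sum>l<length (degs F i). if k = l then coef F i j k else 0)"
        unfolding lin_def by (intro sum.cong) auto
      then show "app F i ?e (coef F i j) k = coef F i j k" by (auto simp: coef_def)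
    qed
    have "app F i (\<zeta> i) (coef F i j) =
        (\<lambda>k. app F i (\<lambda>k. app G i (\<psi> i) (\<phi> i k)) (coef F i j) k - app F i ?e (coef F i j) k)"
      unfolding \<zeta>_eq by (simp add: lin_def[of "{..<length (degs F i)}"] right_diff_distrib sum_subtractf)
    then show ?thesis unfolding \<zeta>_eq[of "Suc i"] sbd_diff 1 2 3 by simp
  qed
  obtain h where h: "\<And>i. homogeneous F i F (Suc i) (h i)"
    and h0: "\<And>j. j < length (degs F 0) \<Longrightarrow> sbd F 0 (h 0 j) = \<zeta> 0 j"
    and hS: "\<And>i j. j < length (degs F (Suc i)) \<Longrightarrow>
        sbd F (Suc i) (h (Suc i) j) = (\<lambda>k. \<zeta> (Suc i) j k - app F i (h i) (coef F i j) k)"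
    using F.null_homotopy[OF hom zero chain] by blast
  have dh: "sbd F i (h i j) k = 0"
    if j: "j < length (degs F i)" and eq: "degs F i ! j = degs F i ! k" for i j k
  proof -
    have "h i j l * coef F i l k = 0" for l
    proof (rule ccontr)
      assume nz: "h i j l * coef F i l k \<noteq> 0"
      then have "degs F (Suc i) ! l \<preceq> degs F i ! j" using homogeneousD[OF h j] by auto
      moreover have "degs F i ! k \<preceq> degs F (Suc i) ! l" using nz coef_nonzeroD[OF F.mg] by auto
      ultimately have "degs F (Suc i) ! l = degs F i ! k" using eq expo_le_antisym by metis
      then show False using min nz by simp
    qed
    then show ?thesis by (simp add: sbd_def lin_def sum.neutral)
  qed
  have hd: "app F i (h i) (coef F i j) k = 0"
    if eq: "degs F (Suc i) ! j = degs F (Suc i) ! k" for i j k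
  proof -
    have "coef F i j l * h i l k = 0" if l: "l < length (degs F i)" for l
    proof (rule ccontr)
      assume nz: "coef F i j l * h i l k \<noteq> 0"
      then have "degs F (Suc i) ! k \<preceq> degs F i ! l" using homogeneousD[OF h l] by auto
      moreover have "degs F i ! l \<preceq> degs F (Suc i) ! j" using nz coef_nonzeroD[OF F.mg] by auto
      ultimately have "degs F (Suc i) ! j = degs F i ! l" using eq expo_le_antisym by metis
      then show False using min nz by simp
    qed
    then show ?thesis by (simp add: lin_def sum.neutral)
  qed
  have \<zeta>0: "\<zeta> i j k = 0" if j: "j < length (degs F i)" and eq: "degs F i ! j = degs F i ! k" for i j k
  proof (cases i)
    case 0
    then show ?thesis using h0 dh[OF j eq] j by simp
  next
    case (Suc i')
    then have "sbd F i (h i j) k = \<zeta> i j k - app F i' (h i') (coef F i' j) k" using hS[of j i'] j by simp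
    then show ?thesis using dh[OF j eq] hd[of i' j k] eq Suc by simp
  qed
  show ?thesis
  proof (rule card_le_of_left_inverse)
    fix j j' assume j: "j \<in> ?P" and j': "j' \<in> ?P"
    have "(\<Sum>q\<in>?Q. \<phi> i j q * \<psi> i q j') = app G i (\<psi> i) (\<phi> i j) j'"
      unfolding lin_def
    proof (rule sum.mono_neutral_left)
      \<comment> \<open>A contributing \<open>q\<close> has degree dividing \<open>u\<close> and
        divisible by \<open>u\<close>, hence equal to \<open>u\<close>.\<close>
      show "\<forall>q\<in>{..<length (degs G i)} - ?Q. \<phi> i j q * \<psi> i q j' = 0"
      proof (rule ballI, rule ccontr)
        fix q assume q: "q \<in> {..<length (degs G i)} - ?Q" and nz: "\<phi> i j q * \<psi> i q j' \<noteq> 0"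
        have "degs G i ! q \<preceq> u" using homogeneousD(2)[OF hom\<phi>, of j i q] j nz by auto
        moreover have "u \<preceq> degs G i ! q" using homogeneousD(2)[OF hom\<psi>, of q i j'] j' q nz by auto
        ultimately show False using q expo_le_antisym by blast
      qed
    qed auto
    also have "\<dots> = (if j = j' then 1 else 0)"
      using \<zeta>0[of j i j'] j j' by (auto simp: \<zeta>_def)
    finally show "(\<Sum>q\<in>?Q. \<phi> i j q * \<psi> i q j') = (if j = j' then 1 else 0)" .
  qed auto
qed

section \<open>Monomial ideals, Betti numbers and Artinian quotients\<close>

lemma carrier_polyring: "carrier (polyring n) = mono_ideal (expos n)"
  by (simp add: polyring_def mono_ideal_def)

lemma mono_ideal_add: "p \<in> mono_ideal X \<Longrightarrow> q \<in> mono_ideal X \<Longrightarrow> p + q \<in> mono_ideal X"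
  using keys_add[of p q] by (auto simp: mono_ideal_def)

lemma mono_ideal_uminus: "p \<in> mono_ideal X \<Longrightarrow> - p \<in> mono_ideal X"
  by (auto simp: mono_ideal_def in_keys_iff)

lemma mono_ideal_mult:
  assumes "\<And>m m'. m \<in> X \<Longrightarrow> m' \<in> Y \<Longrightarrow> m + m' \<in> Z" "p \<in> mono_ideal X" "q \<in> mono_ideal Y"
  shows "p * q \<in> mono_ideal Z"
  using keys_mult[of p q] assms by (fastforce simp: mono_ideal_def)

lemma mono_ideal_single: "single m c \<in> mono_ideal X \<longleftrightarrow> m \<in> X \<or> c = 0"
  by (auto simp: mono_ideal_def)

lemma zero_in_expos [simp]: "0 \<in> expos n"
  by (simp add: expos_def)

lemma cring_polyring: "cring (polyring n :: 'k::field mpoly ring)"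
proof (rule cringI)
  show "abelian_group (polyring n :: 'k mpoly ring)"
  proof (rule abelian_groupI)
    fix x :: "'k mpoly" assume "x \<in> carrier (polyring n)"
    then show "\<exists>y\<in>carrier (polyring n). y \<oplus>\<^bsub>polyring n\<^esub> x = \<zero>\<^bsub>polyring n\<^esub>"
      unfolding carrier_polyring by (intro bexI[of _ "- x"]) (auto intro: mono_ideal_uminus simp: polyring_def)
  qed (auto simp: carrier_polyring intro: mono_ideal_add, auto simp: polyring_def mono_ideal_def add.assoc add.commute
      dest: subsetD[OF keys_add])
  show "comm_monoid (polyring n :: 'k mpoly ring)"
  proof (rule comm_monoidI)
    fix x y :: "'k mpoly" assume "x \<in> carrier (polyring n)" "y \<in> carrier (polyring n)"
    then have "x * y \<in> mono_ideal (expos n)"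
      unfolding carrier_polyring using mono_ideal_mult expos_add by blast
    then show "x \<otimes>\<^bsub>polyring n\<^esub> y \<in> carrier (polyring n)"
      unfolding carrier_polyring by (simp add: polyring_def)
  qed (auto simp: polyring_def mult.assoc mult.commute)
qed (auto simp: polyring_def distrib_right)

lemma ideal_polyringD:
  assumes "ideal J (polyring n :: 'k::field mpoly ring)"
  shows "J \<subseteq> carrier (polyring n)" "0 \<in> J" "p \<in> J \<Longrightarrow> q \<in> J \<Longrightarrow> p + q \<in> J"
    "p \<in> J \<Longrightarrow> r \<in> carrier (polyring n) \<Longrightarrow> r * p \<in> J"
proof -
  interpret ideal J "polyring n :: 'k mpoly ring" by (rule assms)
  show "J \<subseteq> carrier (polyring n)" using Icarr by blast
  show "0 \<in> J" using additive_subgroup.zero_closed[OF is_additive_subgroup] by (simp add: polyring_def)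
  show "p + q \<in> J" if "p \<in> J" "q \<in> J" using additive_subgroup.a_closed[OF is_additive_subgroup that] by (simp add: polyring_def)
  show "r * p \<in> J" if "p \<in> J" "r \<in> carrier (polyring n)"
    using I_l_closed[OF that] by (simp add: polyring_def)
qed

lemma ideal_mono_ideal:
  assumes X: "X \<subseteq> expos n" and up: "\<And>m d. m \<in> X \<Longrightarrow> d \<in> expos n \<Longrightarrow> d + m \<in> X"
  shows "ideal (mono_ideal X) (polyring n :: 'k::field mpoly ring)"
proof (rule idealI)
  interpret cring "polyring n :: 'k mpoly ring" by (rule cring_polyring)
  show "ring (polyring n :: 'k mpoly ring)" by (rule ring_axioms)
  show "subgroup (mono_ideal X) (add_monoid (polyring n :: 'k mpoly ring))"
  proof (rule subgroup.intro)
    show "mono_ideal X \<subseteq> carrier (add_monoid (polyring n :: 'k mpoly ring))"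
      using X by (auto simp: polyring_def mono_ideal_def)
    show "inv\<^bsub>add_monoid (polyring n)\<^esub> x \<in> mono_ideal X" if x: "x \<in> mono_ideal X" for x :: "'k mpoly"
    proof -
      have "\<ominus>\<^bsub>polyring n\<^esub> x = - x"
        using X x mono_ideal_uminus[OF x]
        by (intro minus_equality) (auto simp: polyring_def mono_ideal_def)
      then show ?thesis using mono_ideal_uminus[OF x] by (simp add: a_inv_def)
    qed
  qed (auto simp: polyring_def mono_ideal_add, simp add: mono_ideal_def)
  show l: "x \<otimes>\<^bsub>polyring n\<^esub> p \<in> mono_ideal X"
    if "p \<in> mono_ideal X" "x \<in> carrier (polyring n)" for p x :: "'k mpoly"
  proof -
    have "x * p \<in> mono_ideal X"
      using that mono_ideal_mult[of "expos n" X X x p] up unfolding carrier_polyring by blast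
    then show ?thesis by (simp add: polyring_def)
  qed
  show "p \<otimes>\<^bsub>polyring n\<^esub> x \<in> mono_ideal X"
    if "p \<in> mono_ideal X" "x \<in> carrier (polyring n)" for p x :: "'k mpoly"
    using l[OF that] by (simp add: polyring_def mult.commute)
qed

text \<open>A monomial divisible by a generator is a multiple of it, and every element of the
  right-hand side is a finite sum of such terms.\<close>

lemma genideal_xpow:
  assumes G: "G \<subseteq> expos n"
  shows "genideal (polyring n) (xpow ` G) = (mono_ideal {m \<in> expos n. \<exists>g\<in>G. g \<preceq> m} :: 'k::field mpoly set)"
    (is "?J = mono_ideal ?X")
proof
  interpret cring "polyring n :: 'k mpoly ring" by (rule cring_polyring)
  have sub: "xpow ` G \<subseteq> (carrier (polyring n) :: 'k mpoly set)"
    using G by (auto simp: carrier_polyring xpow_def mono_ideal_single)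
  show "?J \<subseteq> mono_ideal ?X"
  proof (rule genideal_minimal)
    show "ideal (mono_ideal ?X) (polyring n :: 'k mpoly ring)"
    proof (rule ideal_mono_ideal)
      fix m d assume "m \<in> ?X" "d \<in> expos n"
      then show "d + m \<in> ?X" using expos_add expo_le_trans expo_le_add(1) by blast
    qed auto
    show "xpow ` G \<subseteq> (mono_ideal ?X :: 'k mpoly set)"
      using G by (force simp: xpow_def mono_ideal_single)
  qed
  have id: "ideal ?J (polyring n :: 'k mpoly ring)" using sub by (rule genideal_ideal)
  show "mono_ideal ?X \<subseteq> ?J"
  proof
    fix p :: "'k mpoly" assume p: "p \<in> mono_ideal ?X"
    have term_in: "single m c \<in> ?J" if m: "m \<in> ?X" for m and c :: 'k
    proof -
      obtain g where g: "g \<in> G" "g \<preceq> m" using m by blast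
      have "xpow g \<in> ?J" using genideal_self[OF sub] g by blast
      moreover have "single (m - g) c \<in> carrier (polyring n)"
        using m expos_diff by (auto simp: carrier_polyring mono_ideal_single)
      ultimately have "single (m - g) c * xpow g \<in> ?J" using ideal_polyringD(4)[OF id] by blast
      then show ?thesis using g by (simp add: xpow_def mult_single)
    qed
    have "p = (\<Sum>m\<in>keys p. single m (lookup p m))"
      by (rule poly_mapping_eqI) (simp add: lookup_sum lookup_single when_def in_keys_iff)
    also have "\<dots> \<in> ?J"
    proof -
      have "(\<Sum>m\<in>K. single m (lookup p m)) \<in> ?J" if "finite K" "K \<subseteq> keys p" for K
        using that
      proof (induction K)
        case empty
        then show ?case using ideal_polyringD(2)[OF id] by simp
      next
        case (insert m K)
        then have "m \<in> ?X" using p by (auto simp: mono_ideal_def)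
        then show ?case using insert ideal_polyringD(3)[OF id term_in] by simp
      qed
      then show ?thesis by simp
    qed
    finally show "p \<in> ?J" .
  qed
qed

lemma expo_le_single: "single i k \<preceq> m \<longleftrightarrow> k \<le> lookup m i"
  by (auto simp: expo_le_def lookup_single when_def)

lemma max_ideal_eq: "max_ideal n = mono_ideal (expos n - {0})"
proof -
  have im: "(\<lambda>i. xpow (single i 1)) ` {1..n} = xpow ` (\<lambda>i. single i 1) ` {1..n}" by (simp add: image_image)
  have sub: "(\<lambda>i. single i 1) ` {1..n} \<subseteq> expos n" by (auto simp: expos_def)
  have gens: "{m \<in> expos n. \<exists>g\<in>(\<lambda>i. single i 1) ` {1..n}. g \<preceq> m} = expos n - {0}"
  proof -
    have "(\<exists>i\<in>{1..n}. 1 \<le> lookup m i) \<longleftrightarrow> m \<noteq> 0" if "m \<in> expos n" for m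
    proof -
      have "(\<exists>i\<in>{1..n}. 1 \<le> lookup m i) \<longleftrightarrow> (\<exists>i. i \<in> keys m)"
      proof
        assume "\<exists>i. i \<in> keys m"
        then obtain i where i: "i \<in> keys m" ..
        then have "i \<in> {1..n}" using that by (auto simp: expos_def)
        then show "\<exists>i\<in>{1..n}. 1 \<le> lookup m i" using i by (auto simp: in_keys_iff Suc_le_eq)
      qed (auto simp: in_keys_iff Suc_le_eq)
      also have "\<dots> \<longleftrightarrow> keys m \<noteq> {}" by blast
      finally have "(\<exists>i\<in>{1..n}. 1 \<le> lookup m i) \<longleftrightarrow> keys m \<noteq> {}" .
      then show ?thesis by simp
    qed
    then show ?thesis by (auto simp: expo_le_single)
  qed
  show ?thesis unfolding max_ideal_def im genideal_xpow[OF sub] gens ..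
qed

lemma count_list_card: "count_list xs u = card {j. j < length xs \<and> xs ! j = u}"
  by (simp add: count_list_eq_length_filter length_filter_conv_card eq_commute)

text \<open>
  Adding all exponent vectors outside \<open>expos n\<close> to \<open>N\<close> does not affect the degrees in \<open>expos n\<close>
  and makes \<open>N\<close> closed upwards in the type \<open>expo\<close>.
\<close>

lemma strand_exactI:
  assumes "free_resolution n (mono_ideal M) (mono_ideal N) F" "M \<subseteq> expos n"
    and "\<And>u u'. u \<in> N \<Longrightarrow> u \<preceq> u' \<Longrightarrow> u' \<in> expos n \<Longrightarrow> u' \<in> N"
  shows "strand_exact n M (N \<union> - expos n) F"
proof
  show mg: "multigraded n F" using assms(1) by (simp add: free_resolution_def)
  note * = free_resolution_strandwise[OF mg assms(2), of N, THEN iffD1, OF assms(1)]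
  show "degs F 0 ! j \<in> M" if "j < length (degs F 0)" "aug_coef F j \<noteq> 0" for j using * that by blast
  show "\<exists>w\<in>strand F 0 u. u \<in> N \<union> - expos n \<or> saug F w = 1" if "u \<in> M" for u using * that by blast
  show "cyc (N \<union> - expos n) F i u = sbd F i ` strand F (Suc i) u" if "u \<in> expos n" for i u
  proof -
    have "cyc (N \<union> - expos n) F i u = cyc N F i u" using that by (cases i) (simp_all add: cyc_def)
    then show ?thesis using * that by blast
  qed
  show "u' \<in> N \<union> - expos n" if "u \<in> N \<union> - expos n" "u \<preceq> u'" for u u'
    using that assms(3) expos_le by blast
qed

section \<open>Invariance of Betti numbers and projective dimension\<close>

locale monomial_ideals =
  fixes n :: nat and M N :: "expo set"
  assumes M_expos: "M \<subseteq> expos n"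
    and N_upclosed: "\<And>u u'. u \<in> N \<Longrightarrow> u \<preceq> u' \<Longrightarrow> u' \<in> expos n \<Longrightarrow> u' \<in> N"
begin

lemma count_le:
  fixes F G :: "'k::field free_cpx"
  assumes F: "minimal_free_resolution n (mono_ideal M) (mono_ideal N) F"
    and G: "free_resolution n (mono_ideal M) (mono_ideal N) G"
  shows "count_list (degs F i) u \<le> count_list (degs G i) u"
proof -
  \<comment> \<open>Between equal degrees the scalar is the constant term of the entry, and elements
    of the maximal ideal have none.\<close>
  have "coef F i j k = 0" if "degs F (Suc i) ! j = degs F i ! k" for i j k
  proof (cases "j < length (degs F (Suc i)) \<and> k < length (degs F i)")
    case True
    then have "dmat F i j k \<in> mono_ideal (expos n - {0})"
      using F by (simp add: minimal_free_resolution_def max_ideal_eq)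
    then have "lookup (dmat F i j k) 0 = 0" by (auto simp: mono_ideal_def in_keys_iff)
    then show ?thesis using that by (simp add: coef_def)
  qed (auto simp: coef_def)
  moreover have "strand_exact n M (N \<union> - expos n) F" "strand_exact n M (N \<union> - expos n) G"
    using F G M_expos N_upclosed by (auto intro!: strand_exactI simp: minimal_free_resolution_def)
  ultimately show ?thesis unfolding count_list_card by (intro minimal_rank_le)
qed

lemma count_eq:
  fixes F G :: "'k::field free_cpx"
  assumes "minimal_free_resolution n (mono_ideal M) (mono_ideal N) F"
    and "minimal_free_resolution n (mono_ideal M) (mono_ideal N) G"
  shows "count_list (degs F i) u = count_list (degs G i) u"
proof (rule le_antisym)
  show "count_list (degs F i) u \<le> count_list (degs G i) u"
    using assms(2) by (intro count_le[OF assms(1)]) (simp add: minimal_free_resolution_def)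
  show "count_list (degs G i) u \<le> count_list (degs F i) u"
    using assms(1) by (intro count_le[OF assms(2)]) (simp add: minimal_free_resolution_def)
qed

lemma length_eq:
  fixes F G :: "'k::field free_cpx"
  assumes "minimal_free_resolution n (mono_ideal M) (mono_ideal N) F"
    and "minimal_free_resolution n (mono_ideal M) (mono_ideal N) G"
  shows "length (degs F i) = length (degs G i)"
proof -
  have "length (degs H i) = (\<Sum>u\<in>set (degs F i) \<union> set (degs G i). count_list (degs H i) u)"
    if "H \<in> {F, G}" for H
    using that sum_count_set[of "degs H i" "set (degs F i) \<union> set (degs G i)"] by auto
  then show ?thesis using count_eq[OF assms] by simp
qed

lemma betti_mg_eq:
  assumes "minimal_free_resolution n (mono_ideal M) (mono_ideal N :: 'k::field mpoly set) F"
  shows "betti_mg n (mono_ideal M) (mono_ideal N :: 'k mpoly set) i u = count_list (degs F i) u"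
  unfolding betti_mg_def using assms count_eq by (intro the_equality) blast+

lemma betti_eq:
  assumes "minimal_free_resolution n (mono_ideal M) (mono_ideal N :: 'k::field mpoly set) F"
  shows "betti n (mono_ideal M) (mono_ideal N :: 'k mpoly set) i = length (degs F i)"
  unfolding betti_def using assms length_eq by (intro the_equality) blast+

text \<open>\<open>count_le\<close> compares the minimal resolution with an arbitrary one, so no
  free resolution can be zero in homological degree \<open>d\<close>.\<close>

lemma proj_dim_eq:
  assumes F: "minimal_free_resolution n (mono_ideal M) (mono_ideal N :: 'k::field mpoly set) F"
    and top: "degs F d \<noteq> []" "\<And>i. d < i \<Longrightarrow> degs F i = []"
  shows "proj_dim n (mono_ideal M) (mono_ideal N :: 'k mpoly set) = d"
  unfolding proj_dim_def
proof (rule Least_equality)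
  show "\<exists>F. free_resolution n (mono_ideal M) (mono_ideal N :: 'k mpoly set) F \<and> (\<forall>i>d. degs F i = [])"
    using F top by (auto simp: minimal_free_resolution_def)
next
  fix d' assume "\<exists>G. free_resolution n (mono_ideal M) (mono_ideal N :: 'k mpoly set) G \<and> (\<forall>i>d'. degs G i = [])"
  then obtain G where G: "free_resolution n (mono_ideal M) (mono_ideal N :: 'k mpoly set) G"
    "\<And>i. d' < i \<Longrightarrow> degs G i = []" by blast
  show "d \<le> d'"
  proof (rule ccontr)
    assume "\<not> d \<le> d'"
    then have "count_list (degs F d) (hd (degs F d)) \<le> 0"
      using count_le[OF F G(1), of d "hd (degs F d)"] G(2)[of d] by simp
    then show False using top(1) by (simp add: count_list_0_iff)
  qed
qed

end

section \<open>Artinian quotients: primes, depth and dimension\<close>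

lemma primeideal_eq_max_ideal:
  assumes P: "primeideal P (polyring n :: 'k::field mpoly ring)"
    and pow: "\<And>i. i \<in> {1..n} \<Longrightarrow> single (single i (e i)) 1 \<in> P"
  shows "P = max_ideal n"
proof
  interpret primeideal P "polyring n :: 'k mpoly ring" by (rule P)
  have id: "ideal P (polyring n :: 'k mpoly ring)" by (rule is_ideal)
  have not1: "1 \<notin> P" using one_imp_carrier I_notcarr by (auto simp: polyring_def)
  show "max_ideal n \<subseteq> P"
    unfolding max_ideal_def
  proof (rule genideal_minimal[OF id], clarify)
    fix i assume i: "i \<in> {1..n}"
    \<comment> \<open>Primality pulls the variable out of its power one factor at a time; exponent 0
      is impossible because the ideal is proper.\<close>
    have "single (single i k) 1 \<in> P \<Longrightarrow> single (single i 1) 1 \<in> P" for k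
    proof (induction k)
      case 0
      then show ?case using not1 by simp
    next
      case (Suc k)
      have carr: "single (single i k) 1 \<in> carrier (polyring n :: 'k mpoly ring)" for k
        using i by (simp add: carrier_polyring mono_ideal_single) (simp add: expos_def)
      have "single (single i (Suc k)) 1 = (single (single i k) 1 * single (single i 1) 1 :: 'k mpoly)"
        by (simp add: mult_single single_add[symmetric])
      then show ?case
        using Suc I_prime[OF carr[of k] carr[of 1]] by (auto simp: polyring_def)
    qed
    then show "xpow (single i 1) \<in> P" using pow[OF i] by (simp add: xpow_def)
  qed
  then have max: "mono_ideal (expos n - {0}) \<subseteq> P" by (simp add: max_ideal_eq)
  show "P \<subseteq> max_ideal n"
  proof
    fix p assume p: "p \<in> P"
    have pX: "p \<in> mono_ideal (expos n)" using Icarr[OF p] by (simp add: carrier_polyring)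
    let ?s = "lookup p 0"
    have "?s = 0"
    proof (rule ccontr)
      assume s: "?s \<noteq> 0"
      \<comment> \<open>The non-constant part of \<open>p\<close> already lies in the ideal, so the
        nonzero constant term would lie there too and generate the unit.\<close>
      have "single 0 ?s - p \<in> mono_ideal (expos n - {0})"
        using pX by (auto simp: mono_ideal_def in_keys_iff lookup_minus lookup_single when_def split: if_splits)
      then have "(single 0 ?s - p) + p \<in> P" using max p ideal_polyringD(3)[OF id] by blast
      then have "single 0 (inverse ?s) * single 0 ?s \<in> P"
        by (intro ideal_polyringD(4)[OF id]) (simp_all add: carrier_polyring mono_ideal_single)
      then show False using not1 s by (simp add: mult_single)
    qed
    then show "p \<in> max_ideal n" using pX by (auto simp: max_ideal_eq mono_ideal_def in_keys_iff)
  qed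
qed

definition total_degree :: "nat \<Rightarrow> expo \<Rightarrow> nat" where
  "total_degree n m = (\<Sum>i=1..n. lookup m i)"

text \<open>Elements of the maximal ideal are nilpotent modulo the ideal, so none can start a
  regular sequence. All primes above the ideal coincide, so chains of primes have length 0.\<close>

lemma cohen_macaulay_artinian:
  fixes e :: "nat \<Rightarrow> nat"
  assumes X: "X \<subseteq> expos n" and up: "\<And>m m'. m \<in> X \<Longrightarrow> m' \<in> expos n \<Longrightarrow> m \<preceq> m' \<Longrightarrow> m' \<in> X"
    and proper: "0 \<notin> X" and pow: "\<And>i. i \<in> {1..n} \<Longrightarrow> single i (e i) \<in> X"
  shows "cohen_macaulay n (mono_ideal X :: 'k::field mpoly set)"
proof -
  interpret cring "polyring n :: 'k mpoly ring" by (rule cring_polyring)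
  let ?I = "mono_ideal X :: 'k mpoly set"
  have id: "ideal ?I (polyring n)"
  proof (rule ideal_mono_ideal[OF X])
    show "d + m \<in> X" if "m \<in> X" "d \<in> expos n" for m d
      using up[OF that(1)] that X expos_add by auto
  qed
  have one: "1 \<notin> ?I" using proper by (simp add: mono_ideal_def)
  have "1 \<in> (carrier (polyring n) :: 'k mpoly set)" by (simp add: polyring_def)
  then have ne: "?I \<noteq> carrier (polyring n)" using one by metis
  \<comment> \<open>Pigeonhole fixes the exponent: total degree above the sum of the
    \<open>e i\<close> forces some exponent to reach \<open>e i\<close>, and a k-th power has only
    terms of degree at least k.\<close>
  have nilp: "f ^ (Suc (\<Sum>i=1..n. e i)) \<in> ?I" if f: "f \<in> max_ideal n" for f :: "'k mpoly"
  proof -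
    have "f ^ k \<in> mono_ideal {m \<in> expos n. k \<le> total_degree n m}" for k
    proof (induction k)
      case (Suc k)
      have pos: "0 < total_degree n m" if "m \<in> expos n - {0}" for m
      proof -
        have "keys m \<noteq> {}" using that by simp
        then obtain i where "i \<in> keys m" by blast
        then have "i \<in> {1..n}" using that unfolding expos_def by blast
        moreover have "0 < lookup m i" using \<open>i \<in> keys m\<close> by (simp add: in_keys_iff)
        ultimately show ?thesis unfolding total_degree_def by (intro sum_pos2) auto
      qed
      show ?case unfolding power_Suc
      proof (rule mono_ideal_mult[OF _ f[unfolded max_ideal_eq] Suc.IH])
        fix m m' assume m: "m \<in> expos n - {0}" and m': "m' \<in> {m \<in> expos n. k \<le> total_degree n m}"
        have "total_degree n (m + m') = total_degree n m + total_degree n m'"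
          by (simp add: total_degree_def lookup_add sum.distrib)
        then show "m + m' \<in> {m \<in> expos n. Suc k \<le> total_degree n m}"
          using pos[OF m] m m' expos_add by auto
      qed
    qed (simp add: mono_ideal_def)
    moreover have "m \<in> X" if m: "m \<in> expos n" "Suc (\<Sum>i=1..n. e i) \<le> total_degree n m" for m
    proof -
      have "\<exists>i\<in>{1..n}. e i \<le> lookup m i"
      proof (rule ccontr)
        assume "\<not> ?thesis"
        then have "total_degree n m \<le> (\<Sum>i=1..n. e i)"
          unfolding total_degree_def by (intro sum_mono) (meson linear)
        then show False using m by simp
      qed
      then show ?thesis using pow up[OF _ m(1)] expo_le_single by blast
    qed
    ultimately show ?thesis unfolding mono_ideal_def by blast
  qed
  have "depth n ?I \<le> 0"
    unfolding depth_def
  proof (rule Sup_least, clarify)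
    fix fs :: "'k mpoly list" assume reg: "regular_seq n ?I fs" and max: "set fs \<subseteq> max_ideal n"
    have "fs = []"
    proof (rule ccontr)
      assume "fs \<noteq> []"
      then obtain f where f: "f = fs ! 0" "f \<in> max_ideal n" using max by (metis length_greater_0_conv nth_mem subsetD)
      have "genideal (polyring n) ?I = ?I"
        using genideal_minimal[OF id order_refl] genideal_self[OF ideal_polyringD(1)[OF id]] by blast
      then have canc: "g \<in> ?I" if "g \<in> carrier (polyring n)" "f * g \<in> ?I" for g
        using reg that \<open>fs \<noteq> []\<close> f unfolding regular_seq_def by (auto dest!: spec[of _ 0])
      have pw: "f ^ k \<in> carrier (polyring n)" for k
      proof (induction k)
        case (Suc k)
        have "f \<in> mono_ideal (expos n)" using f(2) by (auto simp: max_ideal_eq mono_ideal_def)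
        then show ?case using Suc mono_ideal_mult expos_add unfolding carrier_polyring power_Suc by blast
      qed (simp add: polyring_def)
      have "f ^ k \<in> ?I \<Longrightarrow> 1 \<in> ?I" for k
      proof (induction k)
        case (Suc k)
        then show ?case using canc[OF pw, of k] by simp
      qed simp
      then show False using nilp[OF f(2)] one by blast
    qed
    then show "enat (length fs) \<le> 0" by (simp add: zero_enat_def)
  qed
  moreover have "krull_dim n ?I \<le> 0"
    unfolding krull_dim_def
  proof (rule Sup_least, clarify)
    fix d and P :: "nat \<Rightarrow> 'k mpoly set"
    assume P: "\<forall>j\<le>d. primeideal (P j) (polyring n) \<and> ?I \<subseteq> P j" and strict: "\<forall>j<d. P j \<subset> P (Suc j)"
    have "P j = max_ideal n" if "j \<le> d" for j
    proof (rule primeideal_eq_max_ideal)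
      show "primeideal (P j) (polyring n)" using P that by blast
      show "single (single i (e i)) 1 \<in> P j" if "i \<in> {1..n}" for i
      proof -
        have "single (single i (e i)) 1 \<in> ?I" using pow[OF that] by (simp add: mono_ideal_single)
        then show ?thesis using P \<open>j \<le> d\<close> by blast
      qed
    qed
    then have "d = 0" using strict by (metis Suc_leI gr0I le0 psubsetE subset_refl)
    then show "enat d \<le> 0" by (simp add: zero_enat_def)
  qed
  \<comment> \<open>In \<open>enat\<close> an upper bound 0 already means equality with 0, so depth
    and dimension agree.\<close>
  ultimately show ?thesis using ne by (simp add: cohen_macaulay_def)
qed

section \<open>From one graded differential to a free resolution\<close>

text \<open>Drops homological degree 0; the first differential, read in the single coordinate 0,
  becomes the new augmentation.\<close>

definition shift :: "'k::field free_cpx \<Rightarrow> 'k free_cpx" where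
  "shift F = \<lparr>degs = \<lambda>i. degs F (Suc i), dmat = \<lambda>i. dmat F (Suc i), aug = \<lambda>j. dmat F 0 j 0\<rparr>"

text \<open>Exactness at the rank-one module \<open>S\<close> says that the image of the first
  differential is the ideal, which is surjectivity of the new augmentation. Exactness one step
  higher becomes exactness at the new degree 0.\<close>

lemma minimal_free_resolution_shift:
  fixes F :: "'k::field free_cpx"
  assumes F: "minimal_free_resolution n (mono_ideal (expos n)) (mono_ideal X) F"
    and degs0: "degs F 0 = [0]" and aug0: "aug F 0 = 1" and X: "X \<subseteq> expos n"
  shows "minimal_free_resolution n (mono_ideal X) (mono_ideal {}) (shift F)"
proof -
  have res: "free_resolution n (mono_ideal (expos n)) (mono_ideal X) F"
    using F by (simp add: minimal_free_resolution_def)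
  then have mg: "multigraded n F"
    and exact0: "{v \<in> free_mod n F 0. aug_map F v \<in> mono_ideal X} = bd F 0 ` free_mod n F 1"
    and exact: "\<And>i. {v \<in> free_mod n F (Suc i). bd F i v = (\<lambda>k. 0)} = bd F (Suc i) ` free_mod n F (Suc (Suc i))"
    by (simp_all add: free_resolution_def)
  have fm: "free_mod n (shift F) i = free_mod n F (Suc i)" for i
    by (simp add: free_mod_def shift_def)
  have bd: "bd (shift F) i = bd F (Suc i)" for i
    by (simp add: bd_def shift_def fun_eq_iff)
  have bd0: "bd F 0 v = (\<lambda>k. if k = 0 then aug_map (shift F) v else 0)" for v
    by (simp add: bd_def shift_def aug_map_def degs0 fun_eq_iff)
  have am: "aug_map F v = v 0" for v by (simp add: aug_map_def degs0 aug0)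
  have zero: "mono_ideal {} = ({0} :: 'k mpoly set)" by (auto simp: mono_ideal_def)
  have "multigraded n (shift F)"
    unfolding multigraded_def
  proof (intro conjI allI impI)
    show "keys (aug (shift F) j) \<subseteq> {degs (shift F) 0 ! j}" if j: "j < length (degs (shift F) 0)" for j
    proof
      fix m assume "m \<in> keys (aug (shift F) j)"
      then have m: "m \<in> keys (dmat F 0 j 0)" by (simp add: shift_def)
      have "j < length (degs F (Suc 0))" "0 < length (degs F 0)" using j by (simp_all add: shift_def degs0)
      then have "m + degs F 0 ! 0 = degs F (Suc 0) ! j" using mg m unfolding multigraded_def by blast
      then show "m \<in> {degs (shift F) 0 ! j}" by (simp add: degs0 shift_def)
    qed
  qed (use mg in \<open>auto simp: multigraded_def shift_def\<close>)
  moreover have "aug (shift F) j \<in> mono_ideal X" if j: "j < length (degs (shift F) 0)" for j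
  proof -
    let ?e = "\<lambda>k. if k = j then 1 else (0 :: 'k mpoly)"
    have "?e \<in> free_mod n F 1" using j by (auto simp: free_mod_def polyring_def shift_def)
    then have "bd F 0 ?e \<in> {v \<in> free_mod n F 0. aug_map F v \<in> mono_ideal X}" unfolding exact0 by blast
    then have "aug_map (shift F) ?e \<in> mono_ideal X" by (simp add: am bd0)
    moreover have "aug_map (shift F) ?e = aug (shift F) j"
    proof -
      have "aug_map (shift F) ?e = (\<Sum>k<length (degs (shift F) 0). if k = j then aug (shift F) j else 0)"
        unfolding aug_map_def by (intro sum.cong) auto
      then show ?thesis using j by simp
    qed
    ultimately show ?thesis by simp
  qed
  moreover have "\<exists>v\<in>free_mod n (shift F) 0. p - aug_map (shift F) v \<in> mono_ideal {}"
    if p: "p \<in> mono_ideal X" for p :: "'k mpoly"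
  proof -
    let ?v = "\<lambda>k::nat. if k = 0 then p else 0"
    have "?v \<in> {v \<in> free_mod n F 0. aug_map F v \<in> mono_ideal X}"
      using p X by (auto simp: am free_mod_def degs0 polyring_def mono_ideal_def)
    then obtain w where w: "w \<in> free_mod n F 1" "?v = bd F 0 w" unfolding exact0 by blast
    from fun_cong[OF w(2), of 0] have "p = aug_map (shift F) w" by (simp add: bd0)
    then show ?thesis using w(1) by (intro bexI[of _ w]) (simp_all add: zero fm)
  qed
  moreover have "{v \<in> free_mod n (shift F) 0. aug_map (shift F) v \<in> mono_ideal {}} =
      bd (shift F) 0 ` free_mod n (shift F) 1"
  proof -
    have "bd F 0 v = (\<lambda>k. 0) \<longleftrightarrow> aug_map (shift F) v = 0" for v by (auto simp: bd0 fun_eq_iff)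
    then show ?thesis using exact[of 0] by (simp add: fm bd zero)
  qed
  moreover have "\<forall>i. \<forall>j<length (degs (shift F) (Suc i)). \<forall>k<length (degs (shift F) i).
      dmat (shift F) i j k \<in> max_ideal n"
    using F by (simp add: minimal_free_resolution_def shift_def)
  ultimately show ?thesis
    unfolding minimal_free_resolution_def free_resolution_def fm bd exact by simp
qed

section \<open>Splitting one merged differential into homological levels\<close>

definition level_list :: "'v set \<Rightarrow> ('v \<Rightarrow> nat) \<Rightarrow> nat \<Rightarrow> 'v list" where
  "level_list V lev i = (SOME vs. distinct vs \<and> set vs = {T \<in> V. lev T = i})"

lemma level_list:
  assumes "finite V"
  shows "distinct (level_list V lev i)" "set (level_list V lev i) = {T \<in> V. lev T = i}"
proof -
  have "finite {T \<in> V. lev T = i}" using assms by simp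
  then have "\<exists>vs. distinct vs \<and> set vs = {T \<in> V. lev T = i}" using finite_distinct_list by metis
  then have "distinct (level_list V lev i) \<and> set (level_list V lev i) = {T \<in> V. lev T = i}"
    unfolding level_list_def by (rule someI_ex)
  then show "distinct (level_list V lev i)" "set (level_list V lev i) = {T \<in> V. lev T = i}" by auto
qed

text \<open>The monomial of each entry is forced by the degrees. The augmentation 1 is homogeneous
  because level 0 will consist of one element of degree 0.\<close>

definition levels_cpx ::
    "'v set \<Rightarrow> ('v \<Rightarrow> nat) \<Rightarrow> ('v \<Rightarrow> expo) \<Rightarrow> ('v \<Rightarrow> 'v \<Rightarrow> 'k::field) \<Rightarrow> 'k free_cpx" where
  "levels_cpx V lev dg c =
    \<lparr>degs = \<lambda>i. map dg (level_list V lev i),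
     dmat = \<lambda>i j k. single (dg (level_list V lev (Suc i) ! j) - dg (level_list V lev i ! k))
       (c (level_list V lev (Suc i) ! j) (level_list V lev i ! k)),
     aug = \<lambda>j. 1\<rparr>"

text \<open>The root \<open>r\<close> will be the empty set, the generator of \<open>S\<close>.
  Every other degree lies in \<open>X\<close>, so in a degree outside \<open>X\<close> only the root
  survives.\<close>

locale minimal_rooted =
  fixes n :: nat and X :: "expo set" and V :: "'v set" and lev dg
    and c :: "'v \<Rightarrow> 'v \<Rightarrow> 'k::field" and r :: 'v
  assumes res: "resolving X V lev dg c"
    and X: "X \<subseteq> expos n" and up: "\<And>m m'. m \<in> X \<Longrightarrow> m' \<in> expos n \<Longrightarrow> m \<preceq> m' \<Longrightarrow> m' \<in> X"
    and root: "r \<in> V" "dg r = 0" "\<And>T. T \<in> V \<Longrightarrow> lev T = 0 \<longleftrightarrow> T = r"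
    and dgX: "\<And>T. T \<in> V \<Longrightarrow> T \<noteq> r \<Longrightarrow> dg T \<in> X"
    and minimal: "\<And>j k. j \<in> V \<Longrightarrow> k \<in> V \<Longrightarrow> dg j = dg k \<Longrightarrow> c j k = 0"
begin

abbreviation "vs i \<equiv> level_list V lev i"
abbreviation "F \<equiv> levels_cpx V lev dg c"

lemma fin: "finite V"
  using res by (simp add: resolving_def)

lemma graded: "j \<in> V \<Longrightarrow> k \<in> V \<Longrightarrow> c j k \<noteq> 0 \<Longrightarrow> lev j = Suc (lev k) \<and> dg k \<preceq> dg j"
  using res unfolding resolving_def by blast

lemma vs_nth: "j < length (vs i) \<Longrightarrow> vs i ! j \<in> V \<and> lev (vs i ! j) = i"
  using level_list(2)[OF fin, of lev i] nth_mem by blast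

lemma vs_0: "vs 0 = [r]"
proof -
  have "set (vs 0) = {r}" using level_list(2)[OF fin, of lev 0] root by auto
  then show ?thesis using level_list(1)[OF fin, of lev 0]
    by (metis distinct.simps(2) empty_set insert_not_empty list.set_cases list.set_intros(1) list.set_intros(2)
        neq_Nil_conv singletonD)
qed

lemma degs_F: "degs F i = map dg (vs i)"
  by (simp add: levels_cpx_def)

lemma dg_expos: "T \<in> V \<Longrightarrow> dg T \<in> expos n"
  using dgX X root(2) by (cases "T = r") auto

lemma multigraded_F: "multigraded n F"
  unfolding multigraded_def
proof (intro conjI allI impI)
  show "set (degs F i) \<subseteq> expos n" for i
    using level_list(2)[OF fin, of lev i] dg_expos by (auto simp: degs_F)
  fix i j k assume "j < length (degs F (Suc i))" "k < length (degs F i)"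
  then have j: "j < length (vs (Suc i))" and k: "k < length (vs i)" by (simp_all add: degs_F)
  show "dmat F i j k \<in> carrier (polyring n)"
    using dg_expos vs_nth[OF j] expos_diff
    by (simp add: levels_cpx_def carrier_polyring mono_ideal_single)
  show "\<forall>m\<in>keys (dmat F i j k). m + degs F i ! k = degs F (Suc i) ! j"
    using graded vs_nth[OF j] vs_nth[OF k] j k by (auto simp: levels_cpx_def)
next
  show "keys (aug F j) \<subseteq> {degs F 0 ! j}" if "j < length (degs F 0)" for j
    using that by (simp add: degs_F vs_0 root) (simp add: levels_cpx_def)
qed

lemma coef_F: "j < length (vs (Suc i)) \<Longrightarrow> k < length (vs i) \<Longrightarrow> coef F i j k = c (vs (Suc i) ! j) (vs i ! k)"
  by (simp add: coef_def degs_F) (simp add: levels_cpx_def)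

definition restrict_level :: "nat \<Rightarrow> ('v \<Rightarrow> 'k) \<Rightarrow> nat \<Rightarrow> 'k" where
  "restrict_level i w = (\<lambda>j. if j < length (vs i) then w (vs i ! j) else 0)"

lemma restrict_level_in_strand:
  "supported {T \<in> V. dg T \<preceq> u} w \<Longrightarrow> restrict_level i w \<in> strand F i u"
  using vs_nth by (auto simp: strand_def restrict_level_def supported_def degs_F)

lemma sbd_restrict_level: "sbd F i (restrict_level (Suc i) w) = restrict_level i (lin V c w)"
proof
  fix k
  show "sbd F i (restrict_level (Suc i) w) k = restrict_level i (lin V c w) k"
  proof (cases "k < length (vs i)")
    case True
    let ?T = "vs i ! k"
    have T: "?T \<in> V" "lev ?T = i" using vs_nth[OF True] by auto
    have "sbd F i (restrict_level (Suc i) w) k =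
        (\<Sum>j<length (vs (Suc i)). w (vs (Suc i) ! j) * c (vs (Suc i) ! j) ?T)"
      unfolding sbd_def lin_def
      by (intro sum.cong) (auto simp: degs_F restrict_level_def coef_F True)
    also have "\<dots> = (\<Sum>T'\<in>set (vs (Suc i)). w T' * c T' ?T)"
      using level_list(1)[OF fin, of lev "Suc i"]
      by (intro sum.reindex_bij_betw[of "\<lambda>j. vs (Suc i) ! j"]) (rule bij_betw_nth; simp)
    also have "\<dots> = (\<Sum>T'\<in>V. w T' * c T' ?T)"
      unfolding level_list(2)[OF fin]
    proof (rule sum.mono_neutral_left)
      show "\<forall>T'\<in>V - {T \<in> V. lev T = Suc i}. w T' * c T' ?T = 0" using graded T by fastforce
    qed (use fin in auto)
    finally show ?thesis using True by (simp add: restrict_level_def lin_def)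
  next
    case False
    then show ?thesis by (simp add: restrict_level_def sbd_def lin_def coef_def degs_F)
  qed
qed

text \<open>Extending by zero to the other levels turns a vector of one module into one for the
  merged differential.\<close>

lemma extend_level:
  assumes v: "v \<in> strand F i u"
  shows "\<exists>w. supported {T \<in> V. dg T \<preceq> u \<and> lev T = i} w \<and> restrict_level i w = v"
proof -
  define w where "w T = (\<Sum>j<length (vs i). if vs i ! j = T then v j else 0)" for T
  have w: "w (vs i ! j) = v j" if "j < length (vs i)" for j
  proof -
    have "w (vs i ! j) = (\<Sum>j'<length (vs i). if j' = j then v j else 0)"
      unfolding w_def using level_list(1)[OF fin, of lev i] that
      by (intro sum.cong) (auto simp: nth_eq_iff_index_eq)
    then show ?thesis using that by simp
  qed
  have "w T = 0" if "T \<notin> {T \<in> V. dg T \<preceq> u \<and> lev T = i}" for T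
    unfolding w_def
  proof (rule sum.neutral, intro ballI)
    fix j assume "j \<in> {..<length (vs i)}"
    then show "(if vs i ! j = T then v j else 0) = 0"
      using that v vs_nth[of j i] by (auto simp: strand_def degs_F)
  qed
  moreover have "restrict_level i w = v"
    using v w by (force simp: restrict_level_def strand_def degs_F fun_eq_iff)
  ultimately show ?thesis by (auto simp: supported_def)
qed

lemma sbd_sbd_F:
  assumes "v \<in> strand F (Suc (Suc i)) u"
  shows "sbd F i (sbd F (Suc i) v) = (\<lambda>k. 0)"
proof -
  obtain w where "restrict_level (Suc (Suc i)) w = v" using extend_level[OF assms] by blast
  then have "sbd F i (sbd F (Suc i) v) = restrict_level i (lin V c (lin V c w))"
    using sbd_restrict_level by metis
  moreover have "lin V c (lin V c w) k = 0" if "k \<in> V" for k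
    using res that unfolding lin_lin resolving_def square_zero_def
    by (simp add: lin_def[of V "\<lambda>j. lin V c (c j)"])
  ultimately show ?thesis using vs_nth by (auto simp: restrict_level_def)
qed

lemma saug_F: "saug F v = v 0"
  by (simp add: saug_def degs_F vs_0 aug_coef_def root) (simp add: levels_cpx_def)

text \<open>For \<open>u\<close> in \<open>X\<close> a cycle of level \<open>i\<close> is extended
  by zero and bounded by the merged complex; level \<open>i + 1\<close> of the bounding vector is
  the preimage. For other \<open>u\<close> the strand is the field in homological degree 0, which
  the augmentation maps isomorphically.\<close>

lemma exact_F:
  assumes u: "u \<in> expos n"
  shows "cyc X F i u = sbd F i ` strand F (Suc i) u"
proof (cases "u \<in> X")
  case True
  show ?thesis
  proof
    show "sbd F i ` strand F (Suc i) u \<subseteq> cyc X F i u"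
      using True sbd_in_strand[OF multigraded_F] sbd_sbd_F by (auto simp: cyc_def split: nat.split)
    show "cyc X F i u \<subseteq> sbd F i ` strand F (Suc i) u"
    proof
      fix v assume v: "v \<in> cyc X F i u"
      then obtain w where w: "supported {T \<in> V. dg T \<preceq> u \<and> lev T = i} w" "restrict_level i w = v"
        using extend_level[of v i u] by (auto simp: cyc_def)
      \<comment> \<open>Only an element \<open>k\<close> one level below \<open>i\<close> can
        receive anything from \<open>w\<close>; there the cycle condition on \<open>v\<close>
        applies.\<close>
      have "lin V c w k = 0" if k: "k \<in> V" for k
      proof (cases "i = Suc (lev k)")
        case True
        obtain l where l: "l < length (vs (lev k))" "vs (lev k) ! l = k"
          using k level_list(2)[OF fin, of lev "lev k"] by (metis (mono_tags, lifting) in_set_conv_nth mem_Collect_eq)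
        have "restrict_level (lev k) (lin V c w) l = sbd F (lev k) v l"
          using sbd_restrict_level[of "lev k" w] w(2) True by simp
        also have "\<dots> = 0" using v True by (simp add: cyc_def)
        finally show ?thesis using l by (simp add: restrict_level_def)
      next
        case False
        have "w j * c j k = 0" if "j \<in> V" for j
          using False graded[OF that k] w(1) by (auto simp: supported_def)
        then show ?thesis by (simp add: lin_def sum.neutral)
      qed
      moreover have "supported {T \<in> V. dg T \<preceq> u} w" using w(1) by (auto simp: supported_def)
      moreover have "exact_on V c {T \<in> V. dg T \<preceq> u}" using res True by (simp add: resolving_def)
      ultimately obtain w' where w': "supported {T \<in> V. dg T \<preceq> u} w'" "\<And>k. k \<in> V \<Longrightarrow> lin V c w' k = w k"
        unfolding exact_on_def by blast
      have "sbd F i (restrict_level (Suc i) w') = v"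
        unfolding sbd_restrict_level w(2)[symmetric] using w'(2) vs_nth by (auto simp: restrict_level_def)
      then show "v \<in> sbd F i ` strand F (Suc i) u" using restrict_level_in_strand[OF w'(1)] by blast
    qed
  qed
next
  case False
  have "v j = 0" if v: "v \<in> strand F (Suc i) u" for i v j
  proof (rule ccontr)
    assume "v j \<noteq> 0"
    then have j: "j < length (vs (Suc i))" and le: "dg (vs (Suc i) ! j) \<preceq> u"
      using v by (auto simp: strand_def degs_F)
    have "vs (Suc i) ! j \<in> V" "vs (Suc i) ! j \<noteq> r" using vs_nth[OF j] root(1,3) by force+
    then show False using False dgX up u le by blast
  qed
  then have "strand F (Suc i) u \<subseteq> {\<lambda>j. 0}" for i by (auto intro!: ext)
  moreover have "(\<lambda>j. 0) \<in> strand F (Suc i) u" for i by (simp add: strand_def)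
  ultimately have st: "strand F (Suc i) u = {\<lambda>j. 0}" for i by blast
  have "cyc X F i u = {\<lambda>j. 0}"
  proof (cases i)
    case 0
    have "v = (\<lambda>j. 0)" if "v \<in> cyc X F 0 u" for v
    proof
      fix j
      show "v j = 0"
        using that False by (cases "j = 0") (auto simp: cyc_def saug_F strand_def degs_F vs_0)
    qed
    then show ?thesis using zero_in_cyc 0 by blast
  next
    case (Suc i')
    then have "cyc X F i u \<subseteq> {\<lambda>j. 0}" using st by (auto simp: cyc_def)
    then show ?thesis using zero_in_cyc by blast
  qed
  then show ?thesis by (simp add: st sbd_def lin_zero)
qed

lemma minimal_free_resolution_F: "minimal_free_resolution n (mono_ideal (expos n)) (mono_ideal X) F"
  unfolding minimal_free_resolution_def
proof (intro conjI allI impI)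
  show "free_resolution n (mono_ideal (expos n)) (mono_ideal X) F"
    unfolding free_resolution_strandwise[OF multigraded_F order_refl]
  proof (intro conjI allI impI ballI exact_F)
    show "degs F 0 ! j \<in> expos n" if "j < length (degs F 0)" for j
      using degs_in_expos[OF multigraded_F that] .
    fix u
    have "(\<lambda>j. if j = 0 then 1 else 0) \<in> strand F 0 u"
      by (simp add: strand_def degs_F vs_0 root expo_le_def)
    then show "\<exists>w\<in>strand F 0 u. u \<in> X \<or> saug F w = 1"
      by (rule bexI[rotated]) (simp add: saug_F)
  qed
next
  fix i j k assume "j < length (degs F (Suc i))" "k < length (degs F i)"
  then have j: "vs (Suc i) ! j \<in> V" and k: "vs i ! k \<in> V" using vs_nth by (auto simp: degs_F)
  \<comment> \<open>Divisible degrees with difference 0 are equal, and entries between equal degrees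
    vanish by \<open>minimal\<close>.\<close>
  have "dg (vs (Suc i) ! j) - dg (vs i ! k) \<noteq> 0" if "c (vs (Suc i) ! j) (vs i ! k) \<noteq> 0"
    using graded[OF j k that] minimal[OF j k] that by (metis add_0 expo_le_diff_add)
  then show "dmat F i j k \<in> max_ideal n"
    using dg_expos[OF j] expos_diff by (auto simp: levels_cpx_def max_ideal_eq mono_ideal_single)
qed

lemma minimal_free_resolution_shift_F: "minimal_free_resolution n (mono_ideal X) (mono_ideal {}) (shift F)"
  by (rule minimal_free_resolution_shift[OF minimal_free_resolution_F _ _ X])
    (simp_all add: levels_cpx_def vs_0 root)

end

section \<open>The generators and their labels\<close>

lemma count_list_distinct: "distinct xs \<Longrightarrow> count_list xs x = (if x \<in> set xs then 1 else 0)"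
  by (induction xs) auto

locale two_generators =
  fixes n :: nat and a b :: expo and e :: "nat \<Rightarrow> nat"
  assumes a: "a \<in> expos n" and b: "b \<in> expos n"
    and not_le: "\<not> a \<preceq> b" "\<not> b \<preceq> a"
    and pos: "\<And>i. i \<in> {1..n} \<Longrightarrow> 0 < lookup a i + lookup b i"
    and e: "\<And>i. i \<in> {1..n} \<Longrightarrow> max (lookup a i) (lookup b i) < e i"
begin

abbreviation "Gens \<equiv> {1..n+2}"
abbreviation "Pures \<equiv> {3..n+2}"
abbreviation "P1 \<equiv> set_P1 n a b"
abbreviation "P2 \<equiv> set_P2 n a b"
abbreviation "A \<equiv> set_A n a"
abbreviation "B \<equiv> set_B n b"
abbreviation "lab \<equiv> lcm_label n a b e"
abbreviation "edges \<equiv> matching n a b"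

lemma mem_sets:
  "k \<in> P1 \<longleftrightarrow> k \<in> Pures \<and> lookup b (k - 2) < lookup a (k - 2)"
  "k \<in> P2 \<longleftrightarrow> k \<in> Pures \<and> lookup a (k - 2) < lookup b (k - 2)"
  "k \<in> A \<longleftrightarrow> k \<in> Pures \<and> 0 < lookup a (k - 2)"
  "k \<in> B \<longleftrightarrow> k \<in> Pures \<and> 0 < lookup b (k - 2)"
proof -
  have *: "k \<in> {i + 2 | i. i \<in> {1..n} \<and> P i} \<longleftrightarrow> k \<in> Pures \<and> P (k - 2)" for P :: "nat \<Rightarrow> bool"
    by (auto intro!: exI[of _ "k - 2"])
  show "k \<in> P1 \<longleftrightarrow> k \<in> Pures \<and> lookup b (k - 2) < lookup a (k - 2)"
    "k \<in> P2 \<longleftrightarrow> k \<in> Pures \<and> lookup a (k - 2) < lookup b (k - 2)"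
    "k \<in> A \<longleftrightarrow> k \<in> Pures \<and> 0 < lookup a (k - 2)"
    "k \<in> B \<longleftrightarrow> k \<in> Pures \<and> 0 < lookup b (k - 2)"
    unfolding set_P1_def set_P2_def set_A_def set_B_def by (rule *)+
qed

lemma pos': "k \<in> Pures \<Longrightarrow> 0 < lookup a (k - 2) \<or> 0 < lookup b (k - 2)"
proof -
  assume "k \<in> Pures"
  then have "k - 2 \<in> {1..n}" by auto
  then show ?thesis using pos[of "k - 2"] by linarith
qed

lemma sets_Pures: "P1 \<subseteq> Pures" "P2 \<subseteq> Pures" "A \<subseteq> Pures" "B \<subseteq> Pures"
  by (auto simp: mem_sets)

text \<open>Where \<open>a\<close> does not exceed \<open>b\<close>, the exponent of
  \<open>b\<close> is positive because the two exponents do not both vanish.\<close>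

lemma sets_rel: "P1 \<subseteq> A" "P2 \<subseteq> B" "Pures \<subseteq> P1 \<union> B" "Pures \<subseteq> A \<union> B" "P1 \<inter> P2 = {}" "A \<subseteq> P1 \<union> B"
  using pos' by (fastforce simp: mem_sets)+

lemma finite_sets: "finite P1" "finite P2" "finite A" "finite B"
  using sets_Pures finite_subset by blast+

lemma P_nonempty: "P1 \<noteq> {}" "P2 \<noteq> {}"
proof -
  have *: "\<exists>k\<in>Pures. lookup m' (k - 2) < lookup m (k - 2)"
    if m: "m \<in> expos n" and nle: "\<not> m \<preceq> m'" for m m'
  proof -
    obtain i where i: "lookup m' i < lookup m i" using nle unfolding expo_le_def by (meson linorder_not_le)
    then have "i \<in> keys m" by (simp add: in_keys_iff)
    then have "i \<in> {1..n}" using m by (auto simp: expos_def)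
    then show ?thesis using i by (intro bexI[of _ "i + 2"]) auto
  qed
  show "P1 \<noteq> {}" "P2 \<noteq> {}" using *[OF a not_le(1)] *[OF b not_le(2)] mem_sets by blast+
qed

lemma AB_nonempty: "A \<noteq> {}" "B \<noteq> {}"
  using P_nonempty sets_rel by auto

text \<open>The exponent of \<open>x_i\<close> in the lcm in closed form: \<open>e i\<close> exceeds
  both other candidates, so the pure power decides whenever it is present.\<close>

definition expo_at :: "nat set \<Rightarrow> nat \<Rightarrow> nat" where
  "expo_at T i = (if i + 2 \<in> T then e i
     else max (if 1 \<in> T then lookup a i else 0) (if 2 \<in> T then lookup b i else 0))"

lemma lookup_lab:
  assumes T: "T \<subseteq> Gens"
  shows "lookup (lab T) i = (if i \<in> {1..n} then expo_at T i else 0)"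
proof -
  let ?m = "\<lambda>i. Max (insert 0 ((\<lambda>k. lookup (gen a b e k) i) ` T))"
  have "lookup (lab T) i = (\<Sum>j\<in>{1..n}. if j = i then ?m i else 0)"
    unfolding lcm_label_def lookup_sum by (intro sum.cong) (auto simp: lookup_single when_def)
  also have "\<dots> = (if i \<in> {1..n} then ?m i else 0)" by simp
  also have "\<dots> = (if i \<in> {1..n} then expo_at T i else 0)"
  proof (rule if_cong[OF refl _ refl])
    assume i: "i \<in> {1..n}"
    have fin: "finite T" using T finite_subset by blast
    have g: "lookup (gen a b e k) i = (if k = 1 then lookup a i else if k = 2 then lookup b i
        else if k = i + 2 then e i else 0)" if "k \<in> T" for k
      using T that i by (auto simp: gen_def lookup_single when_def)
    show "?m i = expo_at T i"
    proof (rule Max_eqI)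
      show "finite (insert 0 ((\<lambda>k. lookup (gen a b e k) i) ` T))" using fin by simp
      show "y \<le> expo_at T i" if "y \<in> insert 0 ((\<lambda>k. lookup (gen a b e k) i) ` T)" for y
        using that e[OF i] by (auto simp: g expo_at_def split: if_splits)
      have "expo_at T i \<in> (\<lambda>k. lookup (gen a b e k) i) ` T" if "\<exists>k\<in>{1, 2, i + 2}. k \<in> T"
      proof -
        have "1 \<in> T \<or> 2 \<in> T \<or> i + 2 \<in> T" using that by auto
        then consider "i + 2 \<in> T" | "i + 2 \<notin> T" "1 \<in> T" "2 \<in> T \<longrightarrow> lookup b i \<le> lookup a i"
          | "i + 2 \<notin> T" "2 \<in> T" "1 \<in> T \<longrightarrow> lookup a i \<le> lookup b i"
          by (metis nat_le_linear)
        then show ?thesis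
        proof cases
          case 1
          then show ?thesis using i by (intro image_eqI[of _ _ "i + 2"]) (auto simp: g expo_at_def)
        next
          case 2
          then show ?thesis by (intro image_eqI[of _ _ 1]) (auto simp: g expo_at_def)
        next
          case 3
          then show ?thesis by (intro image_eqI[of _ _ 2]) (auto simp: g expo_at_def)
        qed
      qed
      moreover have "expo_at T i = 0" if "\<not> (\<exists>k\<in>{1, 2, i + 2}. k \<in> T)"
        using that by (auto simp: expo_at_def)
      ultimately show "expo_at T i \<in> insert 0 ((\<lambda>k. lookup (gen a b e k) i) ` T)" by blast
    qed
  qed
  finally show ?thesis .
qed

lemma lab_eq_iff:
  "T \<subseteq> Gens \<Longrightarrow> T' \<subseteq> Gens \<Longrightarrow> lab T = lab T' \<longleftrightarrow> (\<forall>i\<in>{1..n}. expo_at T i = expo_at T' i)"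
  by (auto simp: poly_mapping_eq_iff fun_eq_iff lookup_lab)

lemma gen_expos: "k \<in> Gens \<Longrightarrow> gen a b e k \<in> expos n"
  using a b by (auto simp: gen_def expos_def)

text \<open>The universal property of the lcm, in the form that \<open>resolving_taylor\<close> asks
  for.\<close>

lemma lab_le_iff:
  assumes T: "T \<subseteq> Gens"
  shows "lab T \<preceq> u \<longleftrightarrow> (\<forall>k\<in>T. gen a b e k \<preceq> u)"
proof -
  have fin: "finite T" using T finite_subset by blast
  have out: "lookup (gen a b e k) i = 0" if "k \<in> T" "i \<notin> {1..n}" for k i
    using gen_expos[of k] T that unfolding expos_def in_keys_iff subset_iff by blast
  have "lookup (lab T) i \<le> lookup u i \<longleftrightarrow> (\<forall>k\<in>T. lookup (gen a b e k) i \<le> lookup u i)" for i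
  proof -
    let ?m = "\<lambda>i. Max (insert 0 ((\<lambda>k. lookup (gen a b e k) i) ` T))"
    have "lookup (lab T) i = (\<Sum>j\<in>{1..n}. if j = i then ?m i else 0)"
      unfolding lcm_label_def lookup_sum by (intro sum.cong) (auto simp: lookup_single when_def)
    also have "\<dots> = (if i \<in> {1..n} then ?m i else 0)" by simp
    finally show ?thesis using fin out by auto
  qed
  then show ?thesis unfolding expo_le_def by blast
qed

lemma lab_expos: "T \<subseteq> Gens \<Longrightarrow> lab T \<in> expos n"
  by (auto simp: expos_def in_keys_iff lookup_lab split: if_splits)

text \<open>The exponent \<open>e i\<close> occurs at \<open>i\<close> only if
  \<open>x_i^(e_i)\<close> was used, since \<open>u_1\<close> and \<open>u_2\<close> stay strictly
  below it. This is why at most four sets share a label.\<close>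

lemma lab_eq_Pures:
  assumes "T \<subseteq> Gens" "T' \<subseteq> Gens" "lab T = lab T'"
  shows "T - {1, 2} = T' - {1, 2}"
proof -
  have *: "k \<in> T'" if "k \<in> T - {1, 2}" "T \<subseteq> Gens" "\<forall>i\<in>{1..n}. expo_at T i = expo_at T' i" for k T T'
  proof -
    have k: "k - 2 \<in> {1..n}" "k - 2 + 2 = k" using that by force+
    then have "expo_at T (k - 2) = e (k - 2)" using that by (simp add: expo_at_def)
    then have "expo_at T' (k - 2) = e (k - 2)" using that k by metis
    then show ?thesis using e[OF k(1)] k by (auto simp: expo_at_def max_def split: if_splits)
  qed
  show ?thesis
    using *[of _ T T'] *[of _ T' T] assms lab_eq_iff[OF assms(1,2)] by force
qed

text \<open>Inside \<open>Q\<close> all exponents agree, so labels are compared at the remaining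
  indices: the maximum equals the exponent of \<open>b\<close> exactly off \<open>P1\<close>, that
  of \<open>a\<close> exactly off \<open>P2\<close>, and so on. These are the four conditions of the
  matching.\<close>

lemma lab_eq_insert:
  assumes Q: "Q \<subseteq> Pures"
  shows "lab (insert 1 (insert 2 Q)) = lab (insert 2 Q) \<longleftrightarrow> P1 \<subseteq> Q"
    and "lab (insert 1 (insert 2 Q)) = lab (insert 1 Q) \<longleftrightarrow> P2 \<subseteq> Q"
    and "lab (insert 1 Q) = lab Q \<longleftrightarrow> A \<subseteq> Q"
    and "lab (insert 2 Q) = lab Q \<longleftrightarrow> B \<subseteq> Q"
    and "lab (insert 1 Q) = lab (insert 2 Q) \<Longrightarrow> P1 \<subseteq> Q"
proof -
  have sub: "Q \<subseteq> Gens" "insert 1 Q \<subseteq> Gens" "insert 2 Q \<subseteq> Gens" "insert 1 (insert 2 Q) \<subseteq> Gens"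
    using Q by auto
  have no: "1 \<notin> Q" "2 \<notin> Q" "Suc 0 \<notin> Q" using Q by auto
  have all: "(\<forall>i\<in>{1..n}. P i) \<longleftrightarrow> (\<forall>k\<in>Pures. P (k - 2))" for P :: "nat \<Rightarrow> bool"
  proof
    assume R: "\<forall>k\<in>Pures. P (k - 2)"
    show "\<forall>i\<in>{1..n}. P i"
    proof
      fix i assume "i \<in> {1..n}"
      then show "P i" using R[rule_format, of "i + 2"] by simp
    qed
  qed force
  have sh: "k - 2 + 2 = k" "k \<noteq> 1" "k \<noteq> 2" if "k \<in> Pures" for k using that by auto
  note * = lab_eq_iff[OF sub(4,3)] lab_eq_iff[OF sub(4,2)] lab_eq_iff[OF sub(2,1)]
    lab_eq_iff[OF sub(3,1)] lab_eq_iff[OF sub(2,3)]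
  have v: "expo_at (insert 1 (insert 2 Q)) (k - 2) = (if k \<in> Q then e (k - 2) else max (lookup a (k - 2)) (lookup b (k - 2)))"
    "expo_at (insert 1 Q) (k - 2) = (if k \<in> Q then e (k - 2) else lookup a (k - 2))"
    "expo_at (insert 2 Q) (k - 2) = (if k \<in> Q then e (k - 2) else lookup b (k - 2))"
    "expo_at Q (k - 2) = (if k \<in> Q then e (k - 2) else 0)" if "k \<in> Pures" for k
    unfolding expo_at_def sh(1)[OF that] using sh(2,3)[OF that] no by simp_all
  have sub_iff: "D \<subseteq> Q \<longleftrightarrow> (\<forall>k\<in>Pures. k \<in> D \<longrightarrow> k \<in> Q)" if "D \<subseteq> Pures" for D using that by blast
  show "lab (insert 1 (insert 2 Q)) = lab (insert 2 Q) \<longleftrightarrow> P1 \<subseteq> Q"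
    unfolding * all sub_iff[OF sets_Pures(1)]
    by (rule ball_cong[OF refl]) (simp only: v mem_sets, auto simp: max_def)
  show "lab (insert 1 (insert 2 Q)) = lab (insert 1 Q) \<longleftrightarrow> P2 \<subseteq> Q"
    unfolding * all sub_iff[OF sets_Pures(2)]
    by (rule ball_cong[OF refl]) (simp only: v mem_sets, auto simp: max_def)
  show "lab (insert 1 Q) = lab Q \<longleftrightarrow> A \<subseteq> Q"
    unfolding * all sub_iff[OF sets_Pures(3)]
    by (rule ball_cong[OF refl]) (simp only: v mem_sets, auto)
  show "lab (insert 2 Q) = lab Q \<longleftrightarrow> B \<subseteq> Q"
    unfolding * all sub_iff[OF sets_Pures(4)]
    by (rule ball_cong[OF refl]) (simp only: v mem_sets, auto)
  show "P1 \<subseteq> Q" if "lab (insert 1 Q) = lab (insert 2 Q)"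
  proof
    fix k assume k: "k \<in> P1"
    then have kP: "k \<in> Pures" using sets_Pures by blast
    then have "expo_at (insert 1 Q) (k - 2) = expo_at (insert 2 Q) (k - 2)"
      using that unfolding * all by blast
    then show "k \<in> Q" using k unfolding v[OF kP] mem_sets by (auto split: if_splits)
  qed
qed

end

section \<open>The matching and its critical vertices\<close>

lemma critical_iff: "critical n E T \<longleftrightarrow> T \<in> Pow {1..n+2} - (fst ` E \<union> snd ` E)"
proof -
  have "(\<forall>(T1, T2)\<in>E. T \<noteq> T1 \<and> T \<noteq> T2) \<longleftrightarrow> T \<notin> fst ` E \<union> snd ` E"
    by (auto simp: image_iff)
  then show ?thesis by (auto simp: critical_def graph_vertices_def)
qed

lemma insert_neqs:
  assumes "x \<noteq> y" "x \<notin> Q" "y \<notin> Q"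
  shows "insert x (insert y Q) \<noteq> insert x Q" "insert x (insert y Q) \<noteq> insert y Q"
    "insert x (insert y Q) \<noteq> Q" "insert x Q \<noteq> insert y Q" "insert x Q \<noteq> Q"
  using assms by (metis insertCI insert_iff)+

context two_generators
begin

text \<open>Sorts the edges by pure part; the exception in rule (4) becomes
  \<open>Q \<noteq> Pures\<close>.\<close>

lemma edges_iff:
  "(T, T') \<in> edges \<longleftrightarrow> (\<exists>Q\<subseteq>Pures.
     (T = insert 1 (insert 2 Q) \<and> T' = insert 2 Q \<and> P1 \<subseteq> Q) \<or>
     (T = insert 1 (insert 2 Q) \<and> T' = insert 1 Q \<and> \<not> P1 \<subseteq> Q \<and> P2 \<subseteq> Q) \<or>
     (T = insert 1 Q \<and> T' = Q \<and> A \<subseteq> Q) \<or>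
     (T = insert 2 Q \<and> T' = Q \<and> B \<subseteq> Q \<and> Q \<noteq> Pures))" (is "_ \<longleftrightarrow> ?R")
proof
  have no: "D \<subseteq> T \<longleftrightarrow> D \<subseteq> T - {1, 2}" if "D \<subseteq> Pures" for D T
    using that by fastforce
  assume "(T, T') \<in> edges"
  then have T: "T \<subseteq> Gens" and *: "(T' = T - {1} \<and> 1 \<in> T \<and> 2 \<in> T \<and> P1 \<subseteq> T) \<or>
     (T' = T - {2} \<and> 1 \<in> T \<and> 2 \<in> T \<and> \<not> P1 \<subseteq> T \<and> P2 \<subseteq> T) \<or>
     (T' = T - {1} \<and> 1 \<in> T \<and> 2 \<notin> T \<and> A \<subseteq> T) \<or>
     (T' = T - {2} \<and> 1 \<notin> T \<and> 2 \<in> T \<and> B \<subseteq> T \<and> T \<noteq> Gens - {1})"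
    unfolding matching_def graph_edges_def graph_vertices_def by auto
  let ?Q = "T - {1, 2}"
  have Q: "?Q \<subseteq> Pures"
  proof
    fix k assume "k \<in> ?Q"
    then have "k \<in> Gens" "k \<noteq> 1" "k \<noteq> 2" using T by auto
    then show "k \<in> Pures" by simp
  qed
  have "?Q \<noteq> Pures" if "1 \<notin> T" "2 \<in> T" "T \<noteq> Gens - {1}"
  proof
    assume eq: "?Q = Pures"
    have "T = insert 2 ?Q" using that by auto
    also have "\<dots> = Gens - {1}" unfolding eq by auto
    finally show False using that by simp
  qed
  with * have "(T = insert 1 (insert 2 ?Q) \<and> T' = insert 2 ?Q \<and> P1 \<subseteq> ?Q) \<or>
     (T = insert 1 (insert 2 ?Q) \<and> T' = insert 1 ?Q \<and> \<not> P1 \<subseteq> ?Q \<and> P2 \<subseteq> ?Q) \<or>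
     (T = insert 1 ?Q \<and> T' = ?Q \<and> A \<subseteq> ?Q) \<or>
     (T = insert 2 ?Q \<and> T' = ?Q \<and> B \<subseteq> ?Q \<and> ?Q \<noteq> Pures)"
  proof (elim disjE conjE)
    assume "T' = T - {1}" "1 \<in> T" "2 \<in> T" "P1 \<subseteq> T"
    then have "T = insert 1 (insert 2 ?Q)" "T' = insert 2 ?Q" "P1 \<subseteq> ?Q" using no[OF sets_Pures(1)] by auto
    then show ?thesis by blast
  next
    assume "T' = T - {2}" "1 \<in> T" "2 \<in> T" "\<not> P1 \<subseteq> T" "P2 \<subseteq> T"
    then have "T = insert 1 (insert 2 ?Q)" "T' = insert 1 ?Q" "\<not> P1 \<subseteq> ?Q" "P2 \<subseteq> ?Q"
      using no[OF sets_Pures(2)] by auto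
    then show ?thesis by blast
  next
    assume "T' = T - {1}" "1 \<in> T" "2 \<notin> T" "A \<subseteq> T"
    then have "T = insert 1 ?Q" "T' = ?Q" "A \<subseteq> ?Q" using no[OF sets_Pures(3)] by auto
    then show ?thesis by blast
  next
    assume "T' = T - {2}" "1 \<notin> T" "2 \<in> T" "B \<subseteq> T"
      "1 \<notin> T \<Longrightarrow> 2 \<in> T \<Longrightarrow> T \<noteq> Gens - {1} \<Longrightarrow> ?Q \<noteq> Pures" "T \<noteq> Gens - {1}"
    then have "T = insert 2 ?Q" "T' = ?Q" "B \<subseteq> ?Q" "?Q \<noteq> Pures" using no[OF sets_Pures(4)] by auto
    then show ?thesis by blast
  qed
  then show ?R by (intro exI[of _ ?Q] conjI Q)
next
  assume ?R
  then obtain Q where Q: "Q \<subseteq> Pures" and *: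
    "(T = insert 1 (insert 2 Q) \<and> T' = insert 2 Q \<and> P1 \<subseteq> Q) \<or>
     (T = insert 1 (insert 2 Q) \<and> T' = insert 1 Q \<and> \<not> P1 \<subseteq> Q \<and> P2 \<subseteq> Q) \<or>
     (T = insert 1 Q \<and> T' = Q \<and> A \<subseteq> Q) \<or>
     (T = insert 2 Q \<and> T' = Q \<and> B \<subseteq> Q \<and> Q \<noteq> Pures)" by blast
  have no: "1 \<notin> Q" "2 \<notin> Q" and fin: "finite Q" using Q finite_subset by auto
  have nD: "1 \<notin> P1" "2 \<notin> P1" using sets_Pures by auto
  have edge: "(T, T') \<in> graph_edges n" if "T \<subseteq> Gens" "x \<in> T" "T' = T - {x}" for x
    using that finite_subset[OF that(1)] card_Suc_Diff1[of T x]
    by (auto simp: graph_edges_def graph_vertices_def)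
  have G: "Q \<subseteq> Gens" "1 \<in> Gens" "2 \<in> Gens" using Q by auto
  have notfull: "insert 2 Q \<noteq> Gens - {1}" if "Q \<noteq> Pures"
  proof
    assume eq: "insert 2 Q = Gens - {1}"
    have "Q = insert 2 Q - {2}" using no by auto
    also have "\<dots> = Pures" unfolding eq by auto
    finally show False using that by simp
  qed
  from * show "(T, T') \<in> edges"
  proof (elim disjE conjE)
    assume T: "T = insert 1 (insert 2 Q)" "T' = insert 2 Q" "P1 \<subseteq> Q"
    then have "T' = T - {1}" using no by auto
    moreover have "(T, T') \<in> graph_edges n" by (rule edge[of 1]) (use T G no in auto)
    ultimately show ?thesis using T by (auto simp: matching_def)
  next
    assume T: "T = insert 1 (insert 2 Q)" "T' = insert 1 Q" "\<not> P1 \<subseteq> Q" "P2 \<subseteq> Q"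
    then have "T' = T - {2}" using no by auto
    moreover have "(T, T') \<in> graph_edges n" by (rule edge[of 2]) (use T G no in auto)
    moreover have "\<not> P1 \<subseteq> T" using T nD by auto
    ultimately show ?thesis using T by (auto simp: matching_def)
  next
    assume T: "T = insert 1 Q" "T' = Q" "A \<subseteq> Q"
    then have "T' = T - {1}" using no by auto
    moreover have "(T, T') \<in> graph_edges n" by (rule edge[of 1]) (use T G no in auto)
    ultimately show ?thesis using T no by (auto simp: matching_def)
  next
    assume T: "T = insert 2 Q" "T' = Q" "B \<subseteq> Q" "Q \<noteq> Pures"
    then have "T' = T - {2}" using no by auto
    moreover have "(T, T') \<in> graph_edges n" by (rule edge[of 2]) (use T G no in auto)
    ultimately show ?thesis using T no notfull by (auto simp: matching_def)
  qed
qed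

lemma A_subset_imp_P1: "A \<subseteq> Q \<Longrightarrow> P1 \<subseteq> Q"
  using sets_rel by blast

text \<open>Rules (1) and (4) compete for \<open>insert 2 Q\<close> only at
  \<open>Q = Pures\<close>, which is precisely what the exception in rule (4) excludes.\<close>

lemma P1_B_subset_imp_full: "P1 \<subseteq> Q \<Longrightarrow> B \<subseteq> Q \<Longrightarrow> Q \<subseteq> Pures \<Longrightarrow> Q = Pures"
  using sets_rel by blast

lemma A_B_subset_imp_full: "A \<subseteq> Q \<Longrightarrow> B \<subseteq> Q \<Longrightarrow> Q \<subseteq> Pures \<Longrightarrow> Q = Pures"
  using sets_rel by blast

lemma pure_part:
  assumes "Q \<subseteq> Pures"
  shows "insert 1 (insert 2 Q) - {1, 2} = Q" "insert 1 Q - {1, 2} = Q" "insert 2 Q - {1, 2} = Q" "Q - {1, 2} = Q"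
    "1 \<notin> Q" "2 \<notin> Q"
  using assms by auto

text \<open>Both ends of an edge have the same pure part, so only edges over one \<open>Q\<close>
  can meet. There the rules collide only if \<open>A\<close> is contained in \<open>Q\<close> and
  \<open>P1\<close> is not, or if \<open>Q = Pures\<close> and rule (4) applies.\<close>

lemma edges_disjoint:
  assumes pq: "(p, q) \<in> edges" and pq': "(p', q') \<in> edges" and meet: "{p, q} \<inter> {p', q'} \<noteq> {}"
  shows "(p, q) = (p', q')"
proof -
  obtain Q where Q: "Q \<subseteq> Pures" and *:
    "(p = insert 1 (insert 2 Q) \<and> q = insert 2 Q \<and> P1 \<subseteq> Q) \<or>
     (p = insert 1 (insert 2 Q) \<and> q = insert 1 Q \<and> \<not> P1 \<subseteq> Q \<and> P2 \<subseteq> Q) \<or>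
     (p = insert 1 Q \<and> q = Q \<and> A \<subseteq> Q) \<or>
     (p = insert 2 Q \<and> q = Q \<and> B \<subseteq> Q \<and> Q \<noteq> Pures)"
    using pq unfolding edges_iff by blast
  obtain Q' where Q': "Q' \<subseteq> Pures" and pq'_cases:
    "(p' = insert 1 (insert 2 Q') \<and> q' = insert 2 Q' \<and> P1 \<subseteq> Q') \<or>
     (p' = insert 1 (insert 2 Q') \<and> q' = insert 1 Q' \<and> \<not> P1 \<subseteq> Q' \<and> P2 \<subseteq> Q') \<or>
     (p' = insert 1 Q' \<and> q' = Q' \<and> A \<subseteq> Q') \<or>
     (p' = insert 2 Q' \<and> q' = Q' \<and> B \<subseteq> Q' \<and> Q' \<noteq> Pures)"
    using pq' unfolding edges_iff by blast
  have "r - {1, 2} = Q" if "r \<in> {p, q}" for r using that * pure_part[OF Q] by auto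
  moreover have "r - {1, 2} = Q'" if "r \<in> {p', q'}" for r using that pq'_cases pure_part[OF Q'] by auto
  ultimately have eq: "Q' = Q" using meet by blast
  \<comment> \<open>Encoding the four subsets over \<open>Q\<close> by two booleans makes the sixteen cases propositional.\<close>
  define v where "v x y = (if x then {1} else {}) \<union> (if y then {2} else {}) \<union> Q" for x y
  have inj: "v x y = v x' y' \<longleftrightarrow> x = x' \<and> y = y'" for x y x' y'
  proof -
    have "1 \<in> v x y \<longleftrightarrow> x" "2 \<in> v x y \<longleftrightarrow> y" for x y using pure_part(5,6)[OF Q] by (auto simp: v_def)
    then have mem: "1 \<in> v x y \<longleftrightarrow> x" "2 \<in> v x y \<longleftrightarrow> y" for x y .
    show ?thesis
    proof
      assume "v x y = v x' y'"
      then have "1 \<in> v x y \<longleftrightarrow> 1 \<in> v x' y'" "2 \<in> v x y \<longleftrightarrow> 2 \<in> v x' y'" by simp_all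
      then show "x = x' \<and> y = y'" by (simp only: mem)
    qed simp
  qed
  have vs: "insert 1 (insert 2 Q) = v True True" "insert 1 Q = v True False" "insert 2 Q = v False True" "Q = v False False"
    by (auto simp: v_def)
  have c: "A \<subseteq> Q \<Longrightarrow> P1 \<subseteq> Q" "P1 \<subseteq> Q \<Longrightarrow> B \<subseteq> Q \<Longrightarrow> Q = Pures" "A \<subseteq> Q \<Longrightarrow> B \<subseteq> Q \<Longrightarrow> Q = Pures"
    using A_subset_imp_P1 P1_B_subset_imp_full A_B_subset_imp_full Q by blast+
  have 1: "(p = v True True \<and> q = v False True \<and> P1 \<subseteq> Q) \<or>
     (p = v True True \<and> q = v True False \<and> \<not> P1 \<subseteq> Q \<and> P2 \<subseteq> Q) \<or>
     (p = v True False \<and> q = v False False \<and> A \<subseteq> Q) \<or>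
     (p = v False True \<and> q = v False False \<and> B \<subseteq> Q \<and> Q \<noteq> Pures)"
    using * vs by metis
  have 2: "(p' = v True True \<and> q' = v False True \<and> P1 \<subseteq> Q) \<or>
     (p' = v True True \<and> q' = v True False \<and> \<not> P1 \<subseteq> Q \<and> P2 \<subseteq> Q) \<or>
     (p' = v True False \<and> q' = v False False \<and> A \<subseteq> Q) \<or>
     (p' = v False True \<and> q' = v False False \<and> B \<subseteq> Q \<and> Q \<noteq> Pures)"
    using pq'_cases vs unfolding eq by metis
  have meet': "p = p' \<or> p = q' \<or> q = p' \<or> q = q'" using meet by auto
  show ?thesis
    using 1 2 meet' c
    by (elim disjE conjE) (simp_all only: inj simp_thms prod.inject)
qed

lemma edges_lab:
  assumes "(p, q) \<in> edges"
  shows "lab p = lab q" "p \<subseteq> Gens" "q \<subseteq> Gens" "\<exists>x\<in>p. q = p - {x}" "p \<noteq> {}" "q \<noteq> {}"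
proof -
  obtain Q where Q: "Q \<subseteq> Pures" and *:
    "(p = insert 1 (insert 2 Q) \<and> q = insert 2 Q \<and> P1 \<subseteq> Q) \<or>
     (p = insert 1 (insert 2 Q) \<and> q = insert 1 Q \<and> \<not> P1 \<subseteq> Q \<and> P2 \<subseteq> Q) \<or>
     (p = insert 1 Q \<and> q = Q \<and> A \<subseteq> Q) \<or>
     (p = insert 2 Q \<and> q = Q \<and> B \<subseteq> Q \<and> Q \<noteq> Pures)"
    using assms unfolding edges_iff by blast
  show "lab p = lab q" using * lab_eq_insert[OF Q] by blast
  have "Q \<subseteq> Gens" "1 \<in> Gens" "2 \<in> Gens" using Q by auto
  then show "p \<subseteq> Gens" "q \<subseteq> Gens" using * by blast+
  have "q = p - {1} \<and> 1 \<in> p \<or> q = p - {2} \<and> 2 \<in> p" using * pure_part(5,6)[OF Q] by auto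
  then show "\<exists>x\<in>p. q = p - {x}" by blast
  show "p \<noteq> {}" using * by blast
  show "q \<noteq> {}" using * AB_nonempty by blast
qed

lemma lab_eq_remove:
  assumes "T \<subseteq> Gens" "x \<in> T" "lab T = lab (T - {x})"
  shows "x = 1 \<or> x = 2"
  using lab_eq_Pures[of T "T - {x}"] assms by blast

definition crits :: "nat set set" where
  "crits = {T. critical n edges T}"

lemma crits_eq: "crits = Pow Gens - (fst ` edges \<union> snd ` edges)"
  unfolding crits_def critical_iff by (rule Collect_mem_eq)

lemma crits_iff:
  assumes Q: "Q \<subseteq> Pures"
  shows "insert 1 (insert 2 Q) \<in> crits \<longleftrightarrow> \<not> P1 \<subseteq> Q \<and> \<not> P2 \<subseteq> Q"
    and "insert 1 Q \<in> crits \<longleftrightarrow> \<not> A \<subseteq> Q \<and> (P1 \<subseteq> Q \<or> \<not> P2 \<subseteq> Q)"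
    and "insert 2 Q \<in> crits \<longleftrightarrow> \<not> P1 \<subseteq> Q \<and> \<not> B \<subseteq> Q"
    and "Q \<in> crits \<longleftrightarrow> \<not> A \<subseteq> Q \<and> \<not> B \<subseteq> Q"
proof -
  have on_edge: "T \<in> fst ` edges \<union> snd ` edges \<longleftrightarrow>
      (T = insert 1 (insert 2 Q) \<and> (P1 \<subseteq> Q \<or> P2 \<subseteq> Q)) \<or>
      (T = insert 1 Q \<and> (A \<subseteq> Q \<or> (\<not> P1 \<subseteq> Q \<and> P2 \<subseteq> Q))) \<or>
      (T = insert 2 Q \<and> (P1 \<subseteq> Q \<or> (B \<subseteq> Q \<and> Q \<noteq> Pures))) \<or>
      (T = Q \<and> (A \<subseteq> Q \<or> (B \<subseteq> Q \<and> Q \<noteq> Pures)))" (is "_ \<longleftrightarrow> ?R")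
    if TQ: "T - {1, 2} = Q" for T
  proof
    assume "T \<in> fst ` edges \<union> snd ` edges"
    then obtain p q where pq: "(p, q) \<in> edges" "T = p \<or> T = q" by force
    then obtain Q' where Q': "Q' \<subseteq> Pures" and *:
      "(p = insert 1 (insert 2 Q') \<and> q = insert 2 Q' \<and> P1 \<subseteq> Q') \<or>
       (p = insert 1 (insert 2 Q') \<and> q = insert 1 Q' \<and> \<not> P1 \<subseteq> Q' \<and> P2 \<subseteq> Q') \<or>
       (p = insert 1 Q' \<and> q = Q' \<and> A \<subseteq> Q') \<or>
       (p = insert 2 Q' \<and> q = Q' \<and> B \<subseteq> Q' \<and> Q' \<noteq> Pures)"
      unfolding edges_iff by blast
    have "T - {1, 2} = Q'" using * pq(2) pure_part[OF Q'] by metis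
    then have "Q' = Q" using TQ by simp
    then show ?R using * pq(2) by blast
  next
    let ?on = "fst ` edges \<union> snd ` edges"
    have img: "p \<in> ?on" "q \<in> ?on" if "(p, q) \<in> edges" for p q using that by force+
    have e1: "(insert 1 (insert 2 Q), insert 2 Q) \<in> edges" if "P1 \<subseteq> Q"
      unfolding edges_iff using Q that by blast
    have e2: "(insert 1 (insert 2 Q), insert 1 Q) \<in> edges" if "\<not> P1 \<subseteq> Q" "P2 \<subseteq> Q"
      unfolding edges_iff using Q that by blast
    have e2': "insert 1 (insert 2 Q) \<in> ?on" if "P2 \<subseteq> Q"
      using e1[THEN img(1)] e2[THEN img(1)] that by (cases "P1 \<subseteq> Q") simp_all
    have e3: "(insert 1 Q, Q) \<in> edges" if "A \<subseteq> Q"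
      unfolding edges_iff using Q that by blast
    have e4: "(insert 2 Q, Q) \<in> edges" if "B \<subseteq> Q" "Q \<noteq> Pures"
      unfolding edges_iff using Q that by blast
    assume ?R
    then show "T \<in> ?on"
      by (elim disjE conjE)
        (simp_all only: e1[THEN img(1)] e1[THEN img(2)] e2' e2[THEN img(2)] e3[THEN img(1)] e3[THEN img(2)]
          e4[THEN img(1)] e4[THEN img(2)] simp_thms)
  qed
  have G: "Q \<subseteq> Gens" "1 \<in> Gens" "2 \<in> Gens" using Q by auto
  then have sub: "insert 1 (insert 2 Q) \<in> Pow Gens" "insert 1 Q \<in> Pow Gens" "insert 2 Q \<in> Pow Gens" "Q \<in> Pow Gens"
    by blast+
  have ne: "insert 1 (insert 2 Q) \<noteq> insert 1 Q" "insert 1 (insert 2 Q) \<noteq> insert 2 Q" "insert 1 (insert 2 Q) \<noteq> Q"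
    "insert 1 Q \<noteq> insert 2 Q" "insert 1 Q \<noteq> Q" "insert 2 Q \<noteq> Q"
    using insert_neqs[of 1 2 Q] insert_neqs(5)[of 2 1 Q] pure_part(5,6)[OF Q] by simp_all
  \<comment> \<open>Over \<open>Q = Pures\<close> the sets \<open>insert 2 Q\<close> and
    \<open>Q\<close> are matched by rules (1) and (3), so the exception in rule (4) disappears from
    the criterion.\<close>
  have full: "A \<subseteq> Q" "P1 \<subseteq> Q" if "Q = Pures" using that sets_Pures by blast+
  note d = Diff_iff sub on_edge[OF pure_part(1)[OF Q]] on_edge[OF pure_part(2)[OF Q]]
    on_edge[OF pure_part(3)[OF Q]] on_edge[OF pure_part(4)[OF Q]]
  show "insert 1 (insert 2 Q) \<in> crits \<longleftrightarrow> \<not> P1 \<subseteq> Q \<and> \<not> P2 \<subseteq> Q"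
    unfolding crits_eq d using G(1) ne by simp
  show "insert 1 Q \<in> crits \<longleftrightarrow> \<not> A \<subseteq> Q \<and> (P1 \<subseteq> Q \<or> \<not> P2 \<subseteq> Q)"
    unfolding crits_eq d using G(1) ne ne[symmetric] by simp
  show "insert 2 Q \<in> crits \<longleftrightarrow> \<not> P1 \<subseteq> Q \<and> \<not> B \<subseteq> Q"
    unfolding crits_eq d using G(1) ne ne[symmetric] full by (cases "Q = Pures") simp_all
  show "Q \<in> crits \<longleftrightarrow> \<not> A \<subseteq> Q \<and> \<not> B \<subseteq> Q"
    unfolding crits_eq d using G(1) ne[symmetric] full by (cases "Q = Pures") simp_all
qed

lemma pure_cases:
  assumes "T \<subseteq> Gens"
  obtains Q where "Q \<subseteq> Pures" "T - {1, 2} = Q"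
    "T = insert 1 (insert 2 Q) \<or> T = insert 1 Q \<or> T = insert 2 Q \<or> T = Q"
proof
  show "T - {1, 2} \<subseteq> Pures"
  proof
    fix k assume "k \<in> T - {1, 2}"
    then have "k \<in> Gens" "k \<noteq> 1" "k \<noteq> 2" using assms by auto
    then show "k \<in> Pures" by simp
  qed
  show "T = insert 1 (insert 2 (T - {1, 2})) \<or> T = insert 1 (T - {1, 2}) \<or> T = insert 2 (T - {1, 2}) \<or> T = T - {1, 2}"
    by blast
qed simp

lemma crits_subset: "T \<in> crits \<Longrightarrow> T \<subseteq> Gens"
  by (auto simp: crits_eq)

text \<open>Equal labels give equal pure parts, and then equal sizes leave only
  \<open>insert 1 Q\<close> against \<open>insert 2 Q\<close>. Equality of these labels puts
  \<open>P1\<close> into \<open>Q\<close>, so \<open>insert 2 Q\<close> is not critical.\<close>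

lemma lab_inj_on_crits:
  assumes T: "T \<in> crits" and T': "T' \<in> crits" and eq: "lab T = lab T'" and card: "card T = card T'"
  shows "T = T'"
proof -
  obtain Q where Q: "Q \<subseteq> Pures" "T - {1, 2} = Q"
    and TQ: "T = insert 1 (insert 2 Q) \<or> T = insert 1 Q \<or> T = insert 2 Q \<or> T = Q"
    using pure_cases[OF crits_subset[OF T]] .
  obtain Q' where Q': "Q' \<subseteq> Pures" "T' - {1, 2} = Q'"
    and TQ': "T' = insert 1 (insert 2 Q') \<or> T' = insert 1 Q' \<or> T' = insert 2 Q' \<or> T' = Q'"
    using pure_cases[OF crits_subset[OF T']] .
  have "Q' = Q" using lab_eq_Pures[OF crits_subset[OF T] crits_subset[OF T'] eq] Q Q' by simp
  have fin: "finite Q" using Q finite_subset by blast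
  have cards: "card (insert 1 (insert 2 Q)) = card Q + 2" "card (insert 1 Q) = card Q + 1" "card (insert 2 Q) = card Q + 1"
    using fin pure_part(5,6)[OF Q(1)] by auto
  have no: False if "insert 2 Q \<in> crits" "lab (insert 1 Q) = lab (insert 2 Q)"
    using that crits_iff(3)[OF Q(1)] lab_eq_insert(5)[OF Q(1)] by blast
  show ?thesis
    using TQ TQ' card cards eq T T' no unfolding \<open>Q' = Q\<close> by (elim disjE) auto
qed

text \<open>Removing an element without changing the label would put one of \<open>P1\<close>,
  \<open>P2\<close>, \<open>A\<close>, \<open>B\<close> into \<open>Q\<close>, the very inclusion
  that criticality of \<open>T\<close> forbids.\<close>

lemma crits_minimal:
  assumes T: "T \<in> crits" and T': "T - {x} \<in> crits" and x: "x \<in> T"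
  shows "lab T \<noteq> lab (T - {x})"
proof
  assume eq: "lab T = lab (T - {x})"
  obtain Q where Q: "Q \<subseteq> Pures" "T - {1, 2} = Q"
    and TQ: "T = insert 1 (insert 2 Q) \<or> T = insert 1 Q \<or> T = insert 2 Q \<or> T = Q"
    using pure_cases[OF crits_subset[OF T]] .
  note no = pure_part(5,6)[OF Q(1)]
  have x12: "x = 1 \<or> x = 2" using lab_eq_remove[OF crits_subset[OF T] x eq] .
  have "insert 1 (insert 2 Q) - {1} = insert 2 Q" "insert 1 (insert 2 Q) - {2} = insert 1 Q"
    "insert 1 Q - {1} = Q" "insert 2 Q - {2} = Q"
    using no by auto
  then show False
    using TQ x12 x no T eq crits_iff[OF Q(1)] lab_eq_insert[OF Q(1)] by (elim disjE) simp_all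
qed

text \<open>Critical sets are classified by their complements. A complement with at most one element
  is impossible because \<open>P1\<close> and \<open>P2\<close> are disjoint subsets of
  \<open>Pures\<close>; two-element complements give the count.\<close>

lemma card_crits:
  "card {T \<in> crits. card T = n} = card (A \<inter> B) + card P1 * card P2" (is ?card)
  and card_crits_le: "T \<in> crits \<Longrightarrow> card T \<le> n"
proof -
  have cardG: "card Gens = n + 2" by simp
  have co1: "T \<noteq> Gens - {x}" if T: "T \<in> crits" for T x
  proof
    assume eq: "T = Gens - {x}"
    show False
    proof (cases "x \<in> {1, 2}")
      case True
      have "Gens - {1} = insert 2 Pures" "Gens - {2} = insert 1 Pures" by auto
      then have "T = insert 2 Pures \<or> T = insert 1 Pures" using eq True by blast
      moreover have "insert 1 Pures \<notin> crits" "insert 2 Pures \<notin> crits"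
        using crits_iff(2,3)[OF order_refl] sets_Pures by simp_all
      ultimately show False using T by metis
    next
      case False
      let ?Q = "Pures - {x}"
      have "T = insert 1 (insert 2 ?Q)" using eq False by auto
      then have "\<not> P1 \<subseteq> ?Q" "\<not> P2 \<subseteq> ?Q" using T crits_iff(1)[of ?Q] by auto
      then show False using sets_Pures sets_rel(5) by blast
    qed
  qed
  have coG: "T \<noteq> Gens" if T: "T \<in> crits" for T
    \<comment> \<open>The index 0 does not occur, so \<open>Gens - {0}\<close> is all of
      \<open>Gens\<close>.\<close>
    using co1[OF T, of 0] by auto
  have co: "card (Gens - T) = n + 2 - card T" if "T \<in> crits" for T
    using crits_subset[OF that] by (simp add: card_Diff_subset finite_subset)
  show "card T \<le> n" if T: "T \<in> crits" for T
  proof (rule ccontr)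
    assume "\<not> card T \<le> n"
    then have "card (Gens - T) = 0 \<or> card (Gens - T) = 1" using co[OF T] by arith
    then have "Gens - T = {} \<or> (\<exists>x. Gens - T = {x})" by (auto simp: card_1_singleton_iff)
    then have "T = Gens \<or> (\<exists>x. T = Gens - {x})" using crits_subset[OF T] by blast
    then show False using co1[OF T] coG[OF T] by blast
  qed
  let ?f = "\<lambda>(x, y). Gens - {x, y}"
  \<comment> \<open>\<open>Gens - {1, x}\<close> is critical for \<open>x\<close> in
    \<open>P1 \<inter> B\<close>, \<open>Gens - {2, x}\<close> for \<open>x\<close> in
    \<open>A - P1\<close>; the case distinction selects the index to omit along with
    \<open>x\<close>.\<close>
  let ?h = "\<lambda>x. Gens - {if x \<in> P1 then 1 else 2, x}"
  have ge3: "3 \<le> x \<and> x \<le> n + 2" if "x \<in> P1 \<union> P2 \<union> A \<union> B" for x using that sets_Pures by auto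
  have crit12: "Gens - {x, y} \<in> crits \<longleftrightarrow> (x \<in> P1 \<and> y \<in> P2) \<or> (x \<in> P2 \<and> y \<in> P1)"
    if "x \<in> Pures" "y \<in> Pures" "x \<noteq> y" for x y
  proof -
    have "Gens - {x, y} = insert 1 (insert 2 (Pures - {x, y}))" using that by auto
    then show ?thesis using crits_iff(1)[of "Pures - {x, y}"] sets_Pures sets_rel(5) by auto
  qed
  have crit2: "Gens - {2, x} \<in> crits \<longleftrightarrow> x \<in> A \<and> x \<notin> P1" if "x \<in> Pures" for x
  proof -
    have "Gens - {2, x} = insert 1 (Pures - {x})" using that by auto
    then show ?thesis using crits_iff(2)[of "Pures - {x}"] sets_Pures sets_rel(5) by auto
  qed
  have crit1: "Gens - {1, x} \<in> crits \<longleftrightarrow> x \<in> P1 \<and> x \<in> B" if "x \<in> Pures" for x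
  proof -
    have "Gens - {1, x} = insert 2 (Pures - {x})" using that by auto
    then show ?thesis using crits_iff(3)[of "Pures - {x}"] sets_Pures by auto
  qed
  have "Gens - {1, 2} \<notin> crits"
  proof -
    have "Gens - {1, 2} = Pures" by auto
    then show ?thesis using crits_iff(4)[of Pures] sets_Pures by simp
  qed
  \<comment> \<open>\<open>P1\<close> lies in \<open>A\<close>, and \<open>A - P1\<close> lies in
    \<open>B\<close>, so the two kinds of complements together are indexed by
    \<open>A \<inter> B\<close>.\<close>
  have AB: "A \<inter> B = (A - P1) \<union> (P1 \<inter> B)" using sets_rel by blast
  have eq: "{T \<in> crits. card T = n} = ?f ` (P1 \<times> P2) \<union> ?h ` (A \<inter> B)"
  proof (intro equalityI subsetI)
    fix T assume "T \<in> {T \<in> crits. card T = n}"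
    then have T: "T \<in> crits" "card T = n" by auto
    then have "card (Gens - T) = 2" using co by simp
    then obtain x y where xy: "Gens - T = {x, y}" "x < y" by (metis card_2_iff insert_commute linorder_neqE_nat)
    then have eq: "T = Gens - {x, y}" using crits_subset[OF T(1)] by blast
    have G: "x \<in> Gens" "y \<in> Gens" using xy by blast+
    consider "x = 1" "y = 2" | "x = 1" "y \<in> Pures" | "x = 2" "y \<in> Pures" | "x \<in> Pures" "y \<in> Pures"
      using G xy(2) by force
    then show "T \<in> ?f ` (P1 \<times> P2) \<union> ?h ` (A \<inter> B)"
    proof cases
      case 1
      then show ?thesis using T \<open>Gens - {1, 2} \<notin> crits\<close> eq by simp
    next
      case 2
      then have "y \<in> P1 \<inter> B" using T crit1 eq by simp
      then show ?thesis using AB eq 2 by (intro UnI2 image_eqI[of _ _ y]) auto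
    next
      case 3
      then have "y \<in> A - P1" using T crit2 eq by simp
      then show ?thesis using AB eq 3 by (intro UnI2 image_eqI[of _ _ y]) auto
    next
      case 4
      then have "(x \<in> P1 \<and> y \<in> P2) \<or> (y \<in> P1 \<and> x \<in> P2)" using T crit12 xy(2) eq by auto
      then show ?thesis using eq by (auto simp: insert_commute)
    qed
  next
    fix T assume T: "T \<in> ?f ` (P1 \<times> P2) \<union> ?h ` (A \<inter> B)"
    have cardT: "card (Gens - {x, y}) = n" if "x \<in> Gens" "y \<in> Gens" "x \<noteq> y" for x y
      using that by (simp add: card_Diff_subset)
    from T show "T \<in> {T \<in> crits. card T = n}"
    proof
      assume "T \<in> ?f ` (P1 \<times> P2)"
      then obtain x y where xy: "x \<in> P1" "y \<in> P2" "T = Gens - {x, y}" by auto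
      then have "x \<in> Pures" "y \<in> Pures" "x \<noteq> y" using sets_Pures sets_rel(5) by blast+
      then show ?thesis using crit12[of x y] cardT[of x y] xy by simp
    next
      assume "T \<in> ?h ` (A \<inter> B)"
      then obtain x where x: "x \<in> A" "x \<in> B" "T = ?h x" by auto
      then have "x \<in> Pures" using sets_Pures by blast
      then show ?thesis using crit1[of x] crit2[of x] cardT[of 1 x] cardT[of 2 x] x by auto
    qed
  qed
  have inj_f: "inj_on ?f (P1 \<times> P2)"
  proof (rule inj_onI, clarify)
    fix x y x' y' assume *: "x \<in> P1" "y \<in> P2" "x' \<in> P1" "y' \<in> P2" "Gens - {x, y} = Gens - {x', y'}"
    then have "{x, y} \<subseteq> Gens" "{x', y'} \<subseteq> Gens" using ge3[of x] ge3[of y] ge3[of x'] ge3[of y'] by auto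
    then have "{x, y} = {x', y'}" using *(5) by blast
    then show "x = x' \<and> y = y'" using * sets_rel(5) by (auto simp: doubleton_eq_iff)
  qed
  have inj_h: "inj_on ?h (A \<inter> B)"
  proof (rule inj_onI)
    fix x y assume *: "x \<in> A \<inter> B" "y \<in> A \<inter> B" "?h x = ?h y"
    have x: "x \<noteq> 1" "x \<noteq> 2" "x \<in> Gens" using *(1) ge3[of x] by auto
    have "x \<notin> ?h y" using *(3)[symmetric] by simp
    then have "x \<in> {if y \<in> P1 then 1 else 2, y}" using x(3) by blast
    then show "x = y" using x(1,2) by (cases "y \<in> P1") simp_all
  qed
  have disj: "?f ` (P1 \<times> P2) \<inter> ?h ` (A \<inter> B) = {}"
  proof -
    have "1 \<in> ?f z \<and> 2 \<in> ?f z" if z: "z \<in> P1 \<times> P2" for z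
    proof -
      have "3 \<le> fst z" "3 \<le> snd z" using z ge3[of "fst z"] ge3[of "snd z"] by auto
      then show ?thesis by (auto simp: case_prod_beta)
    qed
    moreover have "\<not> (1 \<in> ?h x \<and> 2 \<in> ?h x)" for x by (cases "x \<in> P1") simp_all
    ultimately show ?thesis unfolding disjoint_iff image_iff by metis
  qed
  have "card {T \<in> crits. card T = n} = card (?f ` (P1 \<times> P2)) + card (?h ` (A \<inter> B))"
    unfolding eq by (rule card_Un_disjoint[OF _ _ disj]) (use finite_sets in auto)
  also have "\<dots> = card P1 * card P2 + card (A \<inter> B)"
    unfolding card_image[OF inj_f] card_image[OF inj_h] card_cartesian_product ..
  finally show ?card by (simp only: add.commute)
qed

end

section \<open>Betti numbers and type of I\<close>

context two_generators
begin

definition I_expos :: "expo set" where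
  "I_expos = {m \<in> expos n. \<exists>k\<in>Gens. gen a b e k \<preceq> m}"

lemma I_expos_up: "m \<in> I_expos \<Longrightarrow> m' \<in> expos n \<Longrightarrow> m \<preceq> m' \<Longrightarrow> m' \<in> I_expos"
  unfolding I_expos_def using expo_le_trans by blast

lemma gen_nonzero: "k \<in> Gens \<Longrightarrow> gen a b e k \<noteq> 0"
proof -
  assume k: "k \<in> Gens"
  have "a \<noteq> 0" "b \<noteq> 0" using not_le by (auto simp: expo_le_def)
  moreover have "0 < e (k - 2)" if "k \<noteq> 1" "k \<noteq> 2"
  proof -
    have "k - 2 \<in> {1..n}" using k that by auto
    then show ?thesis using e[of "k - 2"] by linarith
  qed
  ultimately show ?thesis by (auto simp: gen_def poly_mapping_eq_iff[of "single _ _"] fun_eq_iff lookup_single when_def)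
qed

lemma zero_notin_I_expos: "0 \<notin> I_expos"
proof
  assume "0 \<in> I_expos"
  then obtain k where "k \<in> Gens" "gen a b e k \<preceq> 0" by (auto simp: I_expos_def)
  then show False using gen_nonzero[of k] expo_le_antisym[of "gen a b e k" 0] by (simp add: expo_le_def)
qed

lemma edges_subset: "edges \<subseteq> Pow Gens \<times> Pow Gens"
  using edges_lab(2,3) by (clarify, blast)

lemma finite_edges: "finite edges"
  using edges_subset by (rule finite_subset) simp

text \<open>In the square over \<open>Q\<close>, a matched corner \<open>q\<close> with one extra
  element has only \<open>p\<close> above it, and a corner \<open>p\<close> with one extra element
  has only \<open>q\<close> below it. A detour needs a second set on both sides.\<close>

lemma edges_sparse:
  assumes pq: "(p, q) \<in> edges" and j: "j \<subseteq> Gens" "lab j = lab p" "\<exists>x\<in>j. q = j - {x}" "j \<noteq> p"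
    and k: "lab k = lab p" "\<exists>x\<in>p. k = p - {x}" "k \<noteq> q"
  shows False
proof -
  obtain Q where Q: "Q \<subseteq> Pures" and cases:
    "(p = insert 1 (insert 2 Q) \<and> q = insert 2 Q) \<or> (p = insert 1 (insert 2 Q) \<and> q = insert 1 Q) \<or>
     (p = insert 1 Q \<and> q = Q) \<or> (p = insert 2 Q \<and> q = Q)"
    using pq unfolding edges_iff by blast
  note no = pure_part(5,6)[OF Q]
  obtain x where x: "x \<in> j" "q = j - {x}" using j by blast
  obtain y where y: "y \<in> p" "k = p - {y}" using k by blast
  have "lab j = lab q" using j(2) edges_lab(1)[OF pq] by simp
  then have x12: "x = 1 \<or> x = 2" using lab_eq_remove[OF j(1) x(1)] x(2) by simp
  have y12: "y = 1 \<or> y = 2" using lab_eq_remove[OF edges_lab(2)[OF pq] y(1)] k(1) y(2) by simp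
  have "x \<notin> q" "j = insert x q" using x by auto
  moreover have "insert 1 (insert 2 Q) - {1} = insert 2 Q" "insert 1 (insert 2 Q) - {2} = insert 1 Q"
    "insert 1 Q - {1} = Q" "insert 2 Q - {2} = Q" using no by auto
  ultimately show False
    using cases x12 y12 y no j(4) k(3) by (elim disjE conjE) (simp_all add: insert_commute)
qed

text \<open>Instantiates the elimination with the Taylor complex. The empty set survives as root
  because \<open>A\<close> and \<open>B\<close> are nonempty.\<close>

lemma minimal_rooted_crits:
  "\<exists>c :: nat set \<Rightarrow> nat set \<Rightarrow> 'k::field. minimal_rooted n I_expos crits card lab c {}"
proof -
  have res: "resolving I_expos (Pow Gens) card lab (taylor :: _ \<Rightarrow> _ \<Rightarrow> 'k)"
    by (rule resolving_taylor[OF _ lab_le_iff]) (auto simp: I_expos_def)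
  have "\<exists>c. resolving I_expos (Pow Gens - (fst ` edges \<union> snd ` edges)) card lab c \<and>
     (\<forall>j\<in>Pow Gens - (fst ` edges \<union> snd ` edges). \<forall>k\<in>Pow Gens - (fst ` edges \<union> snd ` edges).
       lab j = lab k \<longrightarrow> c j k = (taylor j k :: 'k))"
  proof (rule resolving_matching[OF res finite_edges])
    show "edges \<subseteq> Pow Gens \<times> Pow Gens" by (rule edges_subset)
    show "(p, q) = (p', q')" if "(p, q) \<in> edges" "(p', q') \<in> edges" "{p, q} \<inter> {p', q'} \<noteq> {}" for p q p' q'
      by (rule edges_disjoint[OF that])
    show "lab p = lab q" if "(p, q) \<in> edges" for p q by (rule edges_lab(1)[OF that])
    show "taylor p q \<noteq> (0 :: 'k)" if "(p, q) \<in> edges" for p q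
    proof -
      have "finite p" using edges_lab(2)[OF that] finite_subset by blast
      then show ?thesis using edges_lab(4)[OF that] by (auto simp: taylor_remove taylor_sign_neq_0)
    qed
    show False if "(p, q) \<in> edges" "j \<in> Pow Gens" "k \<in> Pow Gens" "j \<noteq> p" "k \<noteq> q"
      "lab j = lab p" "lab k = lab p" "taylor j q \<noteq> (0 :: 'k)" "taylor p k \<noteq> (0 :: 'k)" for p q j k
      using edges_sparse[OF that(1) _ that(6) taylor_nonzero[OF that(8)] that(4,7) taylor_nonzero[OF that(9)] that(5)]
        that(2) by simp
  qed
  then have "\<exists>c. resolving I_expos crits card lab c \<and>
     (\<forall>j\<in>crits. \<forall>k\<in>crits. lab j = lab k \<longrightarrow> c j k = (taylor j k :: 'k))"
    unfolding crits_eq .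
  then obtain c :: "nat set \<Rightarrow> nat set \<Rightarrow> 'k" where "resolving I_expos crits card lab c \<and>
     (\<forall>j\<in>crits. \<forall>k\<in>crits. lab j = lab k \<longrightarrow> c j k = taylor j k)" ..
  then have c: "resolving I_expos crits card lab c"
    and same: "\<And>j k. j \<in> crits \<Longrightarrow> k \<in> crits \<Longrightarrow> lab j = lab k \<Longrightarrow> c j k = taylor j k"
    by simp_all
  have "minimal_rooted n I_expos crits card lab c {}"
  proof
    show "resolving I_expos crits card lab c" by (rule c)
    show "I_expos \<subseteq> expos n" by (auto simp: I_expos_def)
    show "m' \<in> I_expos" if "m \<in> I_expos" "m' \<in> expos n" "m \<preceq> m'" for m m' using I_expos_up that by blast
    show "{} \<in> crits" using crits_iff(4)[of "{}"] AB_nonempty by auto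
    show "lab {} = 0" by (rule poly_mapping_eqI) (simp add: lookup_lab expo_at_def)
    show "card T = 0 \<longleftrightarrow> T = {}" if "T \<in> crits" for T
      using crits_subset[OF that] finite_subset by (metis card_eq_0_iff finite_atLeastAtMost)
    show "lab T \<in> I_expos" if T: "T \<in> crits" "T \<noteq> {}" for T
    proof -
      obtain k where "k \<in> T" using T by blast
      then have "gen a b e k \<preceq> lab T" using lab_le_iff[OF crits_subset[OF T(1)], of "lab T"] by simp
      then show ?thesis using lab_expos crits_subset[OF T(1)] \<open>k \<in> T\<close> by (auto simp: I_expos_def)
    qed
    \<comment> \<open>Between equal labels the surviving entries are still Taylor entries, so a
      nonzero one would come from removing a single element.\<close>
    show "c j k = 0" if jk: "j \<in> crits" "k \<in> crits" "lab j = lab k" for j k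
    proof (rule ccontr)
      assume "c j k \<noteq> 0"
      then obtain x where "x \<in> j" "k = j - {x}" using same[OF jk] taylor_nonzero by fastforce
      then show False using crits_minimal jk by blast
    qed
  qed
  then show ?thesis by blast
qed

text \<open>The resolution of \<open>I\<close> is shifted by one, hence size \<open>i + 1\<close>;
  the type is read off the unshifted resolution of \<open>S/I\<close> in homological degree
  \<open>n\<close>.\<close>

theorem betti_numbers_and_type:
  shows "betti_mg n (mono_ideal I_expos) (mono_ideal {} :: 'k::field mpoly set) i u =
      (if u \<in> {lab T | T. critical n edges T \<and> card T = i + 1} then 1 else 0)"
    and "cm_type n (mono_ideal I_expos :: 'k mpoly set) = card (A \<inter> B) + card P1 * card P2"
proof -
  obtain c :: "nat set \<Rightarrow> nat set \<Rightarrow> 'k" where "minimal_rooted n I_expos crits card lab c {}"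
    using minimal_rooted_crits by blast
  then interpret minimal_rooted n I_expos crits card lab c "{}" .
  interpret I: monomial_ideals n I_expos "{}"
    by unfold_locales (auto simp: I_expos_def)
  interpret S: monomial_ideals n "expos n" I_expos
    by unfold_locales (auto intro: I_expos_up)
  have "betti_mg n (mono_ideal I_expos) (mono_ideal {} :: 'k mpoly set) i u = count_list (degs (shift F) i) u"
    by (rule I.betti_mg_eq[OF minimal_free_resolution_shift_F])
  also have "degs (shift F) i = map lab (vs (Suc i))" by (simp add: shift_def degs_F)
  also have "count_list (map lab (vs (Suc i))) u = (if u \<in> set (map lab (vs (Suc i))) then 1 else 0)"
  proof (rule count_list_distinct)
    have "inj_on lab (set (vs (Suc i)))"
      using lab_inj_on_crits by (auto simp: inj_on_def level_list(2)[OF fin])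
    then show "distinct (map lab (vs (Suc i)))" using level_list(1)[OF fin] by (simp add: distinct_map)
  qed
  also have "set (map lab (vs (Suc i))) = {lab T | T. critical n edges T \<and> card T = i + 1}"
    unfolding set_map level_list(2)[OF fin] by (auto simp: crits_def)
  finally show "betti_mg n (mono_ideal I_expos) (mono_ideal {} :: 'k mpoly set) i u =
      (if u \<in> {lab T | T. critical n edges T \<and> card T = i + 1} then 1 else 0)" .
  have len: "length (vs i) = card {T \<in> crits. card T = i}" for i
    using distinct_card[OF level_list(1)[OF fin]] level_list(2)[OF fin] by metis
  \<comment> \<open>Guarantees a critical set of size \<open>n\<close>, so that the projective
    dimension is \<open>n\<close> and not smaller.\<close>
  have pos: "0 < card P1 * card P2" using P_nonempty finite_sets by (simp add: card_gt_0_iff)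
  have "proj_dim n (mono_ideal (expos n)) (mono_ideal I_expos :: 'k mpoly set) = n"
  proof (rule S.proj_dim_eq[OF minimal_free_resolution_F])
    show "degs F n \<noteq> []" using len[of n] card_crits pos by (auto simp: degs_F)
    show "degs F i = []" if "n < i" for i
    proof -
      have "{T \<in> crits. card T = i} = {}" using card_crits_le that by fastforce
      then have "length (vs i) = 0" unfolding len by (simp only: card.empty)
      then show ?thesis by (simp add: degs_F)
    qed
  qed
  then show "cm_type n (mono_ideal I_expos :: 'k mpoly set) = card (A \<inter> B) + card P1 * card P2"
    unfolding cm_type_def carrier_polyring
    by (simp add: S.betti_eq[OF minimal_free_resolution_F] degs_F len card_crits)
qed

lemma cohen_macaulay_I: "cohen_macaulay n (mono_ideal I_expos :: 'k::field mpoly set)"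
proof (rule cohen_macaulay_artinian[OF _ I_expos_up zero_notin_I_expos])
  show "I_expos \<subseteq> expos n" by (auto simp: I_expos_def)
  show "single i (e i) \<in> I_expos" if i: "i \<in> {1..n}" for i
  proof -
    have k: "i + 2 \<in> Gens" "gen a b e (i + 2) = single i (e i)" using i by (auto simp: gen_def)
    then show ?thesis unfolding I_expos_def using gen_expos[OF k(1)] expo_le_refl by force
  qed
qed

lemma genideal_I:
  "genideal (polyring n) ({xpow a, xpow b} \<union> (\<lambda>i. xpow (single i (e i))) ` {1..n}) =
    (mono_ideal I_expos :: 'k::field mpoly set)"
proof -
  have gens: "gen a b e ` Gens = {a, b} \<union> (\<lambda>i. single i (e i)) ` {1..n}"
  proof -
    have "Gens = {1, 2} \<union> (\<lambda>i. i + 2) ` {1..n}"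
    proof (intro equalityI subsetI)
      fix k assume "k \<in> Gens"
      then consider "k = 1" | "k = 2" | "k - 2 \<in> {1..n}" "k = k - 2 + 2" by force
      then show "k \<in> {1, 2} \<union> (\<lambda>i. i + 2) ` {1..n}" by cases (auto intro: image_eqI[of _ _ "k - 2"])
    qed auto
    then have "gen a b e ` Gens = {a, b} \<union> (\<lambda>i. gen a b e (i + 2)) ` {1..n}"
      by (simp only: image_Un image_image) (simp add: gen_def insert_commute)
    also have "(\<lambda>i. gen a b e (i + 2)) ` {1..n} = (\<lambda>i. single i (e i)) ` {1..n}"
      by (rule image_cong) (auto simp: gen_def)
    finally show ?thesis .
  qed
  have "{xpow a, xpow b} \<union> (\<lambda>i. xpow (single i (e i))) ` {1..n} = (xpow ` gen a b e ` Gens :: 'k mpoly set)"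
    unfolding gens by (simp add: image_Un image_image)
  moreover have "genideal (polyring n) (xpow ` gen a b e ` Gens) = (mono_ideal I_expos :: 'k mpoly set)"
    using gen_expos by (subst genideal_xpow) (auto simp: I_expos_def)
  ultimately show ?thesis by simp
qed

end

text \<open>Its contrapositive turns non-divisibility of the polynomials \<open>u_1\<close> and
  \<open>u_2\<close> into the order condition \<open>not_le\<close>.\<close>

lemma xpow_dvd: "m \<preceq> m' \<Longrightarrow> (xpow m :: 'k::field mpoly) dvd xpow m'"
proof -
  assume "m \<preceq> m'"
  then have "m' = m + (m' - m)" by (metis add.commute expo_le_diff_add)
  then have "xpow m' = (xpow m * xpow (m' - m) :: 'k mpoly)" by (simp add: xpow_def mult_single)
  then show ?thesis by simp
qed

theorem corollary6p1:
  fixes n :: nat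
    and a b :: expo
    and e :: "nat \<Rightarrow> nat"
    and I :: "'k::field mpoly set"
  assumes "a \<in> expos n" and "b \<in> expos n"
    and "\<not> (xpow a :: 'k mpoly) dvd xpow b" and "\<not> (xpow b :: 'k mpoly) dvd xpow a"
    and "\<not> (\<exists>i\<in>{1..n}. \<exists>k. a = Poly_Mapping.single i k)"
    and "\<not> (\<exists>i\<in>{1..n}. \<exists>k. b = Poly_Mapping.single i k)"
    and "\<forall>i\<in>{1..n}. Poly_Mapping.lookup a i + Poly_Mapping.lookup b i > 0"
    and "\<forall>i\<in>{1..n}. e i > max (Poly_Mapping.lookup a i) (Poly_Mapping.lookup b i)"
    and "I = genideal (polyring n)
               ({xpow a, xpow b} \<union> (\<lambda>i. xpow (Poly_Mapping.single i (e i))) ` {1..n})"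
  shows "(\<forall>i. \<forall>u \<in> expos n. betti_mg n I {0} i u =
            (if u \<in> {lcm_label n a b e T | T. critical n (matching n a b) T \<and> card T = i + 1}
             then 1 else 0)) \<and>
         cohen_macaulay n I \<and>
         cm_type n I = card (set_A n a \<inter> set_B n b) + card (set_P1 n a b) * card (set_P2 n a b)"
proof -
  interpret two_generators n a b e
  proof
    show "\<not> a \<preceq> b" "\<not> b \<preceq> a" using assms(3,4) xpow_dvd by blast+
  qed (use assms in auto)
  have I: "I = mono_ideal I_expos" unfolding assms(9) by (rule genideal_I)
  have zero: "{0} = (mono_ideal {} :: 'k mpoly set)" by (auto simp: mono_ideal_def)
  show ?thesis
    unfolding I zero using betti_numbers_and_type cohen_macaulay_I by blast
qed

end
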